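(* Let $n\ge 1$ and suppose that $\mathfrak{M}_1$ and $\mathfrak{M}_2$ are spaces homeomorphic to toroidal solenoids $\mathcal{S}_{\mathcal{P}_1}$ and $\mathcal{S}_{\mathcal{P}_2}$, respectively, of the same dimension $n$. Then $\mathfrak{M}_1$ and $\mathfrak{M}_2$ are homeomorphic if and only if the holonomy pseudogroup actions associated to $\mathfrak{M}_1$ and $\mathfrak{M}_2$ are return equivalent.
   Context: **Weak and toroidal solenoids.** A presentation is a sequence $\mathcal{P}=\{p_{\ell+1}\colon M_{\ell+1}\to M_\ell \mid \ell\ge 0\}$ in which each $M_\ell$ is a connected closed manifold of dimension $n$ and each $p_{\ell+1}$ is a finite covering map of degree at least $2$. The weak solenoid of dimension $n$ defined by $\mathcal{P}$ is the inverse limit $\mathcal{S}_{\mathcal{P}}=\varprojlim\{p_{\ell+1}\colon M_{\ell+1}\to M_\ell\}\subset\prod_{\ell\ge0}M_\ell$ with the topology induced from the product topology; $M_0$ is its base manifold. It is a compact connected foliated space whose leaves are its path components. It is a toroidal solenoid if every $M_\ell$ is homeomorphic to the $n$-torus $\mathbb{T}^n$. **Global monodromy action.** Let $\Pi_0\colon\mathcal{S}_{\mathcal{P}}\to M_0$ be the projection, $x_0\in M_0$ a basepoint, $G_0=\pi_1(M_0,x_0)$, and $\mathfrak{X}_0=\Pi_0^{-1}(x_0)$, a Cantor set. For $y\in\mathfrak{X}_0$ the restriction of $\Pi_0$ to the leaf $L_y$ through $y$ (with its leaf topology) is a covering map onto $M_0$. For $g\in G_0$ represented by a loop $\sigma$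 at $x_0$, let $\Phi(g)(y)$ be the endpoint of the lift of $\sigma$ to $L_y$ starting at $y$. This defines a minimal action $\Phi\colon G_0\times\mathfrak{X}_0\to\mathfrak{X}_0$, the global monodromy action. **Return equivalence.** For an action $\varphi\colon G\times\mathfrak{X}\to\mathfrak{X}$ on a Cantor space and an open subset $W\subset\mathfrak{X}$, put $$\Psi^*(\varphi,W)=\{\varphi(g)|_U\colon U\to\varphi(g)(U)\ \mid\ U\subset W \text{ open},\ g\in G,\ \varphi(g)(U)\subset W\}.$$ Minimal actions $\varphi_i\colon G_i\times\mathfrak{X}_i\to\mathfrak{X}_i$ on Cantor spaces, $i=1,2$, are return equivalent if there are non-empty open sets $W_i\subset\mathfrak{X}_i$ and a homeomorphism $h\colon W_1\to W_2$ which conjugates $\Psi^*(\varphi_1,W_1)$ to $\Psi^*(\varphi_2,W_2)$ (that is, $\alpha\mapsto h\circ\alpha\circ h^{-1}$ is a bijection from the first collection onto the second). The holonomy pseudogroup actions associated to weak solenoids (or to spaces homeomorphic to them) are return equivalent when the corresponding global monodromy actions are return equivalent in this sense. *)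

theory Defs
  imports "HOL-Analysis.Analysis" "HOL-Algebra.Group"
begin

section \<open>Presentations and weak solenoids\<close>

definition closed_manifold :: "nat \<Rightarrow> 'a topology \<Rightarrow> bool" where
  "closed_manifold n X \<longleftrightarrow>
     compact_space X \<and> Hausdorff_space X \<and> second_countable X \<and>
     (\<forall>x\<in>topspace X. \<exists>U V. openin X U \<and> x \<in> U \<and> openin (Euclidean_space n) V \<and>
        subtopology X U homeomorphic_space subtopology (Euclidean_space n) V)"

text \<open>The analogue, for abstract topologies, of the library's \<^const>\<open>covering_space\<close>.\<close>

definition covering_map :: "'a topology \<Rightarrow> 'b topology \<Rightarrow> ('a \<Rightarrow> 'b) \<Rightarrow> bool" where
  "covering_map X Y p \<longleftrightarrow>
     continuous_map X Y p \<and> p ` topspace X = topspace Y \<and>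
     (\<forall>y\<in>topspace Y. \<exists>V. openin Y V \<and> y \<in> V \<and>
        (\<exists>\<U>. \<Union>\<U> = {x \<in> topspace X. p x \<in> V} \<and> pairwise disjnt \<U> \<and>
             (\<forall>U\<in>\<U>. openin X U \<and> homeomorphic_map (subtopology X U) (subtopology Y V) p)))"

text \<open>Since \<^term>\<open>card\<close> of an infinite set is 0, a positive degree forces finite fibres.\<close>

definition covering_of_degree :: "nat \<Rightarrow> 'a topology \<Rightarrow> 'b topology \<Rightarrow> ('a \<Rightarrow> 'b) \<Rightarrow> bool" where
  "covering_of_degree d X Y p \<longleftrightarrow>
     covering_map X Y p \<and> (\<forall>y\<in>topspace Y. card {x \<in> topspace X. p x = y} = d)"

text \<open>The map \<open>p (Suc l)\<close> goes from \<open>M (Suc l)\<close> to \<open>M l\<close>; the value \<open>p 0\<close> is never used.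
  Taking all \<open>M l\<close> on one carrier type loses no generality: any sequence of spaces lives on
  the disjoint union of their carriers.\<close>

definition presentation :: "nat \<Rightarrow> (nat \<Rightarrow> 'a topology) \<Rightarrow> (nat \<Rightarrow> 'a \<Rightarrow> 'a) \<Rightarrow> bool" where
  "presentation n M p \<longleftrightarrow>
     (\<forall>l. topspace (M l) \<noteq> {} \<and> connected_space (M l) \<and> closed_manifold n (M l)) \<and>
     (\<forall>l. \<exists>d\<ge>2. covering_of_degree d (M (Suc l)) (M l) (p (Suc l)))"

definition torus :: "nat \<Rightarrow> (nat \<Rightarrow> complex) topology" where
  "torus n = product_topology (\<lambda>_. top_of_set (sphere 0 1)) {..<n}"

definition toroidal_presentation ::
    "nat \<Rightarrow> (nat \<Rightarrow> 'a topology) \<Rightarrow> (nat \<Rightarrow> 'a \<Rightarrow> 'a) \<Rightarrow> bool" where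
  "toroidal_presentation n M p \<longleftrightarrow>
     presentation n M p \<and> (\<forall>l. M l homeomorphic_space torus n)"

definition solenoid :: "(nat \<Rightarrow> 'a topology) \<Rightarrow> (nat \<Rightarrow> 'a \<Rightarrow> 'a) \<Rightarrow> (nat \<Rightarrow> 'a) topology" where
  "solenoid M p =
     subtopology (product_topology M UNIV) {x. \<forall>l. p (Suc l) (x (Suc l)) = x l}"

section \<open>Leaves and the global monodromy action\<close>

text \<open>In a foliated space, locally (Euclidean ball) \<open>\<times>\<close> (totally disconnected space), every path
  component of an open set is a union of open subsets of plaques, and every connected open subset
  of a plaque is a path component of an open set.  So the topology below is the one generated by
  the plaques, and it induces on each path component its leaf topology.\<close>

definition leaf_topology :: "'a topology \<Rightarrow> 'a topology" where
  "leaf_topology X = topology_generated_by (\<Union>U\<in>{U. openin X U}. path_components_of (subtopology X U))"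

definition leaf :: "'a topology \<Rightarrow> 'a \<Rightarrow> 'a topology" where
  "leaf X y = subtopology (leaf_topology X) (path_component_of_set X y)"

definition loop_at :: "'a topology \<Rightarrow> 'a \<Rightarrow> (real \<Rightarrow> 'a) \<Rightarrow> bool" where
  "loop_at X x \<sigma> \<longleftrightarrow> pathin X \<sigma> \<and> \<sigma> 0 = x \<and> \<sigma> 1 = x"

definition loop_class :: "'a topology \<Rightarrow> 'a \<Rightarrow> (real \<Rightarrow> 'a) \<Rightarrow> (real \<Rightarrow> 'a) set" where
  "loop_class X x \<sigma> =
     {\<tau>. loop_at X x \<tau> \<and> homotopic_with (\<lambda>\<rho>. \<rho> 0 = x \<and> \<rho> 1 = x) (top_of_set {0..1}) X \<sigma> \<tau>}"

definition path_concat :: "(real \<Rightarrow> 'a) \<Rightarrow> (real \<Rightarrow> 'a) \<Rightarrow> real \<Rightarrow> 'a" where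
  "path_concat \<sigma> \<tau> = (\<lambda>t. if t \<le> 1/2 then \<sigma> (2 * t) else \<tau> (2 * t - 1))"

text \<open>The product of the classes of \<open>\<sigma>\<close> and \<open>\<tau>\<close> is the class of the loop that runs through \<open>\<tau>\<close>
  first and then \<open>\<sigma>\<close>; with this order lifting of loops is a left action.\<close>

definition fundamental_group :: "'a topology \<Rightarrow> 'a \<Rightarrow> (real \<Rightarrow> 'a) set monoid" where
  "fundamental_group X x =
     \<lparr>carrier = {loop_class X x \<sigma> |\<sigma>. loop_at X x \<sigma>},
      mult = (\<lambda>a b. \<Union>\<sigma>\<in>a. \<Union>\<tau>\<in>b. loop_class X x (path_concat \<tau> \<sigma>)),
      one = loop_class X x (\<lambda>_. x)\<rparr>"

definition base_fibre ::
    "(nat \<Rightarrow> 'a topology) \<Rightarrow> (nat \<Rightarrow> 'a \<Rightarrow> 'a) \<Rightarrow> 'a \<Rightarrow> (nat \<Rightarrow> 'a) topology" where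
  "base_fibre M p x0 = subtopology (solenoid M p) {y. y 0 = x0}"

definition leaf_lift ::
    "(nat \<Rightarrow> 'a topology) \<Rightarrow> (nat \<Rightarrow> 'a \<Rightarrow> 'a) \<Rightarrow> (nat \<Rightarrow> 'a) \<Rightarrow> (real \<Rightarrow> 'a) \<Rightarrow> (real \<Rightarrow> nat \<Rightarrow> 'a) \<Rightarrow> bool"
  where
  "leaf_lift M p y \<sigma> \<gamma> \<longleftrightarrow>
     pathin (leaf (solenoid M p) y) \<gamma> \<and> \<gamma> 0 = y \<and> (\<forall>t\<in>{0..1}. \<gamma> t 0 = \<sigma> t)"

definition global_monodromy ::
    "(nat \<Rightarrow> 'a topology) \<Rightarrow> (nat \<Rightarrow> 'a \<Rightarrow> 'a) \<Rightarrow> (real \<Rightarrow> 'a) set \<Rightarrow> (nat \<Rightarrow> 'a) \<Rightarrow> nat \<Rightarrow> 'a" where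
  "global_monodromy M p g y = (THE z. \<exists>\<sigma>\<in>g. \<exists>\<gamma>. leaf_lift M p y \<sigma> \<gamma> \<and> z = \<gamma> 1)"

section \<open>Return equivalence\<close>

text \<open>A partial map is encoded as its domain together with a function restricted to it
  (so that equality of encodings is equality of partial maps); its codomain is its image.\<close>

definition local_action ::
    "('g, 'm) monoid_scheme \<Rightarrow> 'x topology \<Rightarrow> ('g \<Rightarrow> 'x \<Rightarrow> 'x) \<Rightarrow> 'x set \<Rightarrow> ('x set \<times> ('x \<Rightarrow> 'x)) set" where
  "local_action G X \<phi> W =
     {(U, restrict (\<phi> g) U) |U g. openin X U \<and> U \<subseteq> W \<and> g \<in> carrier G \<and> \<phi> g ` U \<subseteq> W}"

definition conjugate_by ::
    "('x \<Rightarrow> 'y) \<Rightarrow> 'x set \<Rightarrow> 'x set \<times> ('x \<Rightarrow> 'x) \<Rightarrow> 'y set \<times> ('y \<Rightarrow> 'y)" where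
  "conjugate_by h W = (\<lambda>(U, f). (h ` U, restrict (h \<circ> f \<circ> inv_into W h) (h ` U)))"

definition return_equivalent ::
    "('g, 'm) monoid_scheme \<Rightarrow> 'x topology \<Rightarrow> ('g \<Rightarrow> 'x \<Rightarrow> 'x) \<Rightarrow>
     ('h, 'k) monoid_scheme \<Rightarrow> 'y topology \<Rightarrow> ('h \<Rightarrow> 'y \<Rightarrow> 'y) \<Rightarrow> bool" where
  "return_equivalent G X \<phi> H Y \<psi> \<longleftrightarrow>
     (\<exists>V W h. openin X V \<and> V \<noteq> {} \<and> openin Y W \<and> W \<noteq> {} \<and>
        homeomorphic_map (subtopology X V) (subtopology Y W) h \<and>
        bij_betw (conjugate_by h V) (local_action G X \<phi> V) (local_action H Y \<psi> W))"

end

theory Submission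
  imports Defs
begin

text \<open>
  A toroidal solenoid carries a linear flow that contains all of its structure.  The exponential
  covering of \<open>M 0\<close> by \<open>\<real>\<^sup>n\<close> lifts successively through the bonding maps, and this gives compatible
  maps \<open>u l\<close> from \<open>\<real>\<^sup>n\<close> onto \<open>M l\<close> that identify \<open>M l\<close> with the quotient of \<open>\<real>\<^sup>n\<close> by a subgroup
  \<open>period l\<close> of finite index in \<open>\<int>\<^sup>n\<close> (\<open>toroidal_presentation_imp_torus_tower\<close>).  Translations
  therefore act on all \<open>M l\<close> compatibly, hence on the solenoid.  The lift of a loop to a leaf follows
  the flow, so the global monodromy action is the flow of \<open>\<int>\<^sup>n\<close> on the fibre \<open>X\<close>
  (\<open>local_action_monodromy\<close>).  The cylinders, which consist of the points of \<open>X\<close> with a prescribed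
  coordinate in \<open>M l\<close>, form a base of the topology of \<open>X\<close>, and the integer vectors that map such a
  cylinder to itself are those in \<open>period l\<close>.

  Suppose that \<open>h\<close> conjugates the local actions on open sets \<open>V\<close> and \<open>W\<close>.  An element of the
  local action is the restriction of one group element, so for a cylinder \<open>V'\<close> of level \<open>l\<close> inside
  \<open>V\<close> every \<open>g\<close> in \<open>period l\<close> has a partner \<open>d\<close> in \<open>\<int>\<^sup>n\<close> with \<open>h \<circ> g = d \<circ> h\<close> on \<open>V'\<close>, and the
  partners form a subgroup of finite index.  This relation is the graph of an isomorphism up to the
  vectors that act trivially, and those need not vanish.  For large \<open>l\<close> they are a pure subgroup of
  \<open>period l\<close>, so there are \<open>\<int>\<close>-bases adapted to them, and the relation contains the graph of a linear
  automorphism \<open>L\<close> of \<open>\<real>\<^sup>n\<close> (\<open>linear_isomorphism_of_relation\<close>).  Every point of the solenoid is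
  \<open>t \<cdot> v\<close> with \<open>t\<close> in \<open>\<real>\<^sup>n\<close> and \<open>v\<close> in \<open>V'\<close>, and \<open>t \<cdot> v \<mapsto> L t \<cdot> h v\<close> is the desired homeomorphism
  (\<open>equivariant_extension\<close>).

  Conversely let \<open>\<Phi>\<close> be a homeomorphism of the solenoids.  After composition with a flow map it sends
  some point \<open>y0\<close> of the first fibre into the second one.  The base coordinate of \<open>\<Phi> (x \<cdot> v)\<close>, for \<open>v\<close>
  near \<open>y0\<close>, lifts to a map \<open>F\<close> into \<open>\<real>\<^sup>n\<close>; removing it with the flow leaves a point \<open>h v\<close> of
  the second fibre, which does not depend on \<open>x\<close> because the fibre is totally disconnected.  So
  \<open>\<Phi> (x \<cdot> v) = F (x, v) \<cdot> h v\<close>.  For \<open>g\<close> in \<open>period l\<close> the difference of \<open>F (x + g, v)\<close> and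
  \<open>F (x, g \<cdot> v)\<close> is an integer vector \<open>c\<close> with \<open>h (g \<cdot> v) = c \<cdot> h v\<close>.  It depends on \<open>v\<close> in a locally
  constant way and satisfies a cocycle identity.  As \<open>period l\<close> is finitely generated and \<open>X\<close> is
  compact, the dependence on \<open>v\<close> disappears on a smaller cylinder (\<open>leafwise_lift_exists\<close>), which is
  what a conjugation of local actions requires.  The same construction for the inverse of \<open>\<Phi>\<close>
  inverts \<open>h\<close> near \<open>y0\<close> (\<open>leafwise_lift_round_trip\<close>).
\<close>

section \<open>Covering maps and lifting\<close>

lemma continuous_map_locally:
  assumes "\<And>x. x \<in> topspace X \<Longrightarrow> \<exists>N. openin X N \<and> x \<in> N \<and> continuous_map (subtopology X N) Y f"
  shows "continuous_map X Y f"
proof -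
  obtain N where N: "\<And>x. x \<in> topspace X \<Longrightarrow>
      openin X (N x) \<and> x \<in> N x \<and> continuous_map (subtopology X (N x)) Y f"
    using assms by metis
  show ?thesis
    by (rule pasting_lemma[where I = "topspace X" and T = N and f = "\<lambda>_. f"]) (use N in auto)
qed

lemma covering_map_evenly_covered:
  assumes "covering_map E B p" and "y \<in> topspace B"
  obtains V \<U> where "openin B V" "y \<in> V" "\<Union>\<U> = {x \<in> topspace E. p x \<in> V}" "pairwise disjnt \<U>"
    "\<forall>U\<in>\<U>. openin E U"
    "\<forall>U\<in>\<U>. homeomorphic_map (subtopology E U) (subtopology B V) p"
proof -
  have "\<exists>V. openin B V \<and> y \<in> V \<and> (\<exists>\<U>. \<Union>\<U> = {x \<in> topspace E. p x \<in> V} \<and> pairwise disjnt \<U> \<and>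
      (\<forall>U\<in>\<U>. openin E U \<and> homeomorphic_map (subtopology E U) (subtopology B V) p))"
    using assms unfolding covering_map_def by simp
  then show ?thesis by (elim exE conjE) (rule that, auto)
qed

lemma covering_map_sheet:
  assumes "covering_map E B p" and "e \<in> topspace E"
  obtains V U where "openin B V" "p e \<in> V" "openin E U" "e \<in> U"
    "homeomorphic_map (subtopology E U) (subtopology B V) p"
proof -
  have "p e \<in> topspace B" using assms unfolding covering_map_def by auto
  from assms(1) this obtain V \<U> where V: "openin B V" "p e \<in> V"
    and U: "\<Union>\<U> = {x \<in> topspace E. p x \<in> V}" "pairwise disjnt \<U>" "\<forall>U\<in>\<U>. openin E U"
      "\<forall>U\<in>\<U>. homeomorphic_map (subtopology E U) (subtopology B V) p"
    by (rule covering_map_evenly_covered)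
  have "e \<in> \<Union>\<U>" using U(1) V assms(2) by simp
  then show ?thesis using that V U by blast
qed

text \<open>At a point of the domain the two lifts lie either in the same sheet, and then they coincide nearby
  because \<open>p\<close> is injective there, or in disjoint sheets, and then they differ nearby.  So the set of
  coincidence is open and closed.\<close>

lemma lift_unique:
  assumes cov: "covering_map E B p" and X: "connected_space X"
    and f: "continuous_map X E f" and g: "continuous_map X E g"
    and fg: "\<And>x. x \<in> topspace X \<Longrightarrow> p (f x) = p (g x)"
    and x0: "x0 \<in> topspace X" "f x0 = g x0" and x: "x \<in> topspace X"
  shows "f x = g x"
proof -
  define A where "A = {x \<in> topspace X. f x = g x}"
  have fE: "f x \<in> topspace E" and gE: "g x \<in> topspace E" if "x \<in> topspace X" for x
    using that f g by (auto simp: continuous_map_def)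
  have "\<exists>T. openin X T \<and> x \<in> T \<and> (if x \<in> A then T \<subseteq> A else T \<subseteq> topspace X - A)"
    if x: "x \<in> topspace X" for x
  proof -
    have "p (f x) \<in> topspace B" using cov fE[OF x] unfolding covering_map_def by auto
    from cov this obtain V \<U> where V: "openin B V" "p (f x) \<in> V" and \<U>: "\<Union>\<U> = {x \<in> topspace E. p x \<in> V}"
        "pairwise disjnt \<U>" "\<forall>U\<in>\<U>. openin E U"
        "\<forall>U\<in>\<U>. homeomorphic_map (subtopology E U) (subtopology B V) p"
      by (rule covering_map_evenly_covered)
    have "f x \<in> \<Union>\<U>" "g x \<in> \<Union>\<U>" using fE[OF x] gE[OF x] fg[OF x] V \<U> by auto
    then obtain U U' where U: "U \<in> \<U>" "f x \<in> U" and U': "U' \<in> \<U>" "g x \<in> U'" by blast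
    have inj: "inj_on p U"
      using homeomorphic_imp_injective_map[OF \<U>(4)[rule_format, OF U(1)]] openin_subset[OF \<U>(3)[rule_format, OF U(1)]]
      by (simp add: inf.absorb2)
    define T where "T = {x \<in> topspace X. f x \<in> U} \<inter> {x \<in> topspace X. g x \<in> U'}"
    have op: "openin X T"
      unfolding T_def using \<U>(3) U U' f g by (intro openin_Int openin_continuous_map_preimage) auto
    have xT: "x \<in> T" using x U U' by (simp add: T_def)
    show ?thesis
    proof (cases "U = U'")
      case True
      have "T \<subseteq> A"
        using inj fg by (fastforce simp: T_def A_def True inj_on_def)
      with xT op show ?thesis by (intro exI[of _ T]) auto
    next
      case False
      then have "U \<inter> U' = {}" using \<U>(2) U U' by (auto simp: pairwise_def disjnt_def)
      then have "T \<subseteq> topspace X - A" by (auto simp: T_def A_def)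
      with xT op show ?thesis by (intro exI[of _ T]) auto
    qed
  qed
  note key = this
  have "openin X A"
    by (subst openin_subopen) (use key in \<open>fastforce simp: A_def\<close>)
  moreover have "openin X (topspace X - A)"
    by (subst openin_subopen) (use key in fastforce)
  ultimately have "A = {} \<or> A = topspace X"
    using X unfolding connected_space_clopen_in
    by (metis A_def closedin_def mem_Collect_eq subsetI)
  then show ?thesis using x0 x by (auto simp: A_def)
qed

text \<open>The possibility of continuing every local lift near \<open>y0\<close> from time \<open>a\<close> to time \<open>b\<close> is inherited
  by the union of adjacent intervals, and it holds for short intervals, on which \<open>H\<close> stays in one
  evenly covered set.  Bisection then gives it for all intervals.  The quantifier over the initial
  lifts is what makes the statement additive, since the neighbourhood of \<open>y0\<close> shrinks at each step.\<close>

lemma homotopy_lift_near: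
  fixes H :: "'y \<times> real \<Rightarrow> 'b"
  assumes cov: "covering_map E B p"
    and H: "continuous_map (prod_topology Y euclideanreal) B H"
    and y0: "y0 \<in> topspace Y" and "a \<le> b"
  shows "\<forall>N g. openin Y N \<longrightarrow> y0 \<in> N \<longrightarrow> continuous_map (subtopology Y N) E g \<longrightarrow>
       (\<forall>y\<in>N. p (g y) = H (y, a)) \<longrightarrow>
     (\<exists>N' G. openin Y N' \<and> y0 \<in> N' \<and> N' \<subseteq> N \<and>
        continuous_map (prod_topology (subtopology Y N') (top_of_set {a..b})) E G \<and>
        (\<forall>y\<in>N'. G (y, a) = g y \<and> (\<forall>t\<in>{a..b}. p (G (y, t)) = H (y, t))))"
    (is "?P a b")
  using \<open>a \<le> b\<close>
proof (induction rule: Bolzano)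
  case (trans a b c)
  show ?case
  proof (intro allI impI)
    fix N g assume N: "openin Y N" "y0 \<in> N" "continuous_map (subtopology Y N) E g"
      "\<forall>y\<in>N. p (g y) = H (y, a)"
    then obtain N1 G1 where 1: "openin Y N1" "y0 \<in> N1" "N1 \<subseteq> N"
        "continuous_map (prod_topology (subtopology Y N1) (top_of_set {a..b})) E G1"
        "\<forall>y\<in>N1. G1 (y, a) = g y \<and> (\<forall>t\<in>{a..b}. p (G1 (y, t)) = H (y, t))"
      using trans(1)[THEN spec, THEN spec, THEN mp, THEN mp, THEN mp, THEN mp, OF N] by (elim exE conjE) (rule that)
    have "continuous_map (subtopology Y N1) E (G1 \<circ> (\<lambda>y. (y, b)))"
      by (rule continuous_map_compose[OF _ 1(4)])
        (use trans(3) in \<open>auto intro!: continuous_map_pairedI\<close>)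
    then obtain N2 G2 where 2: "openin Y N2" "y0 \<in> N2" "N2 \<subseteq> N1"
        "continuous_map (prod_topology (subtopology Y N2) (top_of_set {b..c})) E G2"
        "\<forall>y\<in>N2. G2 (y, b) = G1 (y, b) \<and> (\<forall>t\<in>{b..c}. p (G2 (y, t)) = H (y, t))"
      using trans(2)[rule_format, of N1 "\<lambda>y. G1 (y, b)"] 1 trans(3) by (auto simp: o_def)
    define G where "G = (\<lambda>z. if snd z \<le> b then G1 z else G2 z)"
    let ?X = "prod_topology (subtopology Y N2) (top_of_set {a..c})"
    have "continuous_map ?X E G"
      unfolding G_def
    proof (rule continuous_map_cases_le)
      show "continuous_map ?X euclideanreal snd"
        by (metis continuous_map_in_subtopology continuous_map_snd)
      have 12: "N1 \<inter> N2 = N2" "N2 \<inter> N1 = N2" using 2 by auto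
      have "subtopology ?X {x \<in> topspace ?X. snd x \<le> b}
          = subtopology (prod_topology (subtopology Y N1) (top_of_set {a..b})) (N2 \<times> {a..b})"
        using trans(3,4) openin_subset[OF 2(1)] 
        by (auto simp flip: subtopology_Times simp: subtopology_subtopology Times_Int_Times 12 subset_iff
            intro!: arg_cong[of _ _ "subtopology _"] 2(3)[THEN subsetD])
      then show "continuous_map (subtopology ?X {x \<in> topspace ?X. snd x \<le> b}) E G1"
        using 1(4) by (simp add: continuous_map_from_subtopology)
      show "continuous_map (subtopology ?X {x \<in> topspace ?X. b \<le> snd x}) E G2"
      proof -
        have "subtopology ?X {x \<in> topspace ?X. b \<le> snd x}
            = subtopology (prod_topology (subtopology Y N2) (top_of_set {b..c})) UNIV"
          using trans(3,4) openin_subset[OF 2(1)]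
          by (auto simp flip: subtopology_Times simp: subtopology_subtopology Times_Int_Times 12 subset_iff
              intro!: arg_cong[of _ _ "subtopology _"])
        then show ?thesis using 2(4) by simp
      qed
    qed (use 2 in auto)
    moreover have "\<forall>y\<in>N2. G (y, a) = g y \<and> (\<forall>t\<in>{a..c}. p (G (y, t)) = H (y, t))"
      using 1 2 trans(3) by (auto simp: G_def subset_iff)
    ultimately show "\<exists>N' G. openin Y N' \<and> y0 \<in> N' \<and> N' \<subseteq> N \<and>
        continuous_map (prod_topology (subtopology Y N') (top_of_set {a..c})) E G \<and>
        (\<forall>y\<in>N'. G (y, a) = g y \<and> (\<forall>t\<in>{a..c}. p (G (y, t)) = H (y, t)))"
      using 1(3) 2(1-3) by (intro exI[of _ N2] exI[of _ G]) auto
  qed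
next
  case (local x)
  have x: "(y0, x) \<in> topspace (prod_topology Y euclideanreal)" using y0 by simp
  then have "H (y0, x) \<in> topspace B" using H by (meson continuous_map_image_subset_topspace image_subset_iff)
  from cov this obtain V \<U> where V: "openin B V" "H (y0, x) \<in> V"
    and \<U>: "\<Union>\<U> = {x \<in> topspace E. p x \<in> V}" "pairwise disjnt \<U>" "\<forall>U\<in>\<U>. openin E U"
      "\<forall>U\<in>\<U>. homeomorphic_map (subtopology E U) (subtopology B V) p"
    by (rule covering_map_evenly_covered)
  have "openin (prod_topology Y euclideanreal) {z \<in> topspace (prod_topology Y euclideanreal). H z \<in> V}"
    using H V(1) by (rule openin_continuous_map_preimage)
  from openin_prod_topology_alt[THEN iffD1, rule_format, OF this, of y0 x]
  have "\<exists>N0 J. openin Y N0 \<and> open J \<and> y0 \<in> N0 \<and> x \<in> J \<and>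
      N0 \<times> J \<subseteq> {z \<in> topspace (prod_topology Y euclideanreal). H z \<in> V}"
    using V x by simp
  then obtain N0 J where NJ: "openin Y N0" "open J" "y0 \<in> N0" "x \<in> J"
      "N0 \<times> J \<subseteq> {z \<in> topspace (prod_topology Y euclideanreal). H z \<in> V}"
    by (elim exE conjE) (rule that)
  then obtain d where d: "d > 0" "ball x d \<subseteq> J" using openE by blast
  show ?case
  proof (intro exI[of _ d] conjI d allI impI)
    fix a b N g assume ab: "a \<le> x \<and> x \<le> b \<and> b - a < d"
      and N: "openin Y N" "y0 \<in> N" "continuous_map (subtopology Y N) E g" "\<forall>y\<in>N. p (g y) = H (y, a)"
    have J: "t \<in> J" if "t \<in> {a..b}" for t
      using that ab d(2) by (auto simp: subset_iff dist_real_def)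
    have HV: "H (y, t) \<in> V" if "y \<in> N0" "t \<in> {a..b}" for y t
      using NJ(5) J[OF that(2)] that(1) by blast
    have "g y0 \<in> topspace E"
      using N(1-3) y0 by (auto simp: continuous_map_def)
    moreover have "p (g y0) \<in> V" using N HV NJ(3) ab by auto
    ultimately obtain U where U: "U \<in> \<U>" "g y0 \<in> U" using \<U>(1) by blast
    obtain q where q: "homeomorphic_maps (subtopology E U) (subtopology B V) p q"
      using \<U>(4)[rule_format, OF U(1)] homeomorphic_map_maps by blast
    have UE: "U \<subseteq> topspace E" using \<U>(3)[rule_format, OF U(1)] openin_subset by blast
    have VB: "V \<subseteq> topspace B" using V openin_subset by blast
    have qp: "q (p u) = u" if "u \<in> U" for u
      using q that UE by (auto simp: homeomorphic_maps_def)
    have pq: "p (q v) = v" "q v \<in> U" if "v \<in> V" for v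
      using q that VB by (auto simp: homeomorphic_maps_def continuous_map_def)
    have qc: "continuous_map (subtopology B V) E q"
      using q by (auto simp: homeomorphic_maps_def continuous_map_in_subtopology)
    define N' where "N' = N0 \<inter> {y \<in> topspace (subtopology Y N). g y \<in> U}"
    have "openin (subtopology Y N) {y \<in> topspace (subtopology Y N). g y \<in> U}"
      using N(3) \<U>(3)[rule_format, OF U(1)] by (rule openin_continuous_map_preimage)
    then have "openin Y {y \<in> topspace (subtopology Y N). g y \<in> U}"
      using N(1) openin_trans_full by blast
    then have N': "openin Y N'" unfolding N'_def using NJ(1) by blast
    have sub: "N' \<subseteq> N" "N' \<subseteq> N0" and gU: "\<And>y. y \<in> N' \<Longrightarrow> g y \<in> U" by (auto simp: N'_def)
    have "continuous_map (prod_topology (subtopology Y N') (top_of_set {a..b})) (subtopology B V) H"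
    proof -
      have "continuous_map (subtopology (prod_topology Y euclideanreal) (N' \<times> {a..b})) B H"
        using H by (rule continuous_map_from_subtopology)
      then show ?thesis
        unfolding subtopology_Times continuous_map_in_subtopology using HV sub by auto
    qed
    then have "continuous_map (prod_topology (subtopology Y N') (top_of_set {a..b})) E (q \<circ> H)"
      using qc by (rule continuous_map_compose)
    moreover have "(q \<circ> H) (y, a) = g y \<and> (\<forall>t\<in>{a..b}. p ((q \<circ> H) (y, t)) = H (y, t))" if "y \<in> N'" for y
    proof -
      have "H (y, a) = p (g y)" using that sub N(4) by auto
      then show ?thesis using that sub gU qp pq HV by (auto simp: subset_iff)
    qed
    moreover have "y0 \<in> N'" using U N NJ y0 by (simp add: N'_def)
    ultimately show "\<exists>N' G. openin Y N' \<and> y0 \<in> N' \<and> N' \<subseteq> N \<and>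
        continuous_map (prod_topology (subtopology Y N') (top_of_set {a..b})) E G \<and>
        (\<forall>y\<in>N'. G (y, a) = g y \<and> (\<forall>t\<in>{a..b}. p (G (y, t)) = H (y, t)))"
      using N' sub by (intro exI[of _ N'] exI[of _ "q \<circ> H"]) auto
  qed
qed

text \<open>The local lifts fit together since the lift of each path \<open>H (z, \<cdot>)\<close> is determined by its
  initial value.\<close>

lemma homotopy_lift:
  fixes H :: "'y \<times> real \<Rightarrow> 'b"
  assumes cov: "covering_map E B p"
    and H: "continuous_map (prod_topology Y euclideanreal) B H"
    and g: "continuous_map Y E g" and gH: "\<And>y. y \<in> topspace Y \<Longrightarrow> p (g y) = H (y, 0)"
  obtains G where "continuous_map (prod_topology Y (top_of_set {0..1})) E G"
    "\<And>y. y \<in> topspace Y \<Longrightarrow> G (y, 0) = g y"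
    "\<And>y t. y \<in> topspace Y \<Longrightarrow> t \<in> {0..1} \<Longrightarrow> p (G (y, t)) = H (y, t)"
proof -
  have "\<exists>N G. openin Y N \<and> y \<in> N \<and>
        continuous_map (prod_topology (subtopology Y N) (top_of_set {0..1})) E G \<and>
        (\<forall>y\<in>N. G (y, 0) = g y \<and> (\<forall>t\<in>{0..1}. p (G (y, t)) = H (y, t)))" if "y \<in> topspace Y" for y
    using homotopy_lift_near[OF cov H that, of 0 1, THEN spec, THEN spec, of "topspace Y" g] g gH that
    by (simp add: continuous_map_from_subtopology) blast
  then obtain N G where N: "\<And>y. y \<in> topspace Y \<Longrightarrow> openin Y (N y) \<and> y \<in> N y \<and>
        continuous_map (prod_topology (subtopology Y (N y)) (top_of_set {0..1})) E (G y) \<and>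
        (\<forall>z\<in>N y. G y (z, 0) = g z \<and> (\<forall>t\<in>{0..1}. p (G y (z, t)) = H (z, t)))"
    by metis
  let ?X = "prod_topology Y (top_of_set {0..1::real})"
  have agree: "G y (z, t) = G y' (z, t)"
    if y: "y \<in> topspace Y" "y' \<in> topspace Y" "z \<in> N y" "z \<in> N y'" and t: "t \<in> {0..1}" for y y' z t
  proof -
    have zY: "z \<in> topspace Y" using N[OF y(1)] y(3) openin_subset by blast
    have c: "continuous_map (top_of_set {0..1}) E (\<lambda>t. G u (z, t))" if "u \<in> topspace Y" "z \<in> N u" for u
    proof -
      have "continuous_map (top_of_set {0..1::real}) (prod_topology (subtopology Y (N u)) (top_of_set {0..1})) (\<lambda>t. (z, t))"
        using that zY by (intro continuous_map_pairedI) auto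
      from continuous_map_compose[OF this, of E "G u"] show ?thesis using N[OF that(1)] by (simp add: o_def)
    qed
    show ?thesis
      by (rule lift_unique[OF cov _ c[OF y(1,3)] c[OF y(2,4)], where ?x0.0 = 0])
       (use N y t in \<open>auto simp: connected_space_subtopology\<close>)
  qed
  obtain F where F: "continuous_map ?X E F"
      "\<And>x i. i \<in> topspace Y \<Longrightarrow> x \<in> topspace ?X \<inter> (N i \<times> {0..1}) \<Longrightarrow> F x = G i x"
  proof (rule pasting_lemma_exists[of ?X "\<lambda>y. N y \<times> {0..1}" "topspace Y" E G])
    show "topspace ?X \<subseteq> (\<Union>y\<in>topspace Y. N y \<times> {0..1})" using N by auto
    show "openin ?X (N y \<times> {0..1})" if "y \<in> topspace Y" for y
      using N[OF that] by (simp add: openin_prod_Times_iff)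
    show "continuous_map (subtopology ?X (N y \<times> {0..1})) E (G y)" if "y \<in> topspace Y" for y
      using N[OF that] by (simp add: subtopology_Times subtopology_subtopology)
    show "G i x = G j x" if "i \<in> topspace Y" "j \<in> topspace Y"
      "x \<in> topspace ?X \<inter> (N i \<times> {0..1}) \<inter> (N j \<times> {0..1})" for i j x
      using agree[of i j "fst x" "snd x"] that by (cases x) simp
  qed (rule that)
  have FG: "F (y, t) = G y (y, t)" if "y \<in> topspace Y" "t \<in> {0..1}" for y t
    using F(2)[of y "(y,t)"] that N[OF that(1)] by auto
  show ?thesis
    by (rule that[OF F(1)]) (use FG N in auto)
qed

section \<open>Euclidean space and the exponential covering of the torus\<close>

text \<open>The dimension \<open>n\<close> is a term, so \<open>\<real>\<^sup>n\<close> is realised as the subspace of vectors with vanishing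
  coordinates from \<open>n\<close> on, inside one normed space of sequences.  In this way linear algebra and
  continuity in normed spaces apply for all \<open>n\<close> at once.\<close>

type_synonym vec = "nat \<Rightarrow>\<^sub>C real"

definition unit_vec :: "nat \<Rightarrow> vec" where
  "unit_vec i = Bcontfun (\<lambda>j. if j = i then 1 else 0)"

lemma unit_vec_apply [simp]: "apply_bcontfun (unit_vec i) j = (if j = i then 1 else 0)"
proof -
  have "(\<lambda>j. if j = i then 1 else 0 :: real) \<in> bcontfun"
    by (auto simp: bcontfun_def intro!: boundedI[of _ 1])
  then show ?thesis unfolding unit_vec_def by (simp add: Bcontfun_inverse)
qed

definition Rn :: "nat \<Rightarrow> vec set" where
  "Rn n = {x. \<forall>i\<ge>n. apply_bcontfun x i = 0}"

definition Zn :: "nat \<Rightarrow> vec set" where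
  "Zn n = {x \<in> Rn n. \<forall>i. apply_bcontfun x i \<in> \<int>}"

abbreviation RnT :: "nat \<Rightarrow> vec topology" where "RnT n \<equiv> top_of_set (Rn n)"

lemma Zn_subset: "Zn n \<subseteq> Rn n" by (auto simp: Zn_def)

lemma subspace_Rn: "subspace (Rn n)"
  by (auto simp: subspace_def Rn_def plus_bcontfun.rep_eq scaleR_bcontfun.rep_eq zero_bcontfun.rep_eq)

lemma Rn_closed [simp, intro]:
  "0 \<in> Rn n" "x \<in> Rn n \<Longrightarrow> y \<in> Rn n \<Longrightarrow> x + y \<in> Rn n" "x \<in> Rn n \<Longrightarrow> y \<in> Rn n \<Longrightarrow> x - y \<in> Rn n"
  "x \<in> Rn n \<Longrightarrow> c *\<^sub>R x \<in> Rn n" "x \<in> Rn n \<Longrightarrow> - x \<in> Rn n"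
  using subspace_Rn by (auto intro: subspace_0 subspace_add subspace_diff subspace_scale subspace_neg)

lemma Zn_closed [simp, intro]:
  "0 \<in> Zn n" "x \<in> Zn n \<Longrightarrow> y \<in> Zn n \<Longrightarrow> x + y \<in> Zn n" "x \<in> Zn n \<Longrightarrow> y \<in> Zn n \<Longrightarrow> x - y \<in> Zn n"
  "x \<in> Zn n \<Longrightarrow> of_int c *\<^sub>R x \<in> Zn n" "x \<in> Zn n \<Longrightarrow> - x \<in> Zn n"
  by (auto simp: Zn_def plus_bcontfun.rep_eq minus_bcontfun.rep_eq uminus_bcontfun.rep_eq
      scaleR_bcontfun.rep_eq zero_bcontfun.rep_eq)

lemma unit_vec_Zn: "i < n \<Longrightarrow> unit_vec i \<in> Zn n"
  by (auto simp: Zn_def Rn_def)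

lemma bounded_linear_coordinate: "bounded_linear (\<lambda>x::vec. apply_bcontfun x i)"
proof (rule bounded_linear_intro[of _ 1])
  show "norm (apply_bcontfun x i) \<le> norm x * 1" for x :: vec using norm_bounded[of x i] by simp
qed (auto simp: plus_bcontfun.rep_eq scaleR_bcontfun.rep_eq)

lemma sum_apply_vec: "apply_bcontfun (\<Sum>i\<in>I. f i :: vec) j = (\<Sum>i\<in>I. apply_bcontfun (f i) j)"
  by (rule bounded_linear.linear[OF bounded_linear_coordinate, THEN linear_sum, of f I])

lemmas vec_simps = plus_bcontfun.rep_eq minus_bcontfun.rep_eq uminus_bcontfun.rep_eq
      scaleR_bcontfun.rep_eq zero_bcontfun.rep_eq sum_apply_vec

lemma coordinates_apply: "i < n \<Longrightarrow> apply_bcontfun (\<Sum>j<n. c j *\<^sub>R unit_vec j) i = c i"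
  by (simp add: vec_simps if_distrib cong: if_cong)

lemma coordinates_in_Rn: "(\<Sum>i<n. c i *\<^sub>R unit_vec i) \<in> Rn n"
  by (auto simp: Rn_def vec_simps)

lemma Rn_coordinates: "x \<in> Rn n \<Longrightarrow> (\<Sum>i<n. apply_bcontfun x i *\<^sub>R unit_vec i) = x"
  by (rule bcontfun_eqI) (auto simp: vec_simps Rn_def if_distrib cong: if_cong)

lemma Rn_eqI: "x \<in> Rn n \<Longrightarrow> y \<in> Rn n \<Longrightarrow> (\<And>i. i < n \<Longrightarrow> apply_bcontfun x i = apply_bcontfun y i) \<Longrightarrow> x = y"
  by (rule bcontfun_eqI) (metis (mono_tags, lifting) Rn_def mem_Collect_eq not_less)

text \<open>The norm dominates each coordinate.\<close>

lemma Zn_discrete: 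
  assumes "z \<in> Zn n" "w \<in> Zn n" "dist z w < 1"
  shows "z = w"
proof (rule bcontfun_eqI)
  fix i
  have "\<bar>apply_bcontfun z i - apply_bcontfun w i\<bar> < 1"
    using dist_fun_lt_imp_dist_val_lt[OF assms(3), of i] by (simp add: dist_real_def)
  moreover have "apply_bcontfun z i \<in> \<int>" "apply_bcontfun w i \<in> \<int>" using assms by (auto simp: Zn_def)
  ultimately show "apply_bcontfun z i = apply_bcontfun w i" by (auto elim!: Ints_cases)
qed

lemma continuous_map_coordinate: 
  assumes "continuous_map X (RnT n) f"
  shows "continuous_map X euclideanreal (\<lambda>x. apply_bcontfun (f x) i)"
proof -
  have "continuous_map X euclidean f" using assms continuous_map_in_subtopology by blast
  moreover have "continuous_map euclidean euclideanreal (\<lambda>x::vec. apply_bcontfun x i)"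
    using linear_continuous_on[OF bounded_linear_coordinate] by simp
  ultimately show ?thesis using continuous_map_compose[of X euclidean f euclidean] by (simp add: o_def)
qed

lemma continuous_map_into_Rn:
  assumes "\<And>i. i < n \<Longrightarrow> continuous_map X euclideanreal (\<lambda>x. f x i)"
  shows "continuous_map X (RnT n) (\<lambda>x. \<Sum>i<n. f x i *\<^sub>R unit_vec i)"
proof -
  have "continuous_map X euclidean (\<lambda>x. f x i *\<^sub>R unit_vec i)" if "i < n" for i
  proof -
    have "continuous_map euclideanreal euclidean (\<lambda>t. t *\<^sub>R unit_vec i)"
      by (simp add: continuous_intros)
    from continuous_map_compose[OF assms[OF that] this] show ?thesis by (simp add: o_def)
  qed
  then show ?thesis 
    by (auto simp: continuous_map_in_subtopology coordinates_in_Rn intro!: continuous_map_sum)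
qed

lemma continuous_map_Rn_add:
  assumes "continuous_map X (RnT n) f" "continuous_map X (RnT n) g"
  shows "continuous_map X (RnT n) (\<lambda>x. f x + g x)"
  using assms by (auto simp: continuous_map_in_subtopology Pi_iff image_subset_iff intro!: continuous_map_add)

lemma continuous_map_Rn_diff:
  assumes "continuous_map X (RnT n) f" "continuous_map X (RnT n) g"
  shows "continuous_map X (RnT n) (\<lambda>x. f x - g x)"
  using assms by (auto simp: continuous_map_in_subtopology Pi_iff image_subset_iff intro!: continuous_map_diff)

lemma continuous_map_Rn_minus:
  assumes "continuous_map X (RnT n) f"
  shows "continuous_map X (RnT n) (\<lambda>x. - f x)"
  using continuous_map_Rn_diff[OF _ assms, of "\<lambda>_. 0"] by simp

lemma connected_Rn: "connected (Rn n)"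
  using convex_connected subspace_imp_convex subspace_Rn by blast

text \<open>Contracting \<open>\<real>\<^sup>n\<close> to the origin along rays turns \<open>g\<close> into a homotopy; the lift is its value at
  time 1.\<close>

lemma lift_from_Rn:
  assumes cov: "covering_map E B p"
    and g: "continuous_map (prod_topology (RnT n) Y) B g"
    and f: "continuous_map Y E f" and fg: "\<And>y. y \<in> topspace Y \<Longrightarrow> p (f y) = g (0, y)"
  obtains G where "continuous_map (prod_topology (RnT n) Y) E G"
    "\<And>y. y \<in> topspace Y \<Longrightarrow> G (0, y) = f y"
    "\<And>x y. x \<in> Rn n \<Longrightarrow> y \<in> topspace Y \<Longrightarrow> p (G (x, y)) = g (x, y)"
proof -
  let ?X = "prod_topology (RnT n) Y"
  have sc: "continuous_map (prod_topology ?X euclideanreal) ?X (\<lambda>w. (snd w *\<^sub>R fst (fst w), snd (fst w)))"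
  proof (intro continuous_map_pairedI)
    have 1: "continuous_map (prod_topology ?X euclideanreal) (RnT n) (\<lambda>w. fst (fst w))"
      using continuous_map_compose[OF continuous_map_fst continuous_map_fst, of "RnT n" Y euclideanreal] by (simp add: o_def)
    show "continuous_map (prod_topology ?X euclideanreal) Y (\<lambda>w. snd (fst w))"
      using continuous_map_compose[OF continuous_map_fst continuous_map_snd, of "RnT n" Y euclideanreal] by (simp add: o_def)
    have "continuous_map (prod_topology ?X euclideanreal) (RnT n)
        (\<lambda>w. \<Sum>i<n. (snd w * apply_bcontfun (fst (fst w)) i) *\<^sub>R unit_vec i)"
      by (intro continuous_map_into_Rn continuous_map_real_mult continuous_map_coordinate[OF 1] continuous_map_snd)
    then show "continuous_map (prod_topology ?X euclideanreal) (RnT n) (\<lambda>w. snd w *\<^sub>R fst (fst w))"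
    proof (rule continuous_map_eq)
      fix w assume "w \<in> topspace (prod_topology ?X euclideanreal)"
      then have "fst (fst w) \<in> Rn n" by auto
      from Rn_coordinates[OF Rn_closed(4)[OF this, of "snd w"]]
      show "(\<Sum>i<n. (snd w * apply_bcontfun (fst (fst w)) i) *\<^sub>R unit_vec i) = snd w *\<^sub>R fst (fst w)"
        by (simp add: scaleR_bcontfun.rep_eq)
    qed
  qed
  have H: "continuous_map (prod_topology ?X euclideanreal) B (\<lambda>w. g (snd w *\<^sub>R fst (fst w), snd (fst w)))"
    using continuous_map_compose[OF sc g] by (simp add: o_def)
  have f': "continuous_map ?X E (\<lambda>w. f (snd w))"
    using continuous_map_compose[OF continuous_map_snd f] by (simp add: o_def)
  obtain L where L: "continuous_map (prod_topology ?X (top_of_set {0..1})) E L"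
    "\<And>w. w \<in> topspace ?X \<Longrightarrow> L (w, 0) = f (snd w)"
    "\<And>w t. w \<in> topspace ?X \<Longrightarrow> t \<in> {0..1} \<Longrightarrow> p (L (w, t)) = g (t *\<^sub>R fst w, snd w)"
    by (rule homotopy_lift[OF cov H f']) (auto simp: fg)
  have pair: "continuous_map (top_of_set {0..1}) (prod_topology ?X (top_of_set {0..1::real})) (\<lambda>t. (w, t))"
    if "w \<in> topspace ?X" for w
    using that by (intro continuous_map_pairedI) auto
  show ?thesis
  proof (rule that[of "\<lambda>w. L (w, 1)"])
    have "continuous_map ?X (prod_topology ?X (top_of_set {0..1::real})) (\<lambda>w. (w, 1))"
      by (intro continuous_map_pairedI) (auto simp: continuous_map_id[unfolded id_def])
    from continuous_map_compose[OF this L(1)] show "continuous_map ?X E (\<lambda>w. L (w, 1))"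
      by (simp add: o_def)
    show "p (L ((x, y), 1)) = g (x, y)" if "x \<in> Rn n" "y \<in> topspace Y" for x y
      using L(3)[of "(x, y)" 1] that by simp
    show "L ((0, y), 1) = f y" if "y \<in> topspace Y" for y
    proof -
      have w: "(0, y) \<in> topspace ?X" using that by simp
      have c: "continuous_map (top_of_set {0..1}) E (\<lambda>t. L ((0, y), t))"
        using continuous_map_compose[OF pair[OF w] L(1)] by (simp add: o_def)
      have fy: "f y \<in> topspace E" using f that by (auto simp: continuous_map_def)
      have k: "continuous_map (top_of_set {0..1::real}) E (\<lambda>t. f y)" using fy by simp
      show ?thesis
        by (rule lift_unique[OF cov _ c k, where ?x0.0 = 0])
         (use L(2)[OF w] L(3)[OF w] fg[OF that] in \<open>auto simp: connected_space_subtopology\<close>)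
    qed
  qed
qed

definition torus_exp :: "nat \<Rightarrow> vec \<Rightarrow> nat \<Rightarrow> complex" where
  "torus_exp n x = (\<lambda>i\<in>{..<n}. cis (2 * pi * apply_bcontfun x i))"

lemma continuous_map_cis:
  assumes "continuous_map X euclideanreal f"
  shows "continuous_map X (top_of_set (sphere 0 1)) (\<lambda>x. cis (f x))"
proof -
  have "continuous_map euclideanreal euclidean cis" by (simp add: continuous_on_cis)
  from continuous_map_compose[OF assms this] show ?thesis 
    by (simp add: o_def continuous_map_in_subtopology)
qed

lemma continuous_torus_exp: "continuous_map (RnT n) (torus n) (torus_exp n)"
  unfolding torus_def continuous_map_componentwise torus_exp_def
  using continuous_map_coordinate[OF continuous_map_id[unfolded id_def], of n]
  by (auto intro!: continuous_map_cis continuous_map_real_mult simp del: continuous_map_subtopology_eu continuous_map_iff_continuous)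

lemma torus_exp_surj:
  assumes "w \<in> topspace (torus n)"
  obtains x where "x \<in> Rn n" "torus_exp n x = w"
proof (rule that)
  let ?x = "\<Sum>i<n. (Arg (w i) / (2 * pi)) *\<^sub>R unit_vec i"
  show "?x \<in> Rn n" by (rule coordinates_in_Rn)
  show "torus_exp n ?x = w"
  proof
    fix i
    show "torus_exp n ?x i = w i"
    proof (cases "i < n")
      case True
      then have "norm (w i) = 1" using assms by (auto simp: torus_def PiE_iff)
      then have "cis (Arg (w i)) = w i" using cis_Arg[of "w i"] by (metis div_by_1 norm_eq_zero of_real_1 sgn_eq zero_neq_one)
      then show ?thesis using True by (simp add: torus_exp_def coordinates_apply)
    next
      case False
      then show ?thesis using assms by (auto simp: torus_exp_def torus_def PiE_iff extensional_def)
    qed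
  qed
qed

lemma torus_exp_eq_iff:
  assumes "x \<in> Rn n" "y \<in> Rn n"
  shows "torus_exp n x = torus_exp n y \<longleftrightarrow> x - y \<in> Zn n"
proof -
  have "cis (2 * pi * s) = cis (2 * pi * t) \<longleftrightarrow> s - t \<in> \<int>" for s t :: real
  proof -
    have "cis (2 * pi * s) = cis (2 * pi * t) \<longleftrightarrow> cis (2 * pi * (s - t)) = 1"
      by (simp add: right_diff_distrib flip: cis_divide)
    also have "\<dots> \<longleftrightarrow> s - t \<in> \<int>"
    proof
      assume "cis (2 * pi * (s - t)) = 1"
      then have "cos (2 * pi * (s - t)) = 1" by (simp add: complex_eq_iff)
      then obtain m :: int where "2 * pi * (s - t) = of_int m * 2 * pi" using cos_one_2pi_int by blast
      then have "s - t = of_int m" by simp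
      then show "s - t \<in> \<int>" by simp
    qed (rule cis_multiple_2pi)
    finally show ?thesis .
  qed
  note c = this
  have "torus_exp n x = torus_exp n y \<longleftrightarrow> (\<forall>i<n. apply_bcontfun x i - apply_bcontfun y i \<in> \<int>)"
    by (simp add: torus_exp_def restrict_def fun_eq_iff c) 
  also have "\<dots> \<longleftrightarrow> x - y \<in> Zn n"
    using assms by (auto simp: Zn_def Rn_def minus_bcontfun.rep_eq) (metis Ints_0 diff_0_right linorder_not_less)
  finally show ?thesis .
qed

text \<open>Around \<open>y = torus_exp n a\<close> the evenly covered set consists of the \<open>w\<close> with no coordinate
  opposite to that of \<open>y\<close>.  Its sheets are the open unit cubes centred at \<open>a + z\<close> for integer
  vectors \<open>z\<close>, with inverse maps given by the principal argument of \<open>w i / y i\<close>.\<close>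

lemma covering_torus_exp: "covering_map (RnT n) (torus n) (torus_exp n)"
  unfolding covering_map_def
proof (intro conjI ballI)
  show "continuous_map (RnT n) (torus n) (torus_exp n)" by (rule continuous_torus_exp)
  then show "torus_exp n ` topspace (RnT n) = topspace (torus n)"
    using continuous_map_image_subset_topspace[of "RnT n" "torus n"] by (auto elim!: torus_exp_surj)
  fix y assume y: "y \<in> topspace (torus n)"
  obtain a where a: "a \<in> Rn n" "torus_exp n a = y" using torus_exp_surj[OF y] by blast
  define V where "V = {w \<in> topspace (torus n). \<forall>i<n. w i \<noteq> - y i}"
  define D where "D z = {x \<in> Rn n. \<forall>i<n. \<bar>apply_bcontfun x i - apply_bcontfun a i - apply_bcontfun z i\<bar> < 1/2}" for z
  define q where "q z w = (\<Sum>i<n. (apply_bcontfun a i + apply_bcontfun z i + Arg (w i / y i) / (2 * pi)) *\<^sub>R unit_vec i)"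
    for z :: vec and w :: "nat \<Rightarrow> complex"
  have yi: "y i = cis (2 * pi * apply_bcontfun a i)" if "i < n" for i
    using a(2) that by (auto simp: torus_exp_def)
  have Vopen: "openin (torus n) V"
  proof -
    have "V = topspace (torus n) \<inter> (\<Inter>i\<in>{..<n}. {w \<in> topspace (torus n). w i \<in> - {- y i}})"
      by (auto simp: V_def)
    moreover have "openin (torus n) {w \<in> topspace (torus n). w i \<in> - {- y i}}" if "i < n" for i
    proof (rule openin_continuous_map_preimage[where Y = euclidean])
      have "continuous_map (torus n) (top_of_set (sphere 0 1)) (\<lambda>w. w i)"
        unfolding torus_def using that by (intro continuous_map_product_projection) auto
      then show "continuous_map (torus n) euclidean (\<lambda>w. w i)" using continuous_map_in_subtopology by blast
    qed auto
    ultimately show ?thesis by (cases "n = 0") (auto intro!: openin_Int openin_INT2)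
  qed
  have Arg1: "Arg (cis (2 * pi * s)) = 2 * pi * s" if "\<bar>s\<bar> < 1/2" for s :: real
  proof (rule Arg_cis)
    have "2 * pi * \<bar>s\<bar> < 2 * pi * (1/2)"
      using that by (intro mult_strict_left_mono) auto
    then have "\<bar>2 * pi * s\<bar> < pi" by (simp add: abs_mult)
    then show "2 * pi * s \<in> {- pi<..pi}" by (simp only: abs_less_iff greaterThanAtMost_iff) linarith
  qed
  have ne: "cis (2 * pi * s) \<noteq> -1" if "\<bar>s\<bar> < 1/2" for s :: real
  proof
    assume "cis (2 * pi * s) = -1"
    moreover have "Arg (-1) = pi" by (simp add: Arg_eq_pi)
    ultimately have "2 * pi * s = pi" using Arg1[OF that] by simp
    then show False using that by (auto simp: abs_if split: if_splits)
  qed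
  have quot: "torus_exp n x i / y i = cis (2 * pi * (apply_bcontfun x i - apply_bcontfun a i - apply_bcontfun z i))"
    if "i < n" "z \<in> Zn n" for x z i
  proof -
    have "cis (2 * pi * apply_bcontfun z i) = 1" using that(2) by (intro cis_multiple_2pi) (auto simp: Zn_def)
    then show ?thesis using that by (simp add: torus_exp_def yi cis_divide right_diff_distrib flip: cis_divide)
  qed
  have pre: "\<Union>(D ` Zn n) = {x \<in> topspace (RnT n). torus_exp n x \<in> V}"
  proof (intro equalityI subsetI)
    fix x assume "x \<in> \<Union>(D ` Zn n)"
    then obtain z where z: "z \<in> Zn n" "x \<in> D z" by blast
    then have x: "x \<in> Rn n" by (simp add: D_def)
    have "torus_exp n x i \<noteq> - y i" if "i < n" for i
    proof
      assume "torus_exp n x i = - y i"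
      then have "torus_exp n x i / y i = -1" using yi[OF that] by simp
      moreover have "\<bar>apply_bcontfun x i - apply_bcontfun a i - apply_bcontfun z i\<bar> < 1/2"
        using z(2) that by (simp add: D_def)
      ultimately show False using quot[OF that z(1), of x] ne by metis
    qed
    then show "x \<in> {x \<in> topspace (RnT n). torus_exp n x \<in> V}"
      using x continuous_map_image_subset_topspace[OF continuous_torus_exp] by (auto simp: V_def)
  next
    fix x assume x: "x \<in> {x \<in> topspace (RnT n). torus_exp n x \<in> V}"
    define z where "z = (\<Sum>i<n. of_int (round (apply_bcontfun x i - apply_bcontfun a i)) *\<^sub>R unit_vec i)"
    have z: "z \<in> Zn n" unfolding z_def Zn_def using coordinates_in_Rn[of _ n] 
      by (auto simp: vec_simps intro!: Ints_sum)
    have "\<bar>apply_bcontfun x i - apply_bcontfun a i - apply_bcontfun z i\<bar> < 1/2" if i: "i < n" for i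
    proof -
      let ?d = "apply_bcontfun x i - apply_bcontfun a i - apply_bcontfun z i"
      have zi: "apply_bcontfun z i = of_int (round (apply_bcontfun x i - apply_bcontfun a i))"
        unfolding z_def by (rule coordinates_apply[OF i])
      have le: "\<bar>?d\<bar> \<le> 1/2" 
        using of_int_round_abs_le[of "apply_bcontfun x i - apply_bcontfun a i"] by (simp add: zi abs_minus_commute)
      have "torus_exp n x i / y i \<noteq> -1" using x i yi[OF i] by (auto simp: V_def field_simps)
      then have nn: "cis (2 * pi * ?d) \<noteq> -1" using quot[OF i z, of x] by simp
      have "cis (2 * pi * (1/2)) = -1" "cis (2 * pi * (-1/2)) = -1" by (simp_all add: complex_eq_iff)
      then have "?d \<noteq> 1/2" "?d \<noteq> -1/2" using nn by metis+
      then show ?thesis using le by (auto simp: abs_if split: if_splits)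
    qed
    then have "x \<in> D z" using x by (auto simp: D_def)
    then show "x \<in> \<Union>(D ` Zn n)" using z by blast
  qed
  have disj: "pairwise disjnt (D ` Zn n)"
  proof -
    have "D z \<inter> D z' = {}" if "z \<in> Zn n" "z' \<in> Zn n" "z \<noteq> z'" for z z'
    proof (rule ccontr)
      assume "D z \<inter> D z' \<noteq> {}"
      then obtain x where x: "x \<in> D z" "x \<in> D z'" by blast
      have "z = z'"
      proof (rule Rn_eqI)
        fix i assume i: "i < n"
        have "\<bar>apply_bcontfun x i - apply_bcontfun a i - apply_bcontfun z i\<bar> < 1/2"
          "\<bar>apply_bcontfun x i - apply_bcontfun a i - apply_bcontfun z' i\<bar> < 1/2"
          using x i by (auto simp: D_def)
        then have "\<bar>apply_bcontfun z i - apply_bcontfun z' i\<bar> < 1" by linarith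
        moreover have "apply_bcontfun z i \<in> \<int>" "apply_bcontfun z' i \<in> \<int>" using that by (auto simp: Zn_def)
        ultimately show "apply_bcontfun z i = apply_bcontfun z' i" by (auto elim!: Ints_cases)
      qed (use that Zn_subset in auto)
      then show False using that by simp
    qed
    then show ?thesis by (auto simp: pairwise_def disjnt_def)
  qed
  have Dopen: "openin (RnT n) (D z)" for z
  proof -
    have "D z = topspace (RnT n) \<inter> (\<Inter>i\<in>{..<n}. {x \<in> topspace (RnT n). apply_bcontfun x i \<in> ball (apply_bcontfun a i + apply_bcontfun z i) (1/2)})"
      by (auto simp: D_def dist_real_def abs_minus_commute diff_diff_eq)
    moreover have "openin (RnT n) {x \<in> topspace (RnT n). apply_bcontfun x i \<in> ball (apply_bcontfun a i + apply_bcontfun z i) (1/2)}" for i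
      by (rule openin_continuous_map_preimage[OF continuous_map_coordinate[OF continuous_map_id[unfolded id_def]]]) auto
    ultimately show ?thesis by (cases "n = 0") (auto intro!: openin_Int openin_INT2)
  qed
  have homeo: "homeomorphic_map (subtopology (RnT n) (D z)) (subtopology (torus n) V) (torus_exp n)" if z: "z \<in> Zn n" for z
  proof -
    have VA: "w i / y i \<notin> \<real>\<^sub>\<le>\<^sub>0" "norm (w i) = 1" if "w \<in> V" "i < n" for w i
    proof -
      show n1: "norm (w i) = 1" using that by (auto simp: V_def torus_def PiE_iff)
      show "w i / y i \<notin> \<real>\<^sub>\<le>\<^sub>0"
      proof
        assume "w i / y i \<in> \<real>\<^sub>\<le>\<^sub>0"
        then have "w i / y i = - of_real (norm (w i / y i))"
          by (auto simp: complex_nonpos_Reals_iff complex_eq_iff cmod_def)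
        moreover have "norm (w i / y i) = 1" using n1 yi[OF that(2)] by (simp add: norm_divide)
        ultimately show False using that yi[OF that(2)] by (auto simp: V_def field_simps)
      qed
    qed
    have "homeomorphic_maps (subtopology (RnT n) (D z)) (subtopology (torus n) V) (torus_exp n) (q z)"
      unfolding homeomorphic_maps_def
    proof (intro conjI ballI)
      show "continuous_map (subtopology (RnT n) (D z)) (subtopology (torus n) V) (torus_exp n)"
        unfolding continuous_map_in_subtopology
        using pre z continuous_map_from_subtopology[OF continuous_torus_exp] by auto
      have c: "continuous_map (subtopology (torus n) V) (top_of_set (- \<real>\<^sub>\<le>\<^sub>0)) (\<lambda>w. w i / y i)" if "i < n" for i
      proof -
        have "continuous_map (torus n) (top_of_set (sphere 0 1)) (\<lambda>w. w i)"
          unfolding torus_def using that by (intro continuous_map_product_projection) auto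
        then have "continuous_map (subtopology (torus n) V) euclidean (\<lambda>w. w i)" 
          using continuous_map_in_subtopology continuous_map_from_subtopology by metis
        moreover have "continuous_map euclidean euclidean (\<lambda>u. u / y i)" 
          using yi[OF that] by (auto intro!: continuous_intros)
        ultimately have "continuous_map (subtopology (torus n) V) euclidean (\<lambda>w. w i / y i)"
          using continuous_map_compose[of _ _ "\<lambda>w. w i" _ "\<lambda>u. u / y i"] by (simp add: o_def)
        then show ?thesis using VA that by (auto simp: continuous_map_in_subtopology)
      qed
      have "continuous_map (subtopology (torus n) V) euclideanreal (\<lambda>w. Arg (w i / y i))" if "i < n" for i
        using continuous_map_compose[OF c[OF that], of euclidean Arg] continuous_on_Arg by (simp add: o_def)
      then have "continuous_map (subtopology (torus n) V) (RnT n) (q z)"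
        unfolding q_def by (intro continuous_map_into_Rn continuous_map_add continuous_map_real_divide) auto
      moreover have "q z w \<in> D z" if w: "w \<in> V" for w
      proof -
        have "\<bar>Arg (w i / y i) / (2 * pi)\<bar> < 1 / 2" if i: "i < n" for i
        proof -
          have "Arg (w i / y i) \<noteq> pi" using VA(1)[OF w i] by (auto simp: Arg_eq_pi complex_nonpos_Reals_iff)
          then have "\<bar>Arg (w i / y i)\<bar> < pi" 
            using mpi_less_Arg[of "w i / y i"] Arg_le_pi[of "w i / y i"] by linarith
          then show ?thesis by (simp add: abs_divide)
        qed
        then show ?thesis unfolding D_def q_def using coordinates_in_Rn coordinates_apply by auto
      qed
      ultimately show "continuous_map (subtopology (torus n) V) (subtopology (RnT n) (D z)) (q z)"
        by (auto simp: continuous_map_in_subtopology)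
      fix x assume "x \<in> topspace (subtopology (RnT n) (D z))"
      then have x: "x \<in> Rn n" "x \<in> D z" by auto
      show "q z (torus_exp n x) = x"
      proof (rule Rn_eqI[of _ n])
        fix i assume i: "i < n"
        have "Arg (torus_exp n x i / y i) = 2 * pi * (apply_bcontfun x i - apply_bcontfun a i - apply_bcontfun z i)"
          unfolding quot[OF i z] using x i by (intro Arg1) (auto simp: D_def)
        then show "apply_bcontfun (q z (torus_exp n x)) i = apply_bcontfun x i"
          unfolding q_def coordinates_apply[OF i] by simp
      qed (use x in \<open>auto simp: q_def coordinates_in_Rn\<close>)
    next
      fix w assume w: "w \<in> topspace (subtopology (torus n) V)"
      show "torus_exp n (q z w) = w"
      proof
        fix i show "torus_exp n (q z w) i = w i"
        proof (cases "i < n")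
          case True
          then have "w i / y i \<noteq> 0" "norm (w i / y i) = 1" using VA[of w i] w yi[OF True] by (auto simp: norm_divide)
          then have A: "cis (Arg (w i / y i)) = w i / y i" using cis_Arg[of "w i / y i"] by (simp add: sgn_eq)
          have zc: "cis (2 * pi * apply_bcontfun z i) = 1" using z by (intro cis_multiple_2pi) (auto simp: Zn_def)
          have "torus_exp n (q z w) i = cis (2 * pi * apply_bcontfun a i + 2 * pi * apply_bcontfun z i + Arg (w i / y i))"
            using True by (simp add: torus_exp_def q_def coordinates_apply distrib_left)
          also have "\<dots> = y i * (w i / y i)" by (simp add: cis_mult[symmetric] zc A yi[OF True, symmetric])
          finally show ?thesis using yi[OF True] by simp
        next
          case False
          then show ?thesis using w by (auto simp: torus_exp_def torus_def PiE_iff extensional_def)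
        qed
      qed
    qed
    then show ?thesis using homeomorphic_map_maps by blast
  qed
  have "y \<in> V" using y yi by (auto simp: V_def)
  then show "\<exists>V. openin (torus n) V \<and> y \<in> V \<and>
      (\<exists>\<U>. \<Union>\<U> = {x \<in> topspace (RnT n). torus_exp n x \<in> V} \<and> pairwise disjnt \<U> \<and>
        (\<forall>U\<in>\<U>. openin (RnT n) U \<and> homeomorphic_map (subtopology (RnT n) U) (subtopology (torus n) V) (torus_exp n)))"
    by (intro exI[of _ V] conjI Vopen exI[of _ "D ` Zn n"] pre disj) (use Dopen homeo in auto)
qed

section \<open>Uniformizing a tower of tori\<close>

lemma covering_map_compose_homeomorphic_maps:
  assumes cov: "covering_map E B p" and f: "homeomorphic_map E' E f" and k: "homeomorphic_map B B' k"
  shows "covering_map E' B' (k \<circ> p \<circ> f)"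
  unfolding covering_map_def
proof (intro conjI ballI)
  have fE: "f ` topspace E' = topspace E" and kB: "k ` topspace B = topspace B'"
    using f k homeomorphic_imp_surjective_map by blast+
  have pE: "p ` topspace E = topspace B" and pc: "continuous_map E B p"
    using cov by (simp_all add: covering_map_def)
  show "continuous_map E' B' (k \<circ> p \<circ> f)"
    using f k pc homeomorphic_imp_continuous_map continuous_map_compose by metis
  show "(k \<circ> p \<circ> f) ` topspace E' = topspace B'"
    by (simp only: image_comp[symmetric] fE pE kB)
  fix y' assume "y' \<in> topspace B'"
  then obtain y where y: "y \<in> topspace B" "y' = k y" using kB by blast
  from cov y(1) obtain V \<U> where V: "openin B V" "y \<in> V" and U: "\<Union>\<U> = {x \<in> topspace E. p x \<in> V}"
      "pairwise disjnt \<U>" "\<forall>U\<in>\<U>. openin E U"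
      "\<forall>U\<in>\<U>. homeomorphic_map (subtopology E U) (subtopology B V) p"
    by (rule covering_map_evenly_covered)
  define h where "h U = {x \<in> topspace E'. f x \<in> U}" for U
  have VB: "V \<subseteq> topspace B" using V openin_subset by blast
  have kinj: "inj_on k (topspace B)" using k homeomorphic_imp_injective_map by blast
  have 1: "openin B' (k ` V)" using k V homeomorphic_imp_open_map open_map_def by metis
  have kV: "k v \<in> k ` V \<longleftrightarrow> v \<in> V" if "v \<in> topspace B" for v
    using kinj VB that by (auto dest: inj_onD)
  have 2: "\<Union>(h ` \<U>) = {x \<in> topspace E'. (k \<circ> p \<circ> f) x \<in> k ` V}"
  proof -
    have "\<Union>(h ` \<U>) = {x \<in> topspace E'. f x \<in> \<Union>\<U>}" by (auto simp: h_def)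
    also have "\<dots> = {x \<in> topspace E'. (k \<circ> p \<circ> f) x \<in> k ` V}"
      unfolding U(1) using kV fE pE by (auto simp: image_iff) 
    finally show ?thesis .
  qed
  have 3: "pairwise disjnt (h ` \<U>)"
    using U(2) unfolding pairwise_image by (auto simp: pairwise_def disjnt_def h_def)
  have 4: "openin E' (h U) \<and> homeomorphic_map (subtopology E' (h U)) (subtopology B' (k ` V)) (k \<circ> p \<circ> f)"
    if "U \<in> \<U>" for U
  proof
    show "openin E' (h U)" unfolding h_def
      using U(3) that f homeomorphic_imp_continuous_map by (intro openin_continuous_map_preimage) auto
    have "homeomorphic_map (subtopology E' (h U)) (subtopology E U) f"
      by (rule homeomorphic_map_subtopologies_alt[OF f]) (auto simp: h_def)
    moreover have "homeomorphic_map (subtopology B V) (subtopology B' (k ` V)) k"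
      by (rule homeomorphic_map_subtopologies_alt[OF k]) (use kV in auto)
    ultimately show "homeomorphic_map (subtopology E' (h U)) (subtopology B' (k ` V)) (k \<circ> p \<circ> f)"
      using U(4) that homeomorphic_map_compose by (metis comp_assoc)
  qed
  show "\<exists>V. openin B' V \<and> y' \<in> V \<and> (\<exists>\<U>. \<Union>\<U> = {x \<in> topspace E'. (k \<circ> p \<circ> f) x \<in> V} \<and>
      pairwise disjnt \<U> \<and> (\<forall>U\<in>\<U>. openin E' U \<and> homeomorphic_map (subtopology E' U) (subtopology B' V) (k \<circ> p \<circ> f)))"
    by (intro exI[of _ "k ` V"] conjI 1 exI[of _ "h ` \<U>"] 2 3) (use 4 V y in auto)
qed

lemma lift_from_Rn_simple:
  assumes cov: "covering_map E B p" and g: "continuous_map (RnT n) B g"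
    and e: "e \<in> topspace E" "p e = g 0"
  obtains G where "continuous_map (RnT n) E G" "G 0 = e" "\<And>x. x \<in> Rn n \<Longrightarrow> p (G x) = g x"
proof -
  let ?Y = "discrete_topology {()}"
  have "continuous_map (prod_topology (RnT n) ?Y) B (\<lambda>w. g (fst w))"
    using continuous_map_compose[OF continuous_map_fst g] by (simp add: o_def)
  moreover have "continuous_map ?Y E (\<lambda>_. e)" using e by simp
  ultimately obtain G where G: "continuous_map (prod_topology (RnT n) ?Y) E G"
    "\<And>y. y \<in> topspace ?Y \<Longrightarrow> G (0, y) = e"
    "\<And>x y. x \<in> Rn n \<Longrightarrow> y \<in> topspace ?Y \<Longrightarrow> p (G (x, y)) = g (fst (x, y))"
    by (rule lift_from_Rn[OF cov]) (use e in auto)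
  have "continuous_map (RnT n) (prod_topology (RnT n) ?Y) (\<lambda>x. (x, ()))"
    by (intro continuous_map_pairedI) (auto simp: continuous_map_id[unfolded id_def])
  from continuous_map_compose[OF this G(1)] show ?thesis
    using G by (intro that[of "\<lambda>x. G (x, ())"]) (auto simp: o_def)
qed

lemma continuous_map_clamp: "continuous_map euclideanreal (top_of_set {0..1}) (\<lambda>t. max 0 (min 1 t))"
  by (auto simp: continuous_map_in_subtopology intro!: continuous_intros)

lemma lift_path:
  assumes cov: "covering_map E B p" and g: "pathin B g" and e: "e \<in> topspace E" "p e = g 0"
  obtains G where "pathin E G" "G 0 = e" "\<And>t. t \<in> {0..1} \<Longrightarrow> p (G t) = g t"
proof -
  let ?Y = "discrete_topology {()}"
  have "continuous_map (prod_topology ?Y euclideanreal) B (\<lambda>w. g (max 0 (min 1 (snd w))))"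
    using continuous_map_compose[OF continuous_map_compose[OF continuous_map_snd continuous_map_clamp] g[unfolded pathin_def]]
    by (simp add: o_def)
  moreover have "continuous_map ?Y E (\<lambda>_. e)" using e by simp
  ultimately obtain G where G: "continuous_map (prod_topology ?Y (top_of_set {0..1})) E G"
    "\<And>y. y \<in> topspace ?Y \<Longrightarrow> G (y, 0) = e"
    "\<And>y t. y \<in> topspace ?Y \<Longrightarrow> t \<in> {0..1} \<Longrightarrow> p (G (y, t)) = g (max 0 (min 1 (snd (y, t))))"
    by (rule homotopy_lift[OF cov]) (use e in auto)
  have "continuous_map (top_of_set {0..1}) (prod_topology ?Y (top_of_set {0..1::real})) (\<lambda>x. ((), x))"
    by (intro continuous_map_pairedI) (auto simp: continuous_map_id[unfolded id_def])
  from continuous_map_compose[OF this G(1)] show ?thesis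
    using G by (intro that[of "\<lambda>x. G ((), x)"]) (auto simp: o_def pathin_def)
qed

lemma homeomorphic_map_translation:
  assumes "a \<in> Rn n"
  shows "homeomorphic_map (RnT n) (RnT n) (\<lambda>x. x + a)"
proof -
  have "homeomorphic_maps (RnT n) (RnT n) (\<lambda>x. x + a) (\<lambda>x. x - a)"
    using assms by (auto simp: homeomorphic_maps_def continuous_map_in_subtopology intro!: continuous_intros)
  then show ?thesis using homeomorphic_map_maps by blast
qed

lemma connected_space_RnT: "connected_space (RnT n)"
  using connected_Rn by (simp add: connected_space_subtopology)

text \<open>The maps \<open>u l\<close> are coordinates that present each \<open>M l\<close> as the quotient of \<open>\<real>\<^sup>n\<close> by a group of
  integer translations, normalised such that the origin lies over \<open>x0\<close>.  Local sections through
  prescribed points replace the statement that every \<open>u l\<close> is a covering map.\<close>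

locale torus_tower =
  fixes n :: nat and M :: "nat \<Rightarrow> 'a topology" and p :: "nat \<Rightarrow> 'a \<Rightarrow> 'a" and x0 :: 'a
    and u :: "nat \<Rightarrow> vec \<Rightarrow> 'a"
  assumes u_continuous: "continuous_map (RnT n) (M l) (u l)"
    and u_onto: "u l ` Rn n = topspace (M l)"
    and u_compatible: "x \<in> Rn n \<Longrightarrow> p (Suc l) (u (Suc l) x) = u l x"
    and u_section: "a \<in> Rn n \<Longrightarrow> \<exists>V \<sigma>. openin (M l) V \<and> u l a \<in> V \<and>
        continuous_map (subtopology (M l) V) (RnT n) \<sigma> \<and> \<sigma> (u l a) = a \<and> (\<forall>s\<in>V. u l (\<sigma> s) = s)"
    and u_eq_iff: "x \<in> Rn n \<Longrightarrow> y \<in> Rn n \<Longrightarrow> u l x = u l y \<longleftrightarrow> u l (x - y) = u l 0"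
    and u_base: "u 0 0 = x0"
    and u_0_eq_iff: "x \<in> Rn n \<Longrightarrow> u 0 x = u 0 0 \<longleftrightarrow> x \<in> Zn n"
    and finite_index: "\<exists>N>0. \<forall>z\<in>Zn n. u l (real N *\<^sub>R z) = u l 0"
    and covering: "covering_map (M (Suc l)) (M l) (p (Suc l))"
    and covering_u_0: "covering_map (RnT n) (M 0) (u 0)"
    and Hausdorff: "Hausdorff_space (M l)"
    and compact: "compact_space (M l)"

text \<open>Here \<open>u 0\<close> is the exponential covering of the torus \<open>M 0\<close>, translated such that the origin lies over
  \<open>x0\<close>, and each \<open>u (Suc l)\<close> is a lift of \<open>u l\<close>.  The properties of \<open>u l\<close> follow by induction on \<open>l\<close>
  from existence and uniqueness of lifts.\<close>

lemma toroidal_presentation_imp_torus_tower: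
  assumes pres: "toroidal_presentation n M p" and x0: "x0 \<in> topspace (M 0)"
  obtains u where "torus_tower n M p x0 u"
proof -
  have M: "compact_space (M l)" "Hausdorff_space (M l)" "M l homeomorphic_space torus n" for l
    using pres by (auto simp: toroidal_presentation_def presentation_def closed_manifold_def)
  obtain d where d: "\<And>l. d l \<ge> (2::nat)" "\<And>l. covering_of_degree (d l) (M (Suc l)) (M l) (p (Suc l))"
    using pres unfolding toroidal_presentation_def presentation_def by metis
  then have cov: "covering_map (M (Suc l)) (M l) (p (Suc l))" for l
    by (simp add: covering_of_degree_def)
  have path_conn: "path_connected_space (M l)" for l
  proof -
    obtain k where k: "homeomorphic_map (torus n) (M l) k" 
      using M(3) homeomorphic_space_sym homeomorphic_space by metis
    have "path_connectedin (RnT n) (topspace (RnT n))"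
      using convex_imp_path_connected[OF subspace_imp_convex[OF subspace_Rn]]
      by (simp add: path_connectedin_subtopology)
    moreover have "continuous_map (RnT n) (M l) (k \<circ> torus_exp n)"
      using k homeomorphic_imp_continuous_map continuous_torus_exp continuous_map_compose by blast
    ultimately have "path_connectedin (M l) ((k \<circ> torus_exp n) ` topspace (RnT n))"
      using path_connectedin_continuous_map_image by blast
    moreover have "(k \<circ> torus_exp n) ` topspace (RnT n) = topspace (M l)"
    proof -
      have "torus_exp n ` topspace (RnT n) = topspace (torus n)"
        using covering_torus_exp[of n] unfolding covering_map_def by blast
      then show ?thesis by (simp only: image_comp[symmetric] homeomorphic_imp_surjective_map[OF k])
    qed
    ultimately show ?thesis by (simp add: path_connectedin_topspace)
  qed
  obtain k where k: "homeomorphic_map (torus n) (M 0) k" 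
    using M(3) homeomorphic_space_sym homeomorphic_space by metis
  then obtain w where w: "w \<in> topspace (torus n)" "k w = x0"
  proof -
    have "x0 \<in> k ` topspace (torus n)" using x0 by (simp only: homeomorphic_imp_surjective_map[OF k])
    then show thesis using that by (metis imageE)
  qed
  then obtain a where a: "a \<in> Rn n" "torus_exp n a = w" using torus_exp_surj by blast
  define u0 where "u0 = k \<circ> torus_exp n \<circ> (\<lambda>x. x + a)"
  have cov0: "covering_map (RnT n) (M 0) u0"
    unfolding u0_def by (rule covering_map_compose_homeomorphic_maps[OF covering_torus_exp homeomorphic_map_translation[OF a(1)] k])
  have u0_eq: "u0 x = u0 y \<longleftrightarrow> x - y \<in> Zn n" if "x \<in> Rn n" "y \<in> Rn n" for x y
  proof -
    have "torus_exp n (x + a) \<in> topspace (torus n)" "torus_exp n (y + a) \<in> topspace (torus n)"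
      using covering_torus_exp[of n] that a by (auto simp: covering_map_def)
    then have "u0 x = u0 y \<longleftrightarrow> torus_exp n (x + a) = torus_exp n (y + a)"
      using homeomorphic_imp_injective_map[OF k] by (auto simp: u0_def dest: inj_onD)
    then show ?thesis using torus_exp_eq_iff[of "x + a" n "y + a"] that a by simp
  qed
  define u where "u = rec_nat u0 (\<lambda>l v. SOME w. continuous_map (RnT n) (M (Suc l)) w \<and> (\<forall>x\<in>Rn n. p (Suc l) (w x) = v x))"
  have u_0: "u 0 = u0" by (simp add: u_def)
  have uc_step: "continuous_map (RnT n) (M (Suc l)) (u (Suc l)) \<and> (\<forall>x\<in>Rn n. p (Suc l) (u (Suc l) x) = u l x)"
    if "continuous_map (RnT n) (M l) (u l)" for l
  proof -
    have "u l 0 \<in> topspace (M l)" using that by (auto simp: continuous_map_def)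
    then obtain e where "e \<in> topspace (M (Suc l))" "p (Suc l) e = u l 0"
    proof -
      have "p (Suc l) ` topspace (M (Suc l)) = topspace (M l)"
        using cov[of l] unfolding covering_map_def by blast
      then show thesis using that \<open>u l 0 \<in> topspace (M l)\<close> by (metis imageE)
    qed
    from lift_from_Rn_simple[OF cov that this] 
    have "\<exists>w. continuous_map (RnT n) (M (Suc l)) w \<and> (\<forall>x\<in>Rn n. p (Suc l) (w x) = u l x)"
      by metis
    from someI_ex[OF this] show ?thesis by (simp add: u_def)
  qed
  have uc: "continuous_map (RnT n) (M l) (u l)" for l
  proof (induction l)
    case 0
    then show ?case using cov0 by (simp add: u_0 covering_map_def)
  qed (use uc_step in blast)
  have pu: "p (Suc l) (u (Suc l) x) = u l x" if "x \<in> Rn n" for l x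
    using uc_step[OF uc] that by blast
  have uM: "u l x \<in> topspace (M l)" if "x \<in> Rn n" for l x
    using uc[of l] that by (auto simp: continuous_map_def)
  \<comment> \<open>in the induction step, \<open>u (Suc l)\<close> and its translate by \<open>x - y\<close> lift the
      same map and agree at \<open>y\<close>\<close>
  have period: "u l (v + (x - y)) = u l v" if "u l x = u l y" "x \<in> Rn n" "y \<in> Rn n" "v \<in> Rn n" for l x y v
    using that
  proof (induction l arbitrary: v)
    case 0
    then have "x - y \<in> Zn n" using u0_eq[of x y] by (simp add: u_0)
    then show ?case using u0_eq[of "v + (x - y)" v] 0 by (simp add: u_0)
  next
    case (Suc l)
    have "u l x = u l y" using pu Suc.prems by metis
    note IH = Suc.IH[OF this Suc.prems(2,3)]
    have c: "continuous_map (RnT n) (M (Suc l)) (\<lambda>v. u (Suc l) (v + (x - y)))"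
      using continuous_map_compose[OF homeomorphic_imp_continuous_map[OF homeomorphic_map_translation[of "x - y" n]] uc] Suc.prems
      by (simp add: o_def)
    show ?case
      by (rule lift_unique[OF cov connected_space_RnT c uc, where ?x0.0 = y])
        (use Suc.prems IH in \<open>auto simp: pu\<close>)
  qed
  have ueq: "u l x = u l y \<longleftrightarrow> u l (x - y) = u l 0" if "x \<in> Rn n" "y \<in> Rn n" for l x y
    using period[of l x y 0] period[of l "x - y" 0 y] that by auto
  \<comment> \<open>a path in \<open>M l\<close> lifts to \<open>\<real>\<^sup>n\<close> since its projection to
      \<open>M 0\<close> does; with path connectedness this gives surjectivity\<close>
  have lift: "\<exists>x. continuous_map (top_of_set {0..1}) (RnT n) x \<and> x 0 = 0 \<and> (\<forall>t\<in>{0..1}. u l (x t) = g t)"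
    if "pathin (M l) g" "g 0 = u l 0" for l g
    using that
  proof (induction l arbitrary: g)
    case 0
    obtain G where "pathin (RnT n) G" "G 0 = 0" "\<And>t. t \<in> {0..1} \<Longrightarrow> u0 (G t) = g t"
      by (rule lift_path[OF cov0 0(1), of 0]) (use 0(2) in \<open>auto simp: u_0\<close>)
    then show ?case unfolding pathin_def u_0 by blast
  next
    case (Suc l)
    have pc: "continuous_map (M (Suc l)) (M l) (p (Suc l))" using cov by (simp add: covering_map_def)
    have "pathin (M l) (p (Suc l) \<circ> g)"
      using Suc.prems(1) pc continuous_map_compose unfolding pathin_def by blast
    moreover have "(p (Suc l) \<circ> g) 0 = u l 0" using Suc.prems pu by simp
    ultimately obtain x where x: "continuous_map (top_of_set {0..1}) (RnT n) x" "x 0 = 0"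
        "\<forall>t\<in>{0..1}. u l (x t) = (p (Suc l) \<circ> g) t"
      using Suc.IH by metis
    have xR: "x t \<in> Rn n" if "t \<in> {0..1}" for t using x(1) that by (auto simp: continuous_map_def)
    have cux: "continuous_map (top_of_set {0..1}) (M (Suc l)) (\<lambda>t. u (Suc l) (x t))"
      using continuous_map_compose[OF x(1) uc] by (simp add: o_def)
    have "u (Suc l) (x t) = g t" if "t \<in> {0..1}" for t
      by (rule lift_unique[OF cov _ cux Suc.prems(1)[unfolded pathin_def], where ?x0.0 = 0])
        (use x xR pu that Suc.prems in \<open>auto simp: connected_space_subtopology\<close>)
    then show ?case using x by blast
  qed
  have onto: "u l ` Rn n = topspace (M l)" for l
  proof (intro equalityI subsetI)
    fix s assume "s \<in> topspace (M l)"
    then obtain g where g: "pathin (M l) g" "g 0 = u l 0" "g 1 = s"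
      using path_conn[of l] uM[of 0 l] unfolding path_connected_space_def by blast
    from lift[OF g(1,2)] obtain x where x: "continuous_map (top_of_set {0..1}) (RnT n) x"
      "\<forall>t\<in>{0..1}. u l (x t) = g t" by blast
    then have "x 1 \<in> Rn n" "u l (x 1) = s" using g(3) by (auto simp: continuous_map_def)
    then show "s \<in> u l ` Rn n" by blast
  qed (use uM in auto)
  \<comment> \<open>a section \<open>\<sigma>\<close> of \<open>u l\<close> yields the section \<open>\<sigma> \<circ>
      p\<close> one level higher, on a neighbourhood inside one sheet of \<open>p\<close>\<close>
  have sect: "\<exists>V \<sigma>. openin (M l) V \<and> u l a \<in> V \<and>
        continuous_map (subtopology (M l) V) (RnT n) \<sigma> \<and> \<sigma> (u l a) = a \<and> (\<forall>s\<in>V. u l (\<sigma> s) = s)"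
    if a: "a \<in> Rn n" for l a
  proof (induction l)
    case 0
    from cov0 a obtain V U where V: "openin (M 0) V" "u0 a \<in> V" "openin (RnT n) U" "a \<in> U"
      "homeomorphic_map (subtopology (RnT n) U) (subtopology (M 0) V) u0"
      by (metis covering_map_sheet topspace_euclidean_subtopology)
    then obtain q where q: "homeomorphic_maps (subtopology (RnT n) U) (subtopology (M 0) V) u0 q"
      using homeomorphic_map_maps by blast
    have VM: "V \<subseteq> topspace (M 0)" using V(1) openin_subset by blast
    show ?case
      using V q VM a by (intro exI[of _ V] exI[of _ q])
        (auto simp: u_0 homeomorphic_maps_def continuous_map_in_subtopology subset_iff)
  next
    case (Suc l)
    then obtain V \<sigma> where V: "openin (M l) V" "u l a \<in> V" "continuous_map (subtopology (M l) V) (RnT n) \<sigma>"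
      "\<sigma> (u l a) = a" "\<forall>s\<in>V. u l (\<sigma> s) = s" by blast
    have pc: "continuous_map (M (Suc l)) (M l) (p (Suc l))" using cov by (simp add: covering_map_def)
    obtain V1 U where U: "openin (M l) V1" "openin (M (Suc l)) U" "u (Suc l) a \<in> U"
      "homeomorphic_map (subtopology (M (Suc l)) U) (subtopology (M l) V1) (p (Suc l))"
      using covering_map_sheet[OF cov uM[OF a]] by metis
    have inj: "inj_on (p (Suc l)) U"
      using homeomorphic_imp_injective_map[OF U(4)] openin_subset[OF U(2)] by (simp add: inf.absorb2)
    define W where "W = {s \<in> topspace (M (Suc l)). p (Suc l) s \<in> V}"
    have W: "openin (M (Suc l)) W" unfolding W_def using pc V(1) by (rule openin_continuous_map_preimage)
    have cpW: "continuous_map (subtopology (M (Suc l)) W) (subtopology (M l) V) (p (Suc l))"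
      using pc by (auto simp: W_def continuous_map_in_subtopology intro: continuous_map_from_subtopology)
    have cs: "continuous_map (subtopology (M (Suc l)) W) (RnT n) (\<lambda>s. \<sigma> (p (Suc l) s))"
      using continuous_map_compose[OF cpW V(3)] by (simp add: o_def)
    have cus: "continuous_map (subtopology (M (Suc l)) W) (M (Suc l)) (\<lambda>s. u (Suc l) (\<sigma> (p (Suc l) s)))"
      using continuous_map_compose[OF cs uc] by (simp add: o_def)
    define N where "N = U \<inter> {s \<in> topspace (subtopology (M (Suc l)) W). u (Suc l) (\<sigma> (p (Suc l) s)) \<in> U}"
    have "openin (M (Suc l)) {s \<in> topspace (subtopology (M (Suc l)) W). u (Suc l) (\<sigma> (p (Suc l) s)) \<in> U}"
      using openin_continuous_map_preimage[OF cus U(2)] W openin_trans_full by blast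
    then have N: "openin (M (Suc l)) N" using U(2) by (simp add: N_def openin_Int)
    have "N \<subseteq> W" by (auto simp: N_def)
    have "u (Suc l) (\<sigma> (p (Suc l) s)) = s" if "s \<in> N" for s
    proof (rule inj_onD[OF inj])
      have "p (Suc l) s \<in> V" using that by (auto simp: N_def W_def)
      moreover have "\<sigma> (p (Suc l) s) \<in> Rn n" using cs that \<open>N \<subseteq> W\<close> by (auto simp: continuous_map_def N_def)
      ultimately show "p (Suc l) (u (Suc l) (\<sigma> (p (Suc l) s))) = p (Suc l) s" using V(5) pu by simp
    qed (use that in \<open>auto simp: N_def\<close>)
    moreover have "u (Suc l) a \<in> N" using U(3) V uM[OF a, of "Suc l"] a by (auto simp: N_def W_def pu)
    moreover have "continuous_map (subtopology (M (Suc l)) N) (RnT n) (\<lambda>s. \<sigma> (p (Suc l) s))"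
      using cs \<open>N \<subseteq> W\<close> continuous_map_from_subtopology_mono by blast
    ultimately show ?case using N V(4) a
      by (intro exI[of _ N] exI[of _ "\<lambda>s. \<sigma> (p (Suc l) s)"]) (auto simp: pu)
  qed
  \<comment> \<open>pigeonhole: the multiples of a period of \<open>M l\<close> have only \<open>d l\<close> possible
      images in \<open>M (Suc l)\<close>\<close>
  have findex: "\<exists>N>0. \<forall>z\<in>Zn n. u l (real N *\<^sub>R z) = u l 0" for l
  proof (induction l)
    case 0
    show ?case using u0_eq[of _ 0] Zn_subset by (intro exI[of _ 1]) (auto simp: u_0)
  next
    case (Suc l)
    then obtain N where N: "N > 0" "\<forall>z\<in>Zn n. u l (real N *\<^sub>R z) = u l 0" by blast
    let ?F = "{s \<in> topspace (M (Suc l)). p (Suc l) s = u l 0}"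
    have F: "card ?F = d l" using d(2)[of l] uM[of 0 l] by (simp add: covering_of_degree_def)
    then have Ffin: "finite ?F" using d(1)[of l] by (metis card.infinite not_numeral_le_zero)
    have "u (Suc l) (real (fact (d l) * N) *\<^sub>R z) = u (Suc l) 0" if z: "z \<in> Zn n" for z
    proof -
      have zR: "z \<in> Rn n" using z Zn_subset by blast
      let ?f = "\<lambda>j::nat. u (Suc l) (real (j * N) *\<^sub>R z)"
      have "?f ` {0..d l} \<subseteq> ?F"
      proof clarsimp
        fix j assume "j \<le> d l"
        have "real j *\<^sub>R z \<in> Zn n" using z by (metis Zn_closed(4) of_int_of_nat_eq)
        then have "u l (real N *\<^sub>R (real j *\<^sub>R z)) = u l 0" using N by blast
        then show "u (Suc l) ((real j * real N) *\<^sub>R z) \<in> topspace (M (Suc l)) \<and>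
            p (Suc l) (u (Suc l) ((real j * real N) *\<^sub>R z)) = u l 0"
          using zR by (simp add: uM pu mult.commute)
      qed
      from card_mono[OF Ffin this] have "card (?f ` {0..d l}) \<le> d l" unfolding F .
      then have "\<not> inj_on ?f {0..d l}" by (metis card_image card_atLeastAtMost diff_zero Suc_n_not_le_n)
      then obtain i j where ij: "i \<le> d l" "j \<le> d l" "i < j" "?f i = ?f j"
        unfolding inj_on_def by (metis atLeastAtMost_iff linorder_neqE_nat)
      define c where "c = j - i"
      have c: "c > 0" "c \<le> d l" using ij by (auto simp: c_def)
      have "u (Suc l) (real (j * N) *\<^sub>R z - real (i * N) *\<^sub>R z) = u (Suc l) 0"
        using ij(4) ueq[of "real (j * N) *\<^sub>R z" "real (i * N) *\<^sub>R z" "Suc l"] zR by auto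
      moreover have "real (j * N) *\<^sub>R z - real (i * N) *\<^sub>R z = real (c * N) *\<^sub>R z"
        using ij(3) by (simp add: c_def of_nat_diff algebra_simps)
      ultimately have uc0: "u (Suc l) (real (c * N) *\<^sub>R z) = u (Suc l) 0" by simp
      have mult: "u (Suc l) (real (m * (c * N)) *\<^sub>R z) = u (Suc l) 0" for m
      proof (induction m)
        case (Suc m)
        have "real (Suc m * (c * N)) *\<^sub>R z = real (m * (c * N)) *\<^sub>R z + (real (c * N) *\<^sub>R z - 0)"
          by (simp add: algebra_simps)
        then show ?case using period[OF uc0, of "real (m * (c * N)) *\<^sub>R z"] Suc zR by simp
      qed simp
      obtain m where "fact (d l) = m * c" using dvd_fact[of c "d l"] c by (metis Suc_leI dvd_def mult.commute One_nat_def)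
      then show ?thesis using mult[of m] by (simp add: mult.assoc)
    qed
    then show ?case using N(1) by (intro exI[of _ "fact (d l) * N"]) auto
  qed
  have "torus_tower n M p x0 u"
  proof (unfold_locales, fact uc, fact onto, fact pu, fact sect, fact ueq)
    show "u 0 0 = x0" using w a by (simp add: u_0 u0_def)
    show "u 0 x = u 0 0 \<longleftrightarrow> x \<in> Zn n" if "x \<in> Rn n" for x using u0_eq[of x 0] that by (simp add: u_0)
    show "covering_map (RnT n) (M 0) (u 0)" using cov0 by (simp add: u_0)
  qed (fact findex cov M)+
  then show ?thesis by (rule that)
qed

section \<open>The flow on the solenoid\<close>

context torus_tower
begin

text \<open>Any parameter of the coordinate \<open>s l\<close> may be used, see \<open>flow_level\<close> below.\<close>

definition flow :: "vec \<Rightarrow> (nat \<Rightarrow> 'a) \<Rightarrow> nat \<Rightarrow> 'a" where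
  "flow t s = (\<lambda>l. u l ((SOME a. a \<in> Rn n \<and> u l a = s l) + t))"

definition period :: "nat \<Rightarrow> vec set" where
  "period l = {z \<in> Rn n. u l z = u l 0}"

abbreviation S :: "(nat \<Rightarrow> 'a) topology" where "S \<equiv> solenoid M p"
abbreviation X :: "(nat \<Rightarrow> 'a) topology" where "X \<equiv> base_fibre M p x0"

definition cylinder :: "nat \<Rightarrow> (nat \<Rightarrow> 'a) \<Rightarrow> (nat \<Rightarrow> 'a) set" where
  "cylinder l y = {y' \<in> topspace X. y' l = y l}"

lemma topspace_S: "topspace S = {s. \<forall>l. s l \<in> topspace (M l) \<and> p (Suc l) (s (Suc l)) = s l}"
  by (auto simp: solenoid_def PiE_iff)

lemma topspace_X: "topspace X = {s \<in> topspace S. s 0 = x0}"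
  by (auto simp: base_fibre_def)

lemma X_subset_S: "y \<in> topspace X \<Longrightarrow> y \<in> topspace S"
  by (simp add: topspace_X)

lemma continuous_projection: "continuous_map S (M l) (\<lambda>s. s l)"
  unfolding solenoid_def by (intro continuous_map_from_subtopology continuous_map_product_projection) auto

lemma u_in_M: "a \<in> Rn n \<Longrightarrow> u l a \<in> topspace (M l)"
  using u_onto by blast

lemma level_parameter:
  assumes "s \<in> topspace S"
  obtains a where "a \<in> Rn n" "s l = u l a"
proof -
  have "s l \<in> u l ` Rn n" unfolding u_onto using assms by (simp add: topspace_S)
  then show ?thesis by (elim imageE) (rule that)
qed

lemma period_closed:
  "0 \<in> period l" "z \<in> period l \<Longrightarrow> w \<in> period l \<Longrightarrow> z + w \<in> period l"
  "z \<in> period l \<Longrightarrow> w \<in> period l \<Longrightarrow> z - w \<in> period l" "z \<in> period l \<Longrightarrow> - z \<in> period l"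
  using u_eq_iff[of z w l] u_eq_iff[of z "- w" l] u_eq_iff[of 0 w l] u_eq_iff[of 0 z l] u_eq_iff[of 0 "-w" l] 
  by (auto simp: period_def)

lemma u_add_period: "a \<in> Rn n \<Longrightarrow> z \<in> Rn n \<Longrightarrow> u l (a + z) = u l a \<longleftrightarrow> z \<in> period l"
  using u_eq_iff[of "a + z" a l] by (simp add: period_def)

lemma u_eq_period: "a \<in> Rn n \<Longrightarrow> b \<in> Rn n \<Longrightarrow> u l a = u l b \<longleftrightarrow> a - b \<in> period l"
  using u_eq_iff[of a b l] by (simp add: period_def)

lemma period_0: "period 0 = Zn n"
  using u_0_eq_iff Zn_subset by (auto simp: period_def)

lemma period_Suc: "period (Suc l) \<subseteq> period l"
proof
  fix z assume "z \<in> period (Suc l)"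
  then have z: "z \<in> Rn n" "u (Suc l) z = u (Suc l) 0" by (auto simp: period_def)
  then have "u l z = u l 0" using u_compatible[of z l] u_compatible[of 0 l] by simp
  then show "z \<in> period l" using z by (simp add: period_def)
qed

lemma period_antimono: "l \<le> m \<Longrightarrow> period m \<subseteq> period l"
  by (induction rule: dec_induct) (use period_Suc in auto)

lemma period_Zn: "period l \<subseteq> Zn n" 
  using period_antimono[of 0 l] period_0 by simp

lemma period_multiples: obtains N where "N > 0" "\<And>z. z \<in> Zn n \<Longrightarrow> real N *\<^sub>R z \<in> period l"
  using finite_index[of l] Zn_subset by (auto simp: period_def subset_iff)

lemma flow_level:
  assumes "s l = u l a" "a \<in> Rn n" "t \<in> Rn n"
  shows "flow t s l = u l (a + t)"
proof -
  let ?b = "SOME a. a \<in> Rn n \<and> u l a = s l"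
  have b: "?b \<in> Rn n \<and> u l ?b = s l" by (rule someI[of _ a]) (use assms in auto)
  then have "?b - a \<in> period l" using assms u_eq_period[of ?b a l] by simp
  then have "u l ((a + t) + (?b - a)) = u l (a + t)"
    using assms u_add_period[of "a + t" "?b - a" l] b by simp
  then show ?thesis by (simp add: flow_def algebra_simps)
qed

lemma flow_in_S [simp]:
  assumes s: "s \<in> topspace S" and t: "t \<in> Rn n"
  shows "flow t s \<in> topspace S"
  unfolding topspace_S
proof (intro CollectI allI conjI)
  fix l
  obtain a where a: "a \<in> Rn n" "s (Suc l) = u (Suc l) a" using level_parameter[OF s] by blast
  have "p (Suc l) (s (Suc l)) = s l" using s by (simp add: topspace_S)
  then have "s l = u l a" using a u_compatible[of a l] by simp
  then show "flow t s l \<in> topspace (M l)" "p (Suc l) (flow t s (Suc l)) = flow t s l"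
    using a t by (simp_all add: flow_level u_compatible u_in_M)
qed

lemma flow_0 [simp]: 
  assumes s: "s \<in> topspace S" shows "flow 0 s = s"
proof
  fix l obtain a where "a \<in> Rn n" "s l = u l a" using level_parameter[OF s] by blast
  then show "flow 0 s l = s l" by (simp add: flow_level)
qed

lemma flow_add: 
  assumes s: "s \<in> topspace S" and t: "t \<in> Rn n" "t' \<in> Rn n"
  shows "flow t (flow t' s) = flow (t' + t) s"
proof
  fix l obtain a where a: "a \<in> Rn n" "s l = u l a" using level_parameter[OF s] by blast
  then have "flow t' s l = u l (a + t')" using t by (simp add: flow_level)
  then have "flow t (flow t' s) l = u l (a + t' + t)" using a t by (intro flow_level) auto
  then show "flow t (flow t' s) l = flow (t' + t) s l" 
    using flow_level[of s l a "t' + t"] a t by (simp add: add.assoc)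
qed

lemma flow_level_eq_iff:
  assumes s: "s \<in> topspace S" and t: "t \<in> Rn n"
  shows "flow t s l = s l \<longleftrightarrow> t \<in> period l"
proof -
  obtain a where a: "a \<in> Rn n" "s l = u l a" using level_parameter[OF s] by blast
  then show ?thesis using flow_level[of s l a t] t u_add_period by simp
qed

lemma flow_level_cong:
  assumes s: "s \<in> topspace S" and t: "t \<in> Rn n" and eq: "s l = s' l"
  shows "flow t s l = flow t s' l"
proof -
  obtain a where a: "a \<in> Rn n" "s l = u l a" using level_parameter[OF s] by blast
  then show ?thesis using flow_level[of s l a t] flow_level[of s' l a t] t eq by simp
qed

lemma flow_fixed_iff:
  assumes s: "s \<in> topspace S" and t: "t \<in> Rn n"
  shows "flow t s = s \<longleftrightarrow> (\<forall>l. t \<in> period l)"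
  by (simp add: fun_eq_iff flow_level_eq_iff[OF assms])

lemma flow_in_X_iff:
  assumes y: "y \<in> topspace X" and t: "t \<in> Rn n"
  shows "flow t y \<in> topspace X \<longleftrightarrow> t \<in> Zn n"
  using flow_level_eq_iff[of y t 0] assms by (auto simp: topspace_X period_0)

lemma flow_in_cylinder_iff:
  assumes y: "y \<in> topspace X" "y' \<in> cylinder l y" and t: "t \<in> Zn n"
  shows "flow t y' \<in> cylinder l y \<longleftrightarrow> t \<in> period l"
  using flow_level_eq_iff[of y' t l] flow_in_X_iff[of y' t] assms Zn_subset X_subset_S
  by (auto simp: cylinder_def)

lemma level_determines_lower:
  assumes s: "s \<in> topspace S" "s' \<in> topspace S" and "l \<le> m" "s m = s' m"
  shows "s l = s' l"
  using assms(3,4)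
proof (induction rule: inc_induct)
  case (step i)
  have "s i = p (Suc i) (s (Suc i))" "s' i = p (Suc i) (s' (Suc i))" using s by (auto simp: topspace_S)
  then show ?case using step by simp
qed 

lemma cylinder_mono: "y \<in> topspace X \<Longrightarrow> l \<le> m \<Longrightarrow> cylinder m y \<subseteq> cylinder l y"
  using level_determines_lower X_subset_S by (auto simp: cylinder_def)

lemma continuous_flow: "continuous_map (prod_topology (RnT n) S) S (\<lambda>(t, s). flow t s)"
proof -
  let ?P = "prod_topology (RnT n) S"
  have "continuous_map ?P (M l) (\<lambda>w. flow (fst w) (snd w) l)" for l
  proof (rule continuous_map_locally)
    fix w assume w: "w \<in> topspace ?P"
    then have s: "snd w \<in> topspace S" by auto
    obtain a where a: "a \<in> Rn n" "snd w l = u l a" using level_parameter[OF s] by blast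
    obtain V \<sigma> where V: "openin (M l) V" "u l a \<in> V" "continuous_map (subtopology (M l) V) (RnT n) \<sigma>"
      "\<forall>s\<in>V. u l (\<sigma> s) = s" using u_section[OF a(1)] by blast
    define N where "N = {w \<in> topspace ?P. snd w l \<in> V}"
    have c: "continuous_map ?P (M l) (\<lambda>w. snd w l)"
      using continuous_map_compose[OF continuous_map_snd continuous_projection] by (simp add: o_def)
    have N: "openin ?P N" unfolding N_def using c V(1) by (rule openin_continuous_map_preimage)
    have VM: "V \<subseteq> topspace (M l)" using V(1) openin_subset by blast
    have \<sigma>R: "\<sigma> s \<in> Rn n" if "s \<in> V" for s using V(3) that VM by (auto simp: continuous_map_def)
    have "continuous_map (subtopology ?P N) (subtopology (M l) V) (\<lambda>w. snd w l)"
      using c by (auto simp: continuous_map_in_subtopology N_def continuous_map_from_subtopology)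
    from continuous_map_compose[OF this V(3)]
    have c1: "continuous_map (subtopology ?P N) (RnT n) (\<lambda>w. \<sigma> (snd w l))" by (simp add: o_def)
    have c2: "continuous_map (subtopology ?P N) (RnT n) fst"
      by (intro continuous_map_from_subtopology continuous_map_fst)
    have "continuous_map (subtopology ?P N) (M l) (\<lambda>w. u l (\<sigma> (snd w l) + fst w))"
      using continuous_map_compose[OF continuous_map_Rn_add[OF c1 c2] u_continuous] by (simp add: o_def)
    then have "continuous_map (subtopology ?P N) (M l) (\<lambda>w. flow (fst w) (snd w) l)"
      by (rule continuous_map_eq) (use V(4) \<sigma>R in \<open>auto simp: N_def intro!: flow_level[symmetric]\<close>)
    then show "\<exists>N. openin ?P N \<and> w \<in> N \<and> continuous_map (subtopology ?P N) (M l) (\<lambda>w. flow (fst w) (snd w) l)"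
      using N a V(2) w by (intro exI[of _ N]) (auto simp: N_def)
  qed
  then have "continuous_map ?P (product_topology M UNIV) (\<lambda>w. flow (fst w) (snd w))"
    by (simp add: continuous_map_componentwise_UNIV)
  moreover have "flow (fst w) (snd w) \<in> topspace S" if "w \<in> topspace ?P" for w
    using that by auto
  ultimately show ?thesis
    by (subst (2) solenoid_def, subst continuous_map_in_subtopology)
      (auto simp: case_prod_unfold topspace_S)
qed

lemma continuous_flow_compose:
  assumes "continuous_map Y (RnT n) f" "continuous_map Y S g"
  shows "continuous_map Y S (\<lambda>y. flow (f y) (g y))"
  using continuous_map_compose[OF continuous_map_pairedI[OF assms] continuous_flow] by (simp add: o_def)

lemma continuous_into_X:
  "continuous_map Y X f \<longleftrightarrow> continuous_map Y S f \<and> (\<forall>y\<in>topspace Y. f y 0 = x0)"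
  by (auto simp: base_fibre_def continuous_map_in_subtopology)

text \<open>The local product structure of the solenoid: a local section of \<open>u 0\<close> measures how far \<open>s\<close> has
  moved along its leaf, and flowing back by this amount leads into the fibre.\<close>

lemma flow_box:
  assumes V: "openin X V" "v \<in> V" and t: "t \<in> Rn n"
  obtains N \<tau> where "openin S N" "flow t v \<in> N" "continuous_map (subtopology S N) (RnT n) \<tau>"
    "\<tau> (flow t v) = t" "\<forall>s\<in>N. flow (- \<tau> s) s \<in> V"
    "continuous_map (subtopology S N) X (\<lambda>s. flow (- \<tau> s) s)"
proof -
  have vX: "v \<in> topspace X" using V openin_subset by blast
  then have v: "v \<in> topspace S" "v 0 = u 0 0" by (auto simp: topspace_X u_base)
  obtain W \<sigma> where W: "openin (M 0) W" "u 0 t \<in> W" "continuous_map (subtopology (M 0) W) (RnT n) \<sigma>"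
      "\<sigma> (u 0 t) = t" "\<forall>s\<in>W. u 0 (\<sigma> s) = s" using u_section[OF t, of 0] by blast
  define N0 where "N0 = {s \<in> topspace S. s 0 \<in> W}"
  have N0: "openin S N0" unfolding N0_def using continuous_projection W(1) by (rule openin_continuous_map_preimage)
  define \<tau> where "\<tau> = (\<lambda>s :: nat \<Rightarrow> 'a. \<sigma> (s 0))"
  have "continuous_map (subtopology S N0) (subtopology (M 0) W) (\<lambda>s. s 0)"
    using continuous_projection by (auto simp: continuous_map_in_subtopology N0_def continuous_map_from_subtopology)
  from continuous_map_compose[OF this W(3)]
  have c\<tau>: "continuous_map (subtopology S N0) (RnT n) \<tau>" by (simp add: o_def \<tau>_def)
  have N0S: "N0 \<subseteq> topspace S" by (auto simp: N0_def)
  have \<tau>R: "\<tau> s \<in> Rn n" if "s \<in> N0" for s using c\<tau> that N0S by (auto simp: continuous_map_def)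
  have cS: "continuous_map (subtopology S N0) S (\<lambda>s. flow (- \<tau> s) s)"
    by (intro continuous_flow_compose continuous_map_Rn_minus c\<tau> continuous_map_from_subtopology)
      (simp add: continuous_map_id[unfolded id_def])
  have X: "flow (- \<tau> s) s 0 = x0" if "s \<in> N0" for s
  proof -
    have "s 0 = u 0 (\<tau> s)" using W(5) that by (simp add: N0_def \<tau>_def)
    then show ?thesis using flow_level[of s 0 "\<tau> s" "- \<tau> s"] \<tau>R[OF that] by (simp add: u_base)
  qed
  have cX: "continuous_map (subtopology S N0) X (\<lambda>s. flow (- \<tau> s) s)"
    using cS X by (auto simp: continuous_into_X)
  define N where "N = {s \<in> topspace (subtopology S N0). flow (- \<tau> s) s \<in> V}"
  have "openin (subtopology S N0) N" unfolding N_def using cX V(1) by (rule openin_continuous_map_preimage)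
  then have N: "openin S N" using N0 openin_trans_full by blast
  have NN0: "N \<subseteq> N0" by (auto simp: N_def)
  have fv: "flow t v 0 = u 0 t" using flow_level[of v 0 0 t] v t by simp
  show ?thesis
  proof (rule that[OF N])
    show t': "\<tau> (flow t v) = t" by (simp add: \<tau>_def fv W)
    have "flow (- t) (flow t v) = v" using flow_add[of v "-t" t] v t by simp
    then show "flow t v \<in> N" using v t fv W(2) V(2) t' by (auto simp: N_def N0_def)
    show "continuous_map (subtopology S N) (RnT n) \<tau>" using c\<tau> NN0 continuous_map_from_subtopology_mono by blast
    show "continuous_map (subtopology S N) X (\<lambda>s. flow (- \<tau> s) s)" 
      using cX NN0 continuous_map_from_subtopology_mono by blast
  qed (auto simp: N_def)
qed

text \<open>The points of \<open>M l\<close> over \<open>x0\<close> form a discrete set: a local section of \<open>u l\<close> takes integer values on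
  them, so by continuity it is constant on those near \<open>y' l\<close>.\<close>

lemma openin_cylinder:
  assumes y: "y \<in> topspace X"
  shows "openin X (cylinder l y)"
proof -
  have "\<exists>T. openin X T \<and> y' \<in> T \<and> T \<subseteq> cylinder l y" if y': "y' \<in> cylinder l y" for y'
  proof -
    have y'X: "y' \<in> topspace X" "y' l = y l" using y' by (auto simp: cylinder_def)
    obtain b where b: "b \<in> Rn n" "y' l = u l b" using level_parameter[OF X_subset_S[OF y'X(1)]] by blast
    obtain W \<sigma> where W: "openin (M l) W" "u l b \<in> W" "continuous_map (subtopology (M l) W) (RnT n) \<sigma>"
      "\<sigma> (u l b) = b" "\<forall>s\<in>W. u l (\<sigma> s) = s" using u_section[OF b(1), of l] by blast
    have WM: "W \<subseteq> topspace (M l)" using W(1) openin_subset by blast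
    have \<sigma>R: "\<sigma> s \<in> Rn n" if "s \<in> W" for s using W(3) that WM by (auto simp: continuous_map_def)
    define W' where "W' = {s \<in> topspace (subtopology (M l) W). \<sigma> s \<in> Rn n \<inter> ball b 1}"
    have "openin (subtopology (M l) W) W'" unfolding W'_def
      using W(3) by (rule openin_continuous_map_preimage) (simp add: openin_open_Int)
    then have W': "openin (M l) W'" using W(1) openin_trans_full by blast
    define T where "T = {y' \<in> topspace X. y' l \<in> W'}"
    have "continuous_map X (M l) (\<lambda>s. s l)"
      unfolding base_fibre_def by (intro continuous_map_from_subtopology continuous_projection)
    then have T: "openin X T" unfolding T_def using W' by (rule openin_continuous_map_preimage)
    have low: "u 0 c = x0" if "c \<in> Rn n" "z \<in> topspace X" "z l = u l c" for c z
    proof -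
      have "flow (- c) z l = u l 0" using flow_level[of z l c "-c"] that by simp
      define z' where "z' = (\<lambda>j. u j c)"
      have "z' \<in> topspace S" using that(1) by (auto simp: z'_def topspace_S u_in_M u_compatible)
      then have "z 0 = z' 0" using that(2,3) level_determines_lower[of z z' 0 l] by (simp add: z'_def X_subset_S)
      then show ?thesis using that by (simp add: z'_def topspace_X)
    qed
    have b0: "b \<in> Zn n" using low[OF b(1) y'X(1) b(2)] u_0_eq_iff b u_base by simp
    have "T \<subseteq> cylinder l y"
    proof
      fix z assume z: "z \<in> T"
      then have zW: "z l \<in> W" "z \<in> topspace X" "dist b (\<sigma> (z l)) < 1" by (auto simp: T_def W'_def)
      then have c: "\<sigma> (z l) \<in> Rn n" "u l (\<sigma> (z l)) = z l" using W \<sigma>R by auto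
      then have "\<sigma> (z l) \<in> Zn n" using low[OF c(1) zW(2)] u_0_eq_iff u_base by simp
      then have "\<sigma> (z l) = b" using Zn_discrete[OF b0 _ zW(3)] by simp
      then show "z \<in> cylinder l y" using zW c y'X b by (simp add: cylinder_def)
    qed
    moreover have "y' \<in> T" using y'X b W WM \<sigma>R by (auto simp: T_def W'_def)
    ultimately show ?thesis using T by blast
  qed
  then show ?thesis by (subst openin_subopen) blast
qed

text \<open>A basic open set of the product restricts finitely many coordinates, and one coordinate of a point
  of the solenoid determines all lower ones.\<close>

lemma cylinder_in_open:
  assumes V: "openin X V" "y \<in> V"
  obtains m where "cylinder m y \<subseteq> V"
proof -
  obtain V' where V': "openin (product_topology M UNIV) V'"
      "V = V' \<inter> {x. \<forall>l. p (Suc l) (x (Suc l)) = x l} \<inter> {y. y 0 = x0}"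
    using V(1) unfolding base_fibre_def solenoid_def subtopology_subtopology openin_subtopology by blast
  then have "y \<in> V'" using V by blast
  then obtain U where U: "finite {i. U i \<noteq> topspace (M i)}" "\<forall>i. openin (M i) (U i)" "y \<in> Pi\<^sub>E UNIV U" "Pi\<^sub>E UNIV U \<subseteq> V'"
    using V'(1) unfolding openin_product_topology_alt by (auto simp: )
  obtain m where m: "\<And>i. U i \<noteq> topspace (M i) \<Longrightarrow> i \<le> m"
    using finite_nat_set_iff_bounded_le U(1) by auto
  have yX: "y \<in> topspace X" using V openin_subset by blast
  have "cylinder m y \<subseteq> V"
  proof
    fix z assume z: "z \<in> cylinder m y"
    then have zX: "z \<in> topspace X" "z m = y m" by (auto simp: cylinder_def)
    have "z i \<in> U i" for i
    proof (cases "i \<le> m")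
      case True
      then have "z i = y i" using level_determines_lower zX yX X_subset_S by metis
      then show ?thesis using U(3) by auto
    next
      case False
      then have "U i = topspace (M i)" using m by blast
      then show ?thesis using zX by (auto simp: topspace_X topspace_S)
    qed
    then have "z \<in> V'" using U(4) by auto
    then show "z \<in> V" using V'(2) zX by (auto simp: topspace_X topspace_S)
  qed
  then show ?thesis by (rule that)
qed

text \<open>This is minimality of the foliation: every leaf meets every non-empty open subset of the fibre.\<close>

lemma flow_into_cylinder:
  assumes s: "s \<in> topspace S" and y: "y \<in> topspace X"
  obtains t where "t \<in> Rn n" "flow t s \<in> cylinder m y"
proof -
  obtain a where a: "a \<in> Rn n" "s m = u m a" using level_parameter[OF s] by blast
  obtain b where b: "b \<in> Rn n" "y m = u m b" using level_parameter[OF X_subset_S[OF y]] by blast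
  have f: "flow (b - a) s m = y m" using flow_level[of s m a "b - a"] a b by simp
  have S': "flow (b - a) s \<in> topspace S" using s a b by simp
  then have "flow (b - a) s 0 = y 0" using level_determines_lower[OF S' X_subset_S[OF y] _ f] by simp
  then have "flow (b - a) s \<in> cylinder m y" using f S' y by (auto simp: cylinder_def topspace_X)
  then show ?thesis using that a b by blast
qed

lemma compact_S: "compact_space S"
proof -
  have "closedin (product_topology M UNIV) {x \<in> topspace (product_topology M UNIV). p (Suc l) (x (Suc l)) = x l}" for l
  proof (rule closedin_continuous_maps_eq)
    show "Hausdorff_space (M l)" by (rule Hausdorff)
    have c1: "continuous_map (product_topology M UNIV) (M (Suc l)) (\<lambda>x. x (Suc l))"
      by (rule continuous_map_product_projection) auto
    have c2: "continuous_map (M (Suc l)) (M l) (p (Suc l))" using covering by (simp add: covering_map_def)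
    show "continuous_map (product_topology M UNIV) (M l) (\<lambda>x. p (Suc l) (x (Suc l)))"
      by (rule continuous_map_compose[OF c1 c2, unfolded o_def])
    show "continuous_map (product_topology M UNIV) (M l) (\<lambda>x. x l)"
      by (rule continuous_map_product_projection) auto
  qed
  then have "closedin (product_topology M UNIV) (\<Inter>l. {x \<in> topspace (product_topology M UNIV). p (Suc l) (x (Suc l)) = x l})"
    by (intro closedin_Inter) auto
  moreover have "(\<Inter>l. {x \<in> topspace (product_topology M UNIV). p (Suc l) (x (Suc l)) = x l}) = topspace S"
    by (auto simp: topspace_S PiE_iff)
  ultimately have "compactin (product_topology M UNIV) (topspace S)"
    using compact by (intro closedin_compact_space) (auto simp: compact_space_product_topology)
  moreover have "S = subtopology (product_topology M UNIV) (topspace S)"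
    unfolding solenoid_def by (subst subtopology_restrict[symmetric]) simp
  ultimately show ?thesis by (metis compact_space_subtopology)
qed

lemma compact_X: "compact_space X"
proof -
  have "topspace S \<inter> {y. y 0 = x0} = {s \<in> topspace S. s 0 \<in> {x0}}" by auto
  moreover have "closedin (M 0) {x0}"
    using u_in_M[of 0 0] u_base Hausdorff by (intro closedin_Hausdorff_singleton) auto
  ultimately have "closedin S (topspace S \<inter> {y. y 0 = x0})"
    using closedin_continuous_map_preimage[OF continuous_projection, of 0 "{x0}"] by simp
  then have "compactin S (topspace S \<inter> {y. y 0 = x0})" using compact_S closedin_compact_space by blast
  then show ?thesis unfolding base_fibre_def
    by (metis compact_space_subtopology subtopology_restrict)
qed

text \<open>Compactness of the fibre makes the level uniform.\<close>

lemma locally_constant_on_fibre: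
  assumes "\<And>y. y \<in> topspace X \<Longrightarrow> \<exists>m. \<forall>y'\<in>cylinder m y. f y' = f y"
  obtains m where "\<And>y y'. y \<in> topspace X \<Longrightarrow> y' \<in> cylinder m y \<Longrightarrow> f y' = f y"
proof -
  obtain k where k: "\<And>y y'. y \<in> topspace X \<Longrightarrow> y' \<in> cylinder (k y) y \<Longrightarrow> f y' = f y"
    using assms by metis
  have self: "y \<in> cylinder l y" if "y \<in> topspace X" for l y using that by (simp add: cylinder_def)
  have "topspace X \<subseteq> \<Union>((\<lambda>y. cylinder (k y) y) ` topspace X)" using self by blast
  moreover have "\<forall>U\<in>(\<lambda>y. cylinder (k y) y) ` topspace X. openin X U" using openin_cylinder by blast
  ultimately obtain \<F> where F: "finite \<F>" "\<F> \<subseteq> (\<lambda>y. cylinder (k y) y) ` topspace X" "topspace X \<subseteq> \<Union>\<F>"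
    using compact_X unfolding compact_space_alt by meson
  then obtain Y where Y: "finite Y" "Y \<subseteq> topspace X" "\<F> = (\<lambda>y. cylinder (k y) y) ` Y"
    using finite_subset_image[OF F(1,2)] by (elim exE conjE) (rule that)
  obtain m where m: "\<And>y. y \<in> Y \<Longrightarrow> k y \<le> m"
    using Y(1) by (metis finite_imageI finite_nat_set_iff_bounded_le image_eqI)
  show ?thesis
  proof (rule that[of m])
    fix y y' assume y: "y \<in> topspace X" "y' \<in> cylinder m y"
    then obtain z where z: "z \<in> Y" "y \<in> cylinder (k z) z" using F(3) Y(3) by blast
    have "y' \<in> cylinder (k z) y" using y cylinder_mono m[OF z(1)] by blast
    then have "y' \<in> cylinder (k z) z" using z by (simp add: cylinder_def)
    then show "f y' = f y" using k[of z] z Y(2) by (metis subsetD)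
  qed
qed

lemma base_point: "(\<lambda>l. u l 0) \<in> topspace X"
  by (auto simp: topspace_X topspace_S u_in_M u_compatible u_base)

end

section \<open>Leaves and monodromy\<close>

lemma topspace_leaf_topology: "topspace (leaf_topology X) = topspace X"
proof -
  have "(\<Union>(\<Union>U\<in>{U. openin X U}. path_components_of (subtopology X U)))
      = (\<Union>U\<in>{U. openin X U}. \<Union>(path_components_of (subtopology X U)))"
    by blast
  also have "\<dots> = (\<Union>U\<in>{U. openin X U}. topspace X \<inter> U)"
    by (simp add: Union_path_components_of)
  also have "\<dots> = topspace X" using openin_topspace by blast
  finally show ?thesis by (simp add: leaf_topology_def)
qed

lemma continuous_map_leaf_topology_id: "continuous_map (leaf_topology X) X id"
proof -
  have "openin (leaf_topology X) U" if "openin X U" for U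
  proof -
    have "U = \<Union>(path_components_of (subtopology X U))"
      using Union_path_components_of[of "subtopology X U"] openin_subset[OF that] by auto
    moreover have "openin (leaf_topology X) C" if "C \<in> path_components_of (subtopology X U)" for C
      unfolding leaf_topology_def using that \<open>openin X U\<close> by (intro topology_generated_by_Basis) auto
    ultimately show ?thesis by (metis openin_Union)
  qed
  then show ?thesis
    using openin_subset by (auto simp: continuous_map_def topspace_leaf_topology Int_absorb1 Collect_conj_eq)
qed

text \<open>A path that starts in an open set \<open>U\<close> stays for a short time in one path component of \<open>U\<close>, hence
  is continuous for the leaf topology as well.\<close>

lemma pathin_leaf_iff:
  assumes "y \<in> topspace X" "g 0 = y"
  shows "pathin (leaf X y) g \<longleftrightarrow> pathin X g"
proof
  assume "pathin (leaf X y) g"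
  then have "continuous_map (top_of_set {0..1}) (leaf_topology X) g"
    by (simp add: pathin_def leaf_def continuous_map_in_subtopology)
  from continuous_map_compose[OF this continuous_map_leaf_topology_id] show "pathin X g"
    by (simp add: pathin_def)
next
  assume g: "pathin X g"
  have conn: "path_component_of (subtopology X U) (g t) (g t')"
    if "is_interval J" "J \<subseteq> {0..1}" "g ` J \<subseteq> U" "t \<in> J" "t' \<in> J" for U J t t'
  proof -
    have "path_connectedin euclideanreal J" using that(1) by (simp add: is_interval_path_connected)
    then have J: "path_connectedin (top_of_set {0..1}) J" using that(2) by (simp add: path_connectedin_subtopology)
    have "path_connectedin X (g ` J)"
      using path_connectedin_continuous_map_image[OF g[unfolded pathin_def] J] .
    then have "path_connectedin (subtopology X U) (g ` J)" using that(3) by (simp add: path_connectedin_subtopology)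
    then show ?thesis using that by (auto simp: path_component_of)
  qed
  have "continuous_map (top_of_set {0..1}) (leaf_topology X) g"
    unfolding leaf_topology_def
  proof (rule continuous_on_generated_topo)
    show "g ` topspace (top_of_set {0..1}) \<subseteq> \<Union>(\<Union>U\<in>{U. openin X U}. path_components_of (subtopology X U))"
      using topspace_leaf_topology[of X] continuous_map_image_subset_topspace[OF g[unfolded pathin_def]]
      by (simp add: leaf_topology_def)
    fix C assume "C \<in> (\<Union>U\<in>{U. openin X U}. path_components_of (subtopology X U))"
    then obtain U where U: "openin X U" "C \<in> path_components_of (subtopology X U)" by blast
    have "openin (top_of_set {0..1}) (g -` C \<inter> {0..1})"
    proof (subst openin_subopen, intro ballI)
      fix t assume t: "t \<in> g -` C \<inter> {0..1}"
      have CU: "C \<subseteq> U" using path_components_of_subset[OF U(2)] by simp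
      have "openin (top_of_set {0..1}) {t \<in> topspace (top_of_set {0..1}). g t \<in> U}"
        using g[unfolded pathin_def] U(1) by (rule openin_continuous_map_preimage)
      then obtain W where W: "open W" "{t \<in> {0..1}. g t \<in> U} = {0..1} \<inter> W"
        by (auto simp: openin_open)
      then have "t \<in> W" using t CU by blast
      then obtain d where d: "d > 0" "ball t d \<subseteq> W" using W(1) openE by blast
      let ?J = "{0..1} \<inter> ball t d"
      have "g t' \<in> C" if t': "t' \<in> ?J" for t'
      proof -
        have "is_interval ?J" by (simp add: is_interval_Int is_interval_ball_real)
        then have "path_component_of (subtopology X U) (g t) (g t')"
          using W d t t' by (intro conn[of ?J]) auto
        then show ?thesis using U(2) t
          unfolding path_components_of_def by (auto dest: path_component_of_trans)
      qed
      then show "\<exists>T. openin (top_of_set {0..1}) T \<and> t \<in> T \<and> T \<subseteq> g -` C \<inter> {0..1}"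
        using t d by (intro exI[of _ ?J]) auto
    qed
    then show "openin (top_of_set {0..1}) (g -` C \<inter> topspace (top_of_set {0..1}))" by simp
  qed
  moreover have "g t \<in> path_component_of_set X y" if "t \<in> {0..1}" for t
    using conn[of "{0..1}" UNIV 0 t] that assms is_interval_cc by simp
  ultimately show "pathin (leaf X y) g" 
    by (auto simp: pathin_def leaf_def continuous_map_in_subtopology)
qed

context torus_tower
begin

text \<open>The endpoint of the lift that starts at the origin; for loops it is the class of \<open>\<sigma>\<close> under the
  isomorphism of the fundamental group with \<open>\<int>\<^sup>n\<close>.\<close>

definition lift_end :: "(real \<Rightarrow> 'a) \<Rightarrow> vec \<Rightarrow> bool" where
  "lift_end \<sigma> z \<longleftrightarrow> (\<exists>x. pathin (RnT n) x \<and> x 0 = 0 \<and> (\<forall>t\<in>{0..1}. u 0 (x t) = \<sigma> t) \<and> x 1 = z)"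

lemma connected_space_unit: "connected_space (top_of_set {0..1::real})"
  by (simp add: connected_space_subtopology)

lemma lift_end_exists:
  assumes "loop_at (M 0) x0 \<sigma>"
  obtains z where "z \<in> Zn n" "lift_end \<sigma> z"
proof -
  obtain x where x: "pathin (RnT n) x" "x 0 = 0" "\<And>t. t \<in> {0..1} \<Longrightarrow> u 0 (x t) = \<sigma> t"
    by (rule lift_path[OF covering_u_0, of \<sigma> 0]) (use assms in \<open>auto simp: loop_at_def u_base\<close>)
  have "x 1 \<in> Rn n" using x(1) by (auto simp: pathin_def continuous_map_def)
  then have "x 1 \<in> Zn n" using x(3)[of 1] assms u_0_eq_iff[of "x 1"] by (simp add: loop_at_def u_base)
  then show ?thesis using x by (intro that[of "x 1"]) (auto simp: lift_end_def)
qed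

lemma lift_end_unique:
  assumes "lift_end \<sigma> z" "lift_end \<sigma> w" shows "z = w"
proof -
  obtain x y where x: "pathin (RnT n) x" "x 0 = 0" "\<forall>t\<in>{0..1}. u 0 (x t) = \<sigma> t" "x 1 = z"
    and y: "pathin (RnT n) y" "y 0 = 0" "\<forall>t\<in>{0..1}. u 0 (y t) = \<sigma> t" "y 1 = w"
    using assms unfolding lift_end_def by metis
  have "x 1 = y 1"
    by (rule lift_unique[OF covering_u_0 connected_space_unit x(1)[unfolded pathin_def] y(1)[unfolded pathin_def], where ?x0.0 = 0])
      (use x y in auto)
  then show ?thesis using x y by simp
qed

text \<open>The endpoints of the lifted loops form a lift of the constant path at \<open>x0\<close>.\<close>

lemma lift_end_homotopic:
  assumes hom: "homotopic_with (\<lambda>\<rho>. \<rho> 0 = x0 \<and> \<rho> 1 = x0) (top_of_set {0..1}) (M 0) \<sigma> \<tau>"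
    and \<sigma>: "lift_end \<sigma> z"
  shows "lift_end \<tau> z"
proof -
  let ?I = "top_of_set {0..1::real}"
  obtain h where h: "continuous_map (prod_topology ?I ?I) (M 0) h" "\<And>s. h (0, s) = \<sigma> s" "\<And>s. h (1, s) = \<tau> s"
    "\<And>t. t \<in> {0..1} \<Longrightarrow> h (t, 0) = x0 \<and> h (t, 1) = x0"
    using hom unfolding homotopic_with_def by blast
  have "continuous_map (prod_topology ?I euclideanreal) (prod_topology ?I ?I) (\<lambda>w. (fst w, max 0 (min 1 (snd w))))"
    using continuous_map_compose[OF continuous_map_snd continuous_map_clamp]
    by (intro continuous_map_pairedI continuous_map_fst) (simp add: o_def)
  from continuous_map_compose[OF this h(1)]
  have H: "continuous_map (prod_topology ?I euclideanreal) (M 0) (\<lambda>w. h (fst w, max 0 (min 1 (snd w))))"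
    by (simp add: o_def)
  obtain G where G: "continuous_map (prod_topology ?I ?I) (RnT n) G"
    "\<And>t. t \<in> topspace ?I \<Longrightarrow> G (t, 0) = 0"
    "\<And>t s. t \<in> topspace ?I \<Longrightarrow> s \<in> {0..1} \<Longrightarrow> u 0 (G (t, s)) = h (fst (t, s), max 0 (min 1 (snd (t, s))))"
    by (rule homotopy_lift[OF covering_u_0 H, of "\<lambda>_. 0"]) (use h in \<open>auto simp: u_base\<close>)
  have row: "continuous_map ?I (RnT n) (\<lambda>s. G (t, s))" if "t \<in> {0..1}" for t
  proof -
    have "continuous_map ?I (prod_topology ?I ?I) (\<lambda>s. (t, s))"
      using that by (intro continuous_map_pairedI) (auto simp: continuous_map_id[unfolded id_def])
    from continuous_map_compose[OF this G(1)] show ?thesis by (simp add: o_def)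
  qed
  have col: "continuous_map ?I (RnT n) (\<lambda>t. G (t, 1))"
  proof -
    have "continuous_map ?I (prod_topology ?I ?I) (\<lambda>t. (t, 1))"
      by (intro continuous_map_pairedI) (auto simp: continuous_map_id[unfolded id_def])
    from continuous_map_compose[OF this G(1)] show ?thesis by (simp add: o_def)
  qed
  have G01: "G (0, 1) \<in> Rn n" using row[of 0] by (auto simp: continuous_map_def)
  have "G (1, 1) = G (0, 1)"
    by (rule lift_unique[OF covering_u_0 connected_space_unit col, of "\<lambda>_. G (0, 1)" 0])
      (use G h(4) h(4)[of 0] G01 in auto)
  moreover have "lift_end \<sigma> (G (0, 1))"
    unfolding lift_end_def pathin_def using row[of 0] G h by (intro exI[of _ "\<lambda>s. G (0, s)"]) auto
  then have "G (0, 1) = z" using \<sigma> lift_end_unique by blast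
  moreover have "lift_end \<tau> (G (1, 1))"
    unfolding lift_end_def pathin_def using row[of 1] G h by (intro exI[of _ "\<lambda>s. G (1, s)"]) auto
  ultimately show ?thesis by simp
qed

text \<open>Flowing along the lifted path gives a lift to the leaf; lifts are unique in each coordinate, by
  induction on the level.\<close>

lemma leaf_lift_end:
  assumes \<sigma>: "lift_end \<sigma> z" and y: "y \<in> topspace X"
  shows "\<exists>\<gamma>. leaf_lift M p y \<sigma> \<gamma> \<and> \<gamma> 1 = flow z y"
    and "leaf_lift M p y \<sigma> \<gamma> \<Longrightarrow> \<gamma> 1 = flow z y"
proof -
  let ?I = "top_of_set {0..1::real}"
  obtain x where x: "pathin (RnT n) x" "x 0 = 0" "\<forall>t\<in>{0..1}. u 0 (x t) = \<sigma> t" "x 1 = z"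
    using \<sigma> unfolding lift_end_def by blast
  have yS: "y \<in> topspace S" using y X_subset_S by blast
  have xR: "x t \<in> Rn n" if "t \<in> {0..1}" for t using x(1) that by (auto simp: pathin_def continuous_map_def)
  define \<delta> where "\<delta> t = flow (x t) y" for t
  have \<delta>: "pathin S \<delta>"
    unfolding \<delta>_def pathin_def by (rule continuous_flow_compose) (use x yS in \<open>auto simp: pathin_def\<close>)
  have \<delta>0: "\<delta> 0 = y" using x yS by (simp add: \<delta>_def)
  have \<delta>\<sigma>: "\<delta> t 0 = \<sigma> t" if "t \<in> {0..1}" for t
    using flow_level[of y 0 0 "x t"] xR that x y by (simp add: \<delta>_def topspace_X u_base)
  have "leaf_lift M p y \<sigma> \<delta>"
    using \<delta> \<delta>0 \<delta>\<sigma> pathin_leaf_iff[OF yS, of \<delta>] by (simp add: leaf_lift_def)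
  then show "\<exists>\<gamma>. leaf_lift M p y \<sigma> \<gamma> \<and> \<gamma> 1 = flow z y" using x by (auto simp: \<delta>_def)
  assume "leaf_lift M p y \<sigma> \<gamma>"
  then have \<gamma>: "pathin S \<gamma>" "\<gamma> 0 = y" "\<And>t. t \<in> {0..1} \<Longrightarrow> \<gamma> t 0 = \<sigma> t"
    using pathin_leaf_iff[OF yS, of \<gamma>] by (auto simp: leaf_lift_def)
  have comp: "continuous_map ?I (M l) (\<lambda>t. g t l)" if "pathin S g" for g l
    using continuous_map_compose[OF that[unfolded pathin_def] continuous_projection] by (simp add: o_def)
  have pS: "p (Suc l) (g t (Suc l)) = g t l" if "pathin S g" "t \<in> {0..1}" for g t l
    using that by (auto simp: pathin_def continuous_map_def topspace_S)
  have "\<forall>t\<in>{0..1}. \<gamma> t l = \<delta> t l" for l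
  proof (induction l)
    case 0
    then show ?case using \<gamma> \<delta>\<sigma> by simp
  next
    case (Suc l)
    show ?case
    proof
      fix t :: real assume t: "t \<in> {0..1}"
      show "\<gamma> t (Suc l) = \<delta> t (Suc l)"
        by (rule lift_unique[OF covering connected_space_unit comp[OF \<gamma>(1)] comp[OF \<delta>], where ?x0.0 = 0])
          (use Suc t \<gamma>(2) \<delta>0 pS[OF \<gamma>(1)] pS[OF \<delta>] in auto)
    qed
  qed
  then have "\<gamma> 1 = \<delta> 1" by (auto simp: fun_eq_iff)
  then show "\<gamma> 1 = flow z y" using x by (simp add: \<delta>_def)
qed

lemma global_monodromy_loop_class:
  assumes \<sigma>: "loop_at (M 0) x0 \<sigma>" "lift_end \<sigma> z" and y: "y \<in> topspace X"
  shows "global_monodromy M p (loop_class (M 0) x0 \<sigma>) y = flow z y"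
  unfolding global_monodromy_def
proof (rule the_equality)
  have "homotopic_with (\<lambda>\<rho>. \<rho> 0 = x0 \<and> \<rho> 1 = x0) (top_of_set {0..1}) (M 0) \<sigma> \<sigma>"
    using \<sigma>(1) by (simp add: loop_at_def pathin_def)
  then have "\<sigma> \<in> loop_class (M 0) x0 \<sigma>" using \<sigma>(1) by (simp add: loop_class_def)
  then show "\<exists>\<tau>\<in>loop_class (M 0) x0 \<sigma>. \<exists>\<gamma>. leaf_lift M p y \<tau> \<gamma> \<and> flow z y = \<gamma> 1"
    using leaf_lift_end(1)[OF \<sigma>(2) y] by metis
  fix w assume "\<exists>\<tau>\<in>loop_class (M 0) x0 \<sigma>. \<exists>\<gamma>. leaf_lift M p y \<tau> \<gamma> \<and> w = \<gamma> 1"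
  then obtain \<tau> \<gamma> where "\<tau> \<in> loop_class (M 0) x0 \<sigma>" and \<gamma>: "leaf_lift M p y \<tau> \<gamma>" "w = \<gamma> 1" by blast
  then have "lift_end \<tau> z" using lift_end_homotopic[OF _ \<sigma>(2)] by (auto simp: loop_class_def)
  then show "w = flow z y" using leaf_lift_end(2)[OF _ y \<gamma>(1)] \<gamma>(2) by simp
qed

lemma global_monodromy_flow:
  shows "g \<in> carrier (fundamental_group (M 0) x0) \<Longrightarrow>
      \<exists>z\<in>Zn n. \<forall>y\<in>topspace X. global_monodromy M p g y = flow z y"
    and "z \<in> Zn n \<Longrightarrow>
      \<exists>g\<in>carrier (fundamental_group (M 0) x0). \<forall>y\<in>topspace X. global_monodromy M p g y = flow z y"
proof -
  assume "g \<in> carrier (fundamental_group (M 0) x0)"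
  then obtain \<sigma> where \<sigma>: "g = loop_class (M 0) x0 \<sigma>" "loop_at (M 0) x0 \<sigma>" by (auto simp: fundamental_group_def)
  then show "\<exists>z\<in>Zn n. \<forall>y\<in>topspace X. global_monodromy M p g y = flow z y"
    using lift_end_exists[OF \<sigma>(2)] global_monodromy_loop_class by metis
next
  assume z: "z \<in> Zn n"
  then have zR: "z \<in> Rn n" using Zn_subset by blast
  let ?\<sigma> = "\<lambda>t. u 0 (t *\<^sub>R z)"
  have x: "pathin (RnT n) (\<lambda>t. t *\<^sub>R z)"
    using zR by (auto simp: pathin_def intro!: continuous_intros)
  have "loop_at (M 0) x0 ?\<sigma>"
    using continuous_map_compose[OF x[unfolded pathin_def] u_continuous] z zR u_0_eq_iff
    by (simp add: loop_at_def pathin_def o_def u_base)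
  moreover have "lift_end ?\<sigma> z" unfolding lift_end_def using x by (intro exI[of _ "\<lambda>t. t *\<^sub>R z"]) auto
  ultimately have "\<forall>y\<in>topspace X. global_monodromy M p (loop_class (M 0) x0 ?\<sigma>) y = flow z y"
    using global_monodromy_loop_class by blast
  moreover have "loop_class (M 0) x0 ?\<sigma> \<in> carrier (fundamental_group (M 0) x0)"
    using \<open>loop_at (M 0) x0 ?\<sigma>\<close> unfolding fundamental_group_def by auto
  ultimately show "\<exists>g\<in>carrier (fundamental_group (M 0) x0). \<forall>y\<in>topspace X. global_monodromy M p g y = flow z y"
    by blast
qed

text \<open>This form of the local action, with integer vectors in place of classes of loops, is the one that
  the comparison of two towers uses.\<close>

lemma local_action_monodromy:
  "local_action (fundamental_group (M 0) x0) X (global_monodromy M p) W =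
     {(U, restrict (flow z) U) |U z. openin X U \<and> U \<subseteq> W \<and> z \<in> Zn n \<and> flow z ` U \<subseteq> W}"
  (is "?L = ?R")
proof -
  have eq: "restrict f U = restrict g U \<and> f ` U = g ` U"
    if "openin X U" "\<forall>y\<in>topspace X. f y = g y" for f g :: "(nat \<Rightarrow> 'a) \<Rightarrow> nat \<Rightarrow> 'a" and U
    using that openin_subset[OF that(1)] by (auto simp: fun_eq_iff restrict_def subset_iff image_iff)
  show ?thesis
  proof (intro equalityI subsetI)
    fix \<alpha> assume "\<alpha> \<in> ?L"
    then obtain U g where U: "\<alpha> = (U, restrict (global_monodromy M p g) U)" "openin X U" "U \<subseteq> W"
        "g \<in> carrier (fundamental_group (M 0) x0)" "global_monodromy M p g ` U \<subseteq> W"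
      unfolding local_action_def by blast
    obtain z where z: "z \<in> Zn n" "\<forall>y\<in>topspace X. global_monodromy M p g y = flow z y"
      using global_monodromy_flow(1)[OF U(4)] by blast
    then show "\<alpha> \<in> ?R" using eq[OF U(2) z(2)] U by auto
  next
    fix \<alpha> assume "\<alpha> \<in> ?R"
    then obtain U z where U: "\<alpha> = (U, restrict (flow z) U)" "openin X U" "U \<subseteq> W" "z \<in> Zn n" "flow z ` U \<subseteq> W"
      by blast
    obtain g where g: "g \<in> carrier (fundamental_group (M 0) x0)" "\<forall>y\<in>topspace X. global_monodromy M p g y = flow z y"
      using global_monodromy_flow(2)[OF U(4)] by blast
    have "\<alpha> = (U, restrict (global_monodromy M p g) U)" "global_monodromy M p g ` U \<subseteq> W"
      using eq[OF U(2) g(2)] U(1,5) by simp_all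
    then show "\<alpha> \<in> ?L" unfolding local_action_def using U(2,3) g(1) by blast
  qed
qed

end

section \<open>Integer lattices\<close>

abbreviation int_comb :: "(vec \<Rightarrow> int) \<Rightarrow> vec set \<Rightarrow> vec" where
  "int_comb c B \<equiv> \<Sum>b\<in>B. of_int (c b) *\<^sub>R b"

definition add_subgroup :: "vec set \<Rightarrow> bool" where
  "add_subgroup G \<longleftrightarrow> 0 \<in> G \<and> (\<forall>x\<in>G. \<forall>y\<in>G. x - y \<in> G)"

lemma add_subgroup_minus: "add_subgroup G \<Longrightarrow> x \<in> G \<Longrightarrow> - x \<in> G"
  unfolding add_subgroup_def by (metis diff_0)

lemma add_subgroup_diff: "add_subgroup G \<Longrightarrow> x \<in> G \<Longrightarrow> y \<in> G \<Longrightarrow> x - y \<in> G"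
  unfolding add_subgroup_def by blast

lemma add_subgroup_add: "add_subgroup G \<Longrightarrow> x \<in> G \<Longrightarrow> y \<in> G \<Longrightarrow> x + y \<in> G"
  using add_subgroup_minus[of G y] add_subgroup_diff[of G x "- y"] by simp

lemma add_subgroup_0: "add_subgroup G \<Longrightarrow> 0 \<in> G"
  by (simp add: add_subgroup_def)

lemma add_subgroup_scale: assumes G: "add_subgroup G" "x \<in> G" shows "of_int c *\<^sub>R x \<in> G"
proof -
  have n: "of_nat k *\<^sub>R x \<in> G" for k
    by (induction k) (use G in \<open>auto simp: add_subgroup_0 add_subgroup_add scaleR_add_left\<close>)
  show ?thesis
  proof (cases "c \<ge> 0")
    case True
    then show ?thesis using n[of "nat c"] by simp
  next
    case False
    then show ?thesis using add_subgroup_minus[OF G(1) n[of "nat (- c)"]] by simp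
  qed
qed

lemma add_subgroup_sum: "add_subgroup G \<Longrightarrow> (\<And>i. i \<in> I \<Longrightarrow> f i \<in> G) \<Longrightarrow> sum f I \<in> G"
  by (induction I rule: infinite_finite_induct) (auto simp: add_subgroup_0 add_subgroup_add)

lemma add_subgroup_comb: "add_subgroup G \<Longrightarrow> (\<And>i. i \<in> I \<Longrightarrow> f i \<in> G) \<Longrightarrow> (\<Sum>i\<in>I. of_int (c i) *\<^sub>R f i) \<in> G"
  by (intro add_subgroup_sum add_subgroup_scale)

lemma add_subgroup_Zn: "add_subgroup (Zn n)" by (auto simp: add_subgroup_def)

lemma inj_unit_vec: "inj_on unit_vec A"
  by (auto simp: inj_on_def) (metis unit_vec_apply zero_neq_one)

lemma independent_unit_vecs: "independent (unit_vec ` {..<n})"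
proof (rule independent_if_scalars_zero)
  fix f x assume s: "(\<Sum>x\<in>unit_vec ` {..<n}. f x *\<^sub>R x) = 0" and x: "x \<in> unit_vec ` {..<n}"
  then obtain i where i: "i < n" "x = unit_vec i" by blast
  have "(\<Sum>j<n. f (unit_vec j) *\<^sub>R unit_vec j) = 0" using s by (simp add: sum.reindex[OF inj_unit_vec])
  then have "apply_bcontfun (\<Sum>j<n. f (unit_vec j) *\<^sub>R unit_vec j) i = 0" by (simp add: zero_bcontfun.rep_eq)
  then show "f x = 0" using i coordinates_apply[OF i(1), of "\<lambda>j. f (unit_vec j)"] by simp
qed simp

lemma Rn_span: "Rn n = span (unit_vec ` {..<n})"
proof
  show "Rn n \<subseteq> span (unit_vec ` {..<n})"
  proof
    fix x assume "x \<in> Rn n"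
    then have "(\<Sum>i<n. apply_bcontfun x i *\<^sub>R unit_vec i) = x" by (rule Rn_coordinates)
    moreover have "(\<Sum>i<n. apply_bcontfun x i *\<^sub>R unit_vec i) \<in> span (unit_vec ` {..<n})"
      by (intro span_sum span_scale span_base) auto
    ultimately show "x \<in> span (unit_vec ` {..<n})" by simp
  qed
  show "span (unit_vec ` {..<n}) \<subseteq> Rn n"
    by (rule span_minimal[OF _ subspace_Rn]) (use unit_vec_Zn Zn_subset in auto)
qed

lemma finite_bounded_Zn: "finite {z \<in> Zn n. \<forall>i. \<bar>apply_bcontfun z i\<bar> \<le> C}"
proof -
  let ?B = "{z \<in> Zn n. \<forall>i. \<bar>apply_bcontfun z i\<bar> \<le> C}"
  let ?f = "\<lambda>z. \<lambda>i\<in>{..<n}. \<lfloor>apply_bcontfun z i\<rfloor>"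
  have "?f ` ?B \<subseteq> Pi\<^sub>E {..<n} (\<lambda>_. {- \<lceil>C\<rceil>..\<lceil>C\<rceil>})"
  proof (clarsimp simp: PiE_iff)
    fix z i assume "z \<in> Zn n" "\<forall>i. \<bar>apply_bcontfun z i\<bar> \<le> C"
    then have "apply_bcontfun z i \<in> \<int>" "\<bar>apply_bcontfun z i\<bar> \<le> C" by (auto simp: Zn_def)
    then show "- \<lceil>C\<rceil> \<le> \<lfloor>apply_bcontfun z i\<rfloor> \<and> \<lfloor>apply_bcontfun z i\<rfloor> \<le> \<lceil>C\<rceil>"
      by (auto elim!: Ints_cases) linarith+
  qed
  then have "finite (?f ` ?B)" by (rule finite_subset) (intro finite_PiE, auto)
  moreover have "inj_on ?f ?B"
  proof (rule inj_onI)
    fix z w assume z: "z \<in> ?B" "w \<in> ?B" "?f z = ?f w"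
    show "z = w"
    proof (rule Rn_eqI[of _ n])
      fix i assume i: "i < n"
      have "?f z i = ?f w i" using z(3) by metis
      then have "\<lfloor>apply_bcontfun z i\<rfloor> = \<lfloor>apply_bcontfun w i\<rfloor>" using i by simp
      moreover have "apply_bcontfun z i \<in> \<int>" "apply_bcontfun w i \<in> \<int>" using z by (auto simp: Zn_def)
      ultimately show "apply_bcontfun z i = apply_bcontfun w i" by (auto elim!: Ints_cases)
    qed (use z Zn_subset in auto)
  qed
  ultimately show ?thesis using finite_imageD by blast
qed

text \<open>Subtracting integral parts of the coefficients with respect to a real basis contained in \<open>G\<close>
  leaves integer vectors in a bounded region.  Applied to elements of \<open>G\<close> this gives finite generation;
  applied to vectors with a multiple in \<open>G\<close> it bounds the torsion of the quotient by \<open>G\<close>.\<close>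

lemma add_subgroup_finite_representatives:
  assumes G: "add_subgroup G" "G \<subseteq> Zn n"
  obtains F B where "finite F" "finite B" "B \<subseteq> G"
    "\<forall>x \<in> Zn n \<inter> span G. \<exists>c :: vec \<Rightarrow> int. x - int_comb c B \<in> F"
proof -
  obtain B where B: "B \<subseteq> G" "independent B" "G \<subseteq> span B"
    using maximal_independent_subset by blast
  have fin: "finite B"
    using independent_span_bound[of "unit_vec ` {..<n}" B] B G Zn_subset Rn_span by fastforce
  define C where "C = (\<Sum>b\<in>B. norm b)"
  show ?thesis
  proof (rule that[OF finite_bounded_Zn[of n C] fin B(1)], rule ballI)
    fix x assume "x \<in> Zn n \<inter> span G"
    then have x: "x \<in> Zn n" "x \<in> span G" by auto
    then have "x \<in> span B" using B span_mono span_span by blast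
    then obtain t where t: "x = (\<Sum>b\<in>B. t b *\<^sub>R b)" using fin by (auto simp: span_finite)
    define f where "f = x - (\<Sum>b\<in>B. of_int \<lfloor>t b\<rfloor> *\<^sub>R b)"
    have "f \<in> Zn n" unfolding f_def using x B G
      by (intro Zn_closed(3) add_subgroup_comb[OF add_subgroup_Zn]) auto
    moreover have "\<bar>apply_bcontfun f i\<bar> \<le> C" for i
    proof -
      have "f = (\<Sum>b\<in>B. frac (t b) *\<^sub>R b)" 
        by (simp add: f_def t frac_def scaleR_diff_left sum_subtractf)
      then have "norm f \<le> (\<Sum>b\<in>B. norm (frac (t b) *\<^sub>R b))" by (simp only: norm_sum)
      also have "\<dots> \<le> C" unfolding C_def
        by (intro sum_mono) (simp add: mult_left_le_one_le frac_ge_0 less_imp_le[OF frac_lt_1])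
      finally show ?thesis using norm_bounded[of f i] by simp
    qed
    ultimately show "\<exists>c :: vec \<Rightarrow> int. x - int_comb c B \<in> {z \<in> Zn n. \<forall>i. \<bar>apply_bcontfun z i\<bar> \<le> C}"
      unfolding f_def by (intro exI[of _ "\<lambda>b. \<lfloor>t b\<rfloor>"]) simp
  qed
qed

lemma add_subgroup_finitely_generated:
  assumes G: "add_subgroup G" "G \<subseteq> Zn n"
  obtains H where "finite H" "H \<subseteq> G" "\<And>x. x \<in> G \<Longrightarrow> \<exists>c :: vec \<Rightarrow> int. x = int_comb c H"
proof -
  obtain F B where F: "finite F" "finite B" "B \<subseteq> G"
    "\<forall>x \<in> Zn n \<inter> span G. \<exists>c :: vec \<Rightarrow> int. x - int_comb c B \<in> F"
    using add_subgroup_finite_representatives[OF G] by blast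
  let ?H = "B \<union> (F \<inter> G)"
  have fin: "finite ?H" using F by simp
  show ?thesis
  proof (rule that[OF fin])
    fix x assume x: "x \<in> G"
    then obtain c :: "vec \<Rightarrow> int" where c: "x - int_comb c B \<in> F"
      using F(4) G span_base by blast
    define f where "f = x - int_comb c B"
    have "f \<in> G" unfolding f_def using F(3) G x by (intro add_subgroup_diff add_subgroup_comb) auto
    then have f: "f \<in> ?H" using c f_def by blast
    let ?c = "\<lambda>b. (if b \<in> B then c b else 0) + (if b = f then 1 else 0)"
    have "int_comb ?c ?H =
        (\<Sum>b\<in>?H. if b \<in> B then of_int (c b) *\<^sub>R b else 0) + (\<Sum>b\<in>?H. if b = f then b else 0)"
      by (subst sum.distrib[symmetric], rule sum.cong) (auto simp: scaleR_add_left)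
    also have "(\<Sum>b\<in>?H. if b = f then b else 0) = f" using f fin by (simp add: sum.delta')
    also have "(\<Sum>b\<in>?H. if b \<in> B then of_int (c b) *\<^sub>R b else 0) = int_comb c B"
      using sum.inter_restrict[OF fin, of "\<lambda>b. of_int (c b) *\<^sub>R b" B] by (simp add: Int_absorb1)
    finally have "x = int_comb ?c ?H" by (simp add: f_def)
    then show "\<exists>c :: vec \<Rightarrow> int. x = int_comb c ?H" by (intro exI[of _ ?c])
  qed (use F in auto)
qed

text \<open>Generators are an indexed family, since the replacement steps below might make two of them equal.\<close>

definition generates_mod :: "vec set \<Rightarrow> vec set \<Rightarrow> nat set \<Rightarrow> (nat \<Rightarrow> vec) \<Rightarrow> bool" where
  "generates_mod G K I g \<longleftrightarrow> finite I \<and> g ` I \<subseteq> G \<and>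
     (\<forall>x\<in>G. \<exists>c :: nat \<Rightarrow> int. x - (\<Sum>i\<in>I. of_int (c i) *\<^sub>R g i) \<in> K)"

text \<open>The Euclidean algorithm on the coefficients of a relation: as long as two of them are non-zero,
  replacing one generator by its sum or difference with another one lowers the sum of the absolute
  values.  A relation with one non-zero coefficient makes its generator superfluous, because \<open>K\<close> is
  pure.\<close>

lemma minimal_generators_no_relation:
  assumes G: "add_subgroup G" and K: "add_subgroup K"
    and pure: "\<And>x k. x \<in> G \<Longrightarrow> k \<noteq> 0 \<Longrightarrow> of_int k *\<^sub>R x \<in> K \<Longrightarrow> x \<in> K"
    and min: "\<And>J h. generates_mod G K J h \<Longrightarrow> card I \<le> card J"
    and g: "generates_mod G K I g"
    and c: "(\<Sum>i\<in>I. of_int (c i) *\<^sub>R g i) \<in> K" and i: "i \<in> I"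
  shows "c i = (0::int)"
proof (rule ccontr)
  assume "c i \<noteq> 0"
  with g c i show False
  proof (induction "\<Sum>i\<in>I. nat \<bar>c i\<bar>" arbitrary: g c i rule: less_induct)
    case less
    have fin: "finite I" and gG: "\<And>k. k \<in> I \<Longrightarrow> g k \<in> G" using less.prems(1) by (auto simp: generates_mod_def)
    show False
    proof (cases "\<exists>j\<in>I. j \<noteq> i \<and> c j \<noteq> 0")
      case False
      then have "(\<Sum>k\<in>I. of_int (c k) *\<^sub>R g k) = of_int (c i) *\<^sub>R g i"
        using fin less.prems(3) by (subst sum.remove[of I i]) (auto intro!: sum.neutral)
      then have "g i \<in> K" using pure[OF gG[OF less.prems(3)] less.prems(4)] less.prems(2) by simp
      have "generates_mod G K (I - {i}) g"
        unfolding generates_mod_def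
      proof (intro conjI ballI)
        fix x assume "x \<in> G"
        then obtain d :: "nat \<Rightarrow> int" where "x - (\<Sum>k\<in>I. of_int (d k) *\<^sub>R g k) \<in> K"
          using less.prems(1) unfolding generates_mod_def by blast
        from add_subgroup_add[OF K this add_subgroup_scale[OF K \<open>g i \<in> K\<close>, of "d i"]]
        have "x - (\<Sum>k\<in>I - {i}. of_int (d k) *\<^sub>R g k) \<in> K"
          using fin less.prems(3) by (simp add: sum.remove[of I i])
        then show "\<exists>c :: nat \<Rightarrow> int. x - (\<Sum>i\<in>I - {i}. of_int (c i) *\<^sub>R g i) \<in> K" by blast
      qed (use fin gG in auto)
      from min[OF this] have "card I \<le> card (I - {i})" .
      then show False using fin less.prems(3) by (metis card_Diff1_less leD)
    next
      case True
      then obtain j where j: "j \<in> I" "j \<noteq> i" "c j \<noteq> 0" by blast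
      obtain a b where ab: "a \<in> I" "b \<in> I" "a \<noteq> b" "c a \<noteq> 0" "c b \<noteq> 0" "\<bar>c b\<bar> \<le> \<bar>c a\<bar>"
        using j less.prems(3,4) by (metis linear)
      define s where "s = sgn (c a) * sgn (c b)"
      define g' where "g' = g(b := g b + of_int s *\<^sub>R g a)"
      define c' where "c' = c(a := c a - s * c b)"
      have split: "sum f I = f a + f b + sum f (I - {a, b})" for f :: "nat \<Rightarrow> 'z :: comm_monoid_add"
      proof -
        have "sum f I = f a + sum f (I - {a})" using fin ab by (simp add: sum.remove)
        also have "sum f (I - {a}) = f b + sum f (I - {a} - {b})" using fin ab by (intro sum.remove) auto
        also have "I - {a} - {b} = I - {a, b}" by blast
        finally show ?thesis by (simp add: add.assoc)
      qed
      have comb: "(\<Sum>k\<in>I. of_int (d k) *\<^sub>R g k) = (\<Sum>k\<in>I. of_int ((d(a := d a - s * d b)) k) *\<^sub>R g' k)" for d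
        unfolding split g'_def using ab(3) by (auto simp: algebra_simps intro!: sum.cong)
      have gen: "generates_mod G K I g'"
        unfolding generates_mod_def
      proof (intro conjI ballI)
        show "g' ` I \<subseteq> G" using gG ab G by (auto simp: g'_def add_subgroup_add add_subgroup_scale)
        fix x assume "x \<in> G"
        then obtain d :: "nat \<Rightarrow> int" where "x - (\<Sum>k\<in>I. of_int (d k) *\<^sub>R g k) \<in> K"
          using less.prems(1) unfolding generates_mod_def by blast
        then show "\<exists>c :: nat \<Rightarrow> int. x - (\<Sum>i\<in>I. of_int (c i) *\<^sub>R g' i) \<in> K"
          unfolding comb by blast
      qed (use fin in auto)
      have rel: "(\<Sum>k\<in>I. of_int (c' k) *\<^sub>R g' k) \<in> K" using less.prems(2) unfolding comb c'_def .
      have "\<bar>c a - s * c b\<bar> < \<bar>c a\<bar>"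
        using ab by (auto simp: s_def sgn_if abs_if split: if_splits)
      then have "(\<Sum>k\<in>I. nat \<bar>c' k\<bar>) < (\<Sum>k\<in>I. nat \<bar>c k\<bar>)"
        unfolding split c'_def using ab(3) by simp
      moreover have "c' b \<noteq> 0" using ab by (simp add: c'_def)
      ultimately show False using less.hyps[OF _ gen rel ab(2)] by blast
    qed
  qed
qed

text \<open>The residue classes of \<open>B\<close> form a \<open>\<int>\<close>-basis of \<open>G / K\<close>.\<close>

definition basis_mod :: "vec set \<Rightarrow> vec set \<Rightarrow> vec set \<Rightarrow> bool" where
  "basis_mod G K B \<longleftrightarrow> finite B \<and> B \<subseteq> G \<and>
     (\<forall>x\<in>G. \<exists>c :: vec \<Rightarrow> int. x - int_comb c B \<in> K) \<and>
     (\<forall>c :: vec \<Rightarrow> int. int_comb c B \<in> K \<longrightarrow> (\<forall>b\<in>B. c b = 0))"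

lemma basis_modD:
  assumes "basis_mod G K B"
  shows "finite B" "B \<subseteq> G"
    and "x \<in> G \<Longrightarrow> \<exists>c :: vec \<Rightarrow> int. x - int_comb c B \<in> K"
    and "int_comb c B \<in> K \<Longrightarrow> b \<in> B \<Longrightarrow> c b = (0 :: int)"
  using assms unfolding basis_mod_def by simp_all

lemma basis_mod_exists:
  assumes G: "add_subgroup G" "G \<subseteq> Zn n" and K: "add_subgroup K"
    and pure: "\<And>x k. x \<in> G \<Longrightarrow> k \<noteq> 0 \<Longrightarrow> of_int k *\<^sub>R x \<in> K \<Longrightarrow> x \<in> K"
  obtains B where "basis_mod G K B"
proof -
  obtain H where H: "finite H" "H \<subseteq> G" "\<And>x. x \<in> G \<Longrightarrow> \<exists>c :: vec \<Rightarrow> int. x = int_comb c H"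
    using add_subgroup_finitely_generated[OF G] by blast
  obtain h where h: "bij_betw h {0..<card H} H" using ex_bij_betw_nat_finite[OF H(1)] by blast
  have "generates_mod G K {0..<card H} h"
    unfolding generates_mod_def
  proof (intro conjI ballI)
    show "h ` {0..<card H} \<subseteq> G" using h H(2) by (simp add: bij_betw_def)
    fix x assume "x \<in> G"
    then obtain c :: "vec \<Rightarrow> int" where "x = int_comb c H" using H(3) by blast
    then have "x - (\<Sum>i\<in>{0..<card H}. of_int (c (h i)) *\<^sub>R h i) = 0"
      using sum.reindex_bij_betw[OF h, of "\<lambda>b. of_int (c b) *\<^sub>R b"] by simp
    then show "\<exists>c :: nat \<Rightarrow> int. x - (\<Sum>i\<in>{0..<card H}. of_int (c i) *\<^sub>R h i) \<in> K"
      using add_subgroup_0[OF K] by (intro exI[of _ "\<lambda>i. c (h i)"]) simp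
  qed auto
  then obtain I g where Ig: "generates_mod G K I g" and min: "\<And>J h. generates_mod G K J h \<Longrightarrow> card I \<le> card J"
    using ex_has_least_nat[of "\<lambda>(I, g). generates_mod G K I g" "({0..<card H}, h)" "\<lambda>(I, g). card I"]
    by (auto simp del: split_paired_Ex simp: case_prod_unfold)
  have indep: "c i = 0" if "(\<Sum>i\<in>I. of_int (c i) *\<^sub>R g i) \<in> K" "i \<in> I" for c :: "nat \<Rightarrow> int" and i
    by (rule minimal_generators_no_relation[OF G(1) K _ min Ig that]) (fact pure)
  have fin: "finite I" and gG: "g ` I \<subseteq> G" using Ig by (auto simp: generates_mod_def)
  have inj: "inj_on g I"
  proof (rule inj_onI, rule ccontr)
    fix i j assume ij: "i \<in> I" "j \<in> I" "g i = g j" "i \<noteq> j"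
    let ?c = "\<lambda>k. if k = i then 1 else if k = j then -1 else 0 :: int"
    have "(\<Sum>k\<in>I. of_int (?c k) *\<^sub>R g k) = (\<Sum>k\<in>I. (if k = i then g k else 0) - (if k = j then g k else 0))"
      using ij(4) by (intro sum.cong) auto
    also have "\<dots> = 0" using fin ij by (simp add: sum_subtractf sum.delta)
    finally show False using indep[of ?c i] ij add_subgroup_0[OF K] by simp
  qed
  have re: "int_comb c (g ` I) = (\<Sum>i\<in>I. of_int (c (g i)) *\<^sub>R g i)" for c
    by (simp add: sum.reindex[OF inj])
  have "basis_mod G K (g ` I)"
    unfolding basis_mod_def
  proof (intro conjI ballI allI impI)
    fix x assume "x \<in> G"
    then obtain c :: "nat \<Rightarrow> int" where c: "x - (\<Sum>i\<in>I. of_int (c i) *\<^sub>R g i) \<in> K"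
      using Ig unfolding generates_mod_def by blast
    have "(\<Sum>i\<in>I. of_int (c (inv_into I g (g i))) *\<^sub>R g i) = (\<Sum>i\<in>I. of_int (c i) *\<^sub>R g i)"
      by (intro sum.cong) (simp_all add: inv_into_f_f[OF inj])
    then show "\<exists>c :: vec \<Rightarrow> int. x - int_comb c (g ` I) \<in> K"
      using c by (intro exI[of _ "\<lambda>b. c (inv_into I g b)"]) (simp only: re)
  next
    fix c :: "vec \<Rightarrow> int" and b assume "int_comb c (g ` I) \<in> K" "b \<in> g ` I"
    then show "c b = 0" unfolding re using indep[of "\<lambda>i. c (g i)"] by blast
  qed (use fin gG in auto)
  then show ?thesis by (rule that)
qed


text \<open>Integral independence has to be improved to real independence.  The coordinates of \<open>N e\<^sub>j\<close> in the
  basis \<open>B\<close> define a real linear map \<open>f\<close> that sends the elements of \<open>B\<close> to distinct standard vectors.\<close>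

lemma basis_full_rank:
  assumes B: "basis_mod G {0} B" and G: "add_subgroup G" "G \<subseteq> Zn n"
    and N: "N > 0" "\<And>z. z \<in> Zn n \<Longrightarrow> real N *\<^sub>R z \<in> G"
  shows "independent B" "card B = n" "Rn n \<subseteq> span B"
proof -
  have fin: "finite B" and BG: "B \<subseteq> G" using B by (auto simp: basis_mod_def)
  have gen: "\<exists>c :: vec \<Rightarrow> int. x = int_comb c B" if "x \<in> G" for x
    using B that by (auto simp: basis_mod_def)
  have indep: "c b = 0" if "int_comb c B = 0" "b \<in> B" for c :: "vec \<Rightarrow> int" and b
    using B that by (auto simp: basis_mod_def)
  have "\<exists>c :: vec \<Rightarrow> int. real N *\<^sub>R unit_vec j = int_comb c B" if "j < n" for j
    using gen[OF N(2)[OF unit_vec_Zn[OF that]]] .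
  then obtain C :: "nat \<Rightarrow> vec \<Rightarrow> int"
    where C: "\<And>j. j < n \<Longrightarrow> real N *\<^sub>R unit_vec j = (\<Sum>b\<in>B. of_int (C j b) *\<^sub>R b)" by metis
  have spanB: "Rn n \<subseteq> span B"
    unfolding Rn_span
  proof (rule span_minimal)
    show "unit_vec ` {..<n} \<subseteq> span B"
    proof clarify
      fix j assume "j < n"
      then have "unit_vec j = (1 / real N) *\<^sub>R (\<Sum>b\<in>B. of_int (C j b) *\<^sub>R b)"
        using C[of j] N(1) by (simp flip: C)
      moreover have "\<dots> \<in> span B" by (intro span_scale span_sum span_base)
      ultimately show "unit_vec j \<in> span B" by simp
    qed
  qed simp
  then show "Rn n \<subseteq> span B" .
  obtain \<beta> where \<beta>: "bij_betw \<beta> B {0..<card B}" using ex_bij_betw_finite_nat[OF fin] by blast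
  define F where "F j = (1 / real N) *\<^sub>R (\<Sum>b\<in>B. of_int (C j b) *\<^sub>R unit_vec (\<beta> b))" for j
  obtain f where f: "linear f" "\<And>j. j < n \<Longrightarrow> f (unit_vec j) = F j"
  proof -
    from linear_independent_extend[OF independent_unit_vecs[of n], of "\<lambda>x. F (inv_into UNIV unit_vec x)"]
    obtain f where "linear f" "\<forall>x\<in>unit_vec ` {..<n}. f x = F (inv_into UNIV unit_vec x)" by blast
    then show thesis using that inv_f_f[OF inj_unit_vec] by (metis image_eqI lessThan_iff)
  qed
  have fb: "f b = unit_vec (\<beta> b)" if b: "b \<in> B" for b
  proof -
    have bZ: "b \<in> Zn n" using b BG G by blast
    define k where "k j = \<lfloor>apply_bcontfun b j\<rfloor>" for j
    have k: "apply_bcontfun b j = of_int (k j)" for j using bZ by (auto simp: Zn_def k_def elim!: Ints_cases)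
    have be: "(\<Sum>j<n. of_int (k j) *\<^sub>R unit_vec j) = b"
      using Rn_coordinates[of b n] bZ Zn_subset by (auto simp: k)
    define D where "D b' = (\<Sum>j<n. k j * C j b')" for b'
    have "real N *\<^sub>R b = (\<Sum>j<n. of_int (k j) *\<^sub>R (real N *\<^sub>R unit_vec j))"
      by (subst be[symmetric]) (simp add: scaleR_sum_right mult.commute)
    also have "\<dots> = (\<Sum>j<n. \<Sum>b'\<in>B. of_int (k j * C j b') *\<^sub>R b')"
      by (intro sum.cong) (simp_all add: C scaleR_sum_right)
    also have "\<dots> = int_comb D B"
      by (subst sum.swap) (simp add: D_def scaleR_sum_left)
    finally have NB: "real N *\<^sub>R b = int_comb D B" .
    let ?c = "\<lambda>b'. D b' - (if b' = b then int N else 0)"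
    have "int_comb ?c B = (\<Sum>b'\<in>B. of_int (D b') *\<^sub>R b' - (if b' = b then real N *\<^sub>R b' else 0))"
      by (intro sum.cong) (auto simp: scaleR_diff_left)
    also have "\<dots> = 0" using fin b by (simp add: sum_subtractf NB[symmetric] sum.delta')
    finally have D: "D b' = (if b' = b then int N else 0)" if "b' \<in> B" for b' using indep[of ?c b'] that by simp
    have "f b = (\<Sum>j<n. of_int (k j) *\<^sub>R f (unit_vec j))"
      by (subst be[symmetric]) (simp add: linear_sum[OF f(1)] linear_scale[OF f(1)])
    also have "\<dots> = (\<Sum>j<n. \<Sum>b'\<in>B. (1 / real N) *\<^sub>R (of_int (k j * C j b') *\<^sub>R unit_vec (\<beta> b')))"
      by (intro sum.cong) (simp_all add: f(2) F_def scaleR_sum_right)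
    also have "\<dots> = (\<Sum>b'\<in>B. (1 / real N) *\<^sub>R (of_int (D b') *\<^sub>R unit_vec (\<beta> b')))"
      by (subst sum.swap) (simp add: D_def scaleR_sum_left scaleR_sum_right sum_divide_distrib)
    also have "\<dots> = (\<Sum>b'\<in>B. if b' = b then unit_vec (\<beta> b') else 0)"
      using N(1) by (intro sum.cong) (auto simp: D)
    also have "\<dots> = unit_vec (\<beta> b)" using fin b by (simp add: sum.delta')
    finally show ?thesis .
  qed
  show ind: "independent B"
  proof (rule independent_if_scalars_zero[OF fin])
    fix r b assume s: "(\<Sum>x\<in>B. r x *\<^sub>R x) = 0" and b: "b \<in> B"
    have "(\<Sum>x\<in>B. r x *\<^sub>R unit_vec (\<beta> x)) = f (\<Sum>x\<in>B. r x *\<^sub>R x)"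
      by (simp add: linear_sum[OF f(1)] linear_scale[OF f(1)] fb)
    also have "\<dots> = 0" using s linear_0[OF f(1)] by simp
    finally have "apply_bcontfun (\<Sum>x\<in>B. r x *\<^sub>R unit_vec (\<beta> x)) (\<beta> b) = 0" by (simp add: zero_bcontfun.rep_eq)
    then have "(\<Sum>x\<in>B. r x * (if \<beta> b = \<beta> x then 1 else 0)) = 0" by (simp add: vec_simps)
    moreover have "(\<Sum>x\<in>B. r x * (if \<beta> b = \<beta> x then 1 else 0)) = (\<Sum>x\<in>B. if x = b then r x else 0)"
      using \<beta> b by (intro sum.cong) (auto simp: bij_betw_def inj_on_def)
    ultimately show "r b = 0" using fin b by (simp add: sum.delta')
  qed
  have "card B \<le> n"
  proof -
    have "B \<subseteq> span (unit_vec ` {..<n})" using BG G(2) Zn_subset Rn_span by blast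
    from independent_span_bound[OF _ ind this] show ?thesis by (simp add: card_image[OF inj_unit_vec])
  qed
  moreover have "n \<le> card B"
  proof -
    have "unit_vec ` {..<n} \<subseteq> span B"
      using subset_trans[OF Zn_subset spanB] unit_vec_Zn by auto
    from independent_span_bound[OF fin independent_unit_vecs this] show ?thesis by (simp add: card_image[OF inj_unit_vec])
  qed
  ultimately show "card B = n" by simp
qed

lemma basis_mod_Un:
  assumes B: "basis_mod G K B" and C: "basis_mod K {0} C" and G: "add_subgroup G" and K: "add_subgroup K" "K \<subseteq> G"
  shows "basis_mod G {0} (B \<union> C)" "B \<inter> C = {}"
proof -
  have fin: "finite B" "finite C" and BG: "B \<subseteq> G" and CK: "C \<subseteq> K" using B C by (auto simp: basis_mod_def)
  show disj: "B \<inter> C = {}"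
  proof (rule ccontr)
    assume "B \<inter> C \<noteq> {}"
    then obtain b where b: "b \<in> B" "b \<in> C" by blast
    let ?c = "\<lambda>x. if x = b then 1 else 0 :: int"
    have "int_comb ?c B = (\<Sum>x\<in>B. if x = b then x else 0)" by (intro sum.cong) auto
    also have "\<dots> = b" using fin b by (simp add: sum.delta')
    finally have "int_comb ?c B \<in> K" using b CK by auto
    from basis_modD(4)[OF B this b(1)] have "?c b = 0" .
    then show False by simp
  qed
  note un = sum.union_disjoint[OF fin disj]
  show "basis_mod G {0} (B \<union> C)"
    unfolding basis_mod_def
  proof (intro conjI ballI allI impI)
    fix x assume "x \<in> G"
    then obtain c :: "vec \<Rightarrow> int" where c: "x - int_comb c B \<in> K"
      using basis_modD(3)[OF B] by blast
    then obtain d :: "vec \<Rightarrow> int" where d: "x - int_comb c B = int_comb d C"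
      using basis_modD(3)[OF C] by fastforce
    let ?e = "\<lambda>b. if b \<in> B then c b else d b"
    have "int_comb ?e (B \<union> C) = int_comb c B + int_comb d C"
      unfolding un using disj by (intro arg_cong2[of _ _ _ _ "(+)"] sum.cong) auto
    then show "\<exists>c :: vec \<Rightarrow> int. x - int_comb c (B \<union> C) \<in> {0}"
      using d by (intro exI[of _ ?e]) (simp add: algebra_simps)
  next
    fix c :: "vec \<Rightarrow> int" and b assume c: "int_comb c (B \<union> C) \<in> {0}" and b: "b \<in> B \<union> C"
    then have s: "int_comb c B + int_comb c C = 0"
      using un[of "\<lambda>b. of_int (c b) *\<^sub>R b"] by simp
    have "int_comb c C \<in> K" using CK K by (intro add_subgroup_comb) auto
    moreover have "int_comb c B = - int_comb c C" using s by (simp add: eq_neg_iff_add_eq_0)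
    ultimately have "int_comb c B \<in> K" using add_subgroup_minus[OF K(1)] by simp
    then have cB: "\<forall>b\<in>B. c b = 0" using basis_modD(4)[OF B] by blast
    then have "int_comb c C = 0" using s by simp
    then have "\<forall>b\<in>C. c b = 0" using basis_modD(4)[OF C] by simp
    then show "c b = 0" using cB b by blast
  qed (use fin BG CK K in auto)
qed

text \<open>The relation \<open>R\<close> induces an isomorphism between \<open>G / K\<close> and \<open>H / L\<close>.  A basis of \<open>G\<close> modulo \<open>K\<close>
  corresponds under \<open>R\<close> to a basis of \<open>H\<close> modulo \<open>L\<close>.  Completing both by bases of \<open>K\<close> and \<open>L\<close> gives
  bases of \<open>\<real>\<^sup>n\<close>, so \<open>K\<close> and \<open>L\<close> have the same rank, and matching these bases defines the linear maps.
  The choice on \<open>K\<close> does not matter because \<open>R\<close> contains all pairs from \<open>K\<close> and \<open>L\<close>.\<close>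

lemma linear_isomorphism_of_relation:
  fixes R :: "vec \<Rightarrow> vec \<Rightarrow> bool"
  assumes G: "add_subgroup G" "G \<subseteq> Zn n" and K: "add_subgroup K" "K \<subseteq> G"
    and H: "add_subgroup H" "H \<subseteq> Zn n" and L: "add_subgroup L" "L \<subseteq> H"
    and NG: "NG > 0" "\<And>z. z \<in> Zn n \<Longrightarrow> real NG *\<^sub>R z \<in> G"
    and NH: "NH > 0" "\<And>z. z \<in> Zn n \<Longrightarrow> real NH *\<^sub>R z \<in> H"
    and pure: "\<And>x k. x \<in> G \<Longrightarrow> k \<noteq> 0 \<Longrightarrow> of_int k *\<^sub>R x \<in> K \<Longrightarrow> x \<in> K"
    and R: "\<And>g h. R g h \<Longrightarrow> g \<in> G \<and> h \<in> H" "\<And>g. g \<in> G \<Longrightarrow> \<exists>h. R g h" "\<And>h. h \<in> H \<Longrightarrow> \<exists>g. R g h"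
      "\<And>g h g' h'. R g h \<Longrightarrow> R g' h' \<Longrightarrow> R (g - g') (h - h')"
      "\<And>g h. R g h \<Longrightarrow> g \<in> K \<longleftrightarrow> h \<in> L" "\<And>g h. g \<in> K \<Longrightarrow> h \<in> L \<Longrightarrow> R g h"
  obtains A A' where "linear A" "linear A'" "\<And>x. x \<in> Rn n \<Longrightarrow> A x \<in> Rn n \<and> A' (A x) = x"
    "\<And>x. x \<in> Rn n \<Longrightarrow> A' x \<in> Rn n \<and> A (A' x) = x"
    "\<And>g. g \<in> G \<Longrightarrow> R g (A g)" "\<And>h. h \<in> H \<Longrightarrow> R (A' h) h"
proof -
  have R0: "R 0 0" using R(6) add_subgroup_0 K L by blast
  have Radd: "R (g + g') (h + h')" if "R g h" "R g' h'" for g g' h h'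
    using R(4)[OF that(1) R(4)[OF R0 that(2)]] by simp
  have Rneg: "R (- g) (- h)" if "R g h" for g h using R(4)[OF R0 that] by simp
  have Rnat: "R (of_nat k *\<^sub>R g) (of_nat k *\<^sub>R h)" if "R g h" for k g h
    by (induction k) (use R0 Radd that in \<open>auto simp: scaleR_add_left\<close>)
  have Rscale: "R (of_int k *\<^sub>R g) (of_int k *\<^sub>R h)" if "R g h" for k g h
  proof (cases "k \<ge> 0")
    case True
    then show ?thesis using Rnat[OF that, of "nat k"] by simp
  next
    case False
    then show ?thesis using Rneg[OF Rnat[OF that, of "nat (- k)"]] by simp
  qed
  have Rsum: "R (sum f I) (sum f' I)" if "\<And>i. i \<in> I \<Longrightarrow> R (f i) (f' i)" for I f f'
    using that by (induction I rule: infinite_finite_induct) (auto simp: R0 Radd)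
  obtain B where B: "basis_mod G K B"
    by (rule basis_mod_exists[OF G K(1)]) (use pure in blast)+
  have finB: "finite B" and BG: "B \<subseteq> G" using B by (auto simp: basis_mod_def)
  obtain d where d: "\<And>b. b \<in> B \<Longrightarrow> R b (d b)" using R(2) BG by (metis subsetD)
  have Rcomb: "R (int_comb c B) (\<Sum>b\<in>B. of_int (c b) *\<^sub>R d b)" for c
    by (intro Rsum Rscale d)
  have dinj: "inj_on d B"
  proof (rule inj_onI, rule ccontr)
    fix a b assume ab: "a \<in> B" "b \<in> B" "d a = d b" "a \<noteq> b"
    let ?c = "\<lambda>k. if k = a then 1 else if k = b then -1 else 0 :: int"
    have "(\<Sum>k\<in>B. of_int (?c k) *\<^sub>R d k) = (\<Sum>k\<in>B. (if k = a then d k else 0) - (if k = b then d k else 0))"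
      using ab(4) by (intro sum.cong) auto
    also have "\<dots> = 0" using finB ab by (simp add: sum_subtractf sum.delta)
    finally have "int_comb ?c B \<in> K" using Rcomb[of ?c] R(5) add_subgroup_0[OF L(1)] by simp
    from basis_modD(4)[OF B this ab(1)] have "?c a = 0" .
    then show False by simp
  qed
  have re: "int_comb c (d ` B) = (\<Sum>b\<in>B. of_int (c (d b)) *\<^sub>R d b)" for c
    by (simp add: sum.reindex[OF dinj])
  have D: "basis_mod H L (d ` B)"
    unfolding basis_mod_def
  proof (intro conjI ballI allI impI)
    fix h assume "h \<in> H"
    then obtain g where g: "R g h" using R(3) by blast
    then have "g \<in> G" using R(1) by blast
    then obtain c :: "vec \<Rightarrow> int" where c: "g - int_comb c B \<in> K"
      using basis_modD(3)[OF B] by blast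
    have "h - (\<Sum>b\<in>B. of_int (c b) *\<^sub>R d b) \<in> L" using R(5)[OF R(4)[OF g Rcomb]] c by blast
    moreover have "(\<Sum>b\<in>B. of_int (c (inv_into B d (d b))) *\<^sub>R d b) = (\<Sum>b\<in>B. of_int (c b) *\<^sub>R d b)"
      by (intro sum.cong) (simp_all add: inv_into_f_f[OF dinj])
    ultimately show "\<exists>c :: vec \<Rightarrow> int. h - int_comb c (d ` B) \<in> L"
      by (intro exI[of _ "\<lambda>b. c (inv_into B d b)"]) (simp only: re)
  next
    fix c :: "vec \<Rightarrow> int" and b assume c: "int_comb c (d ` B) \<in> L" and b: "b \<in> d ` B"
    have "(\<Sum>b\<in>B. of_int (c (d b)) *\<^sub>R b) \<in> K" using R(5)[OF Rcomb[of "\<lambda>b. c (d b)"]] c unfolding re by blast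
    then have "\<forall>b\<in>B. c (d b) = 0" using basis_modD(4)[OF B, of "\<lambda>b. c (d b)"] by blast
    then show "c b = 0" using b by blast
  qed (use finB d R(1) in auto)
  have torsion_free: "x \<in> {0}" if "k \<noteq> 0" "of_int k *\<^sub>R x \<in> {0 :: vec}" for x and k :: int
    using that by simp
  have l0: "add_subgroup {0}" by (simp add: add_subgroup_def)
  obtain C where C: "basis_mod K {0} C"
    by (rule basis_mod_exists[OF K(1) _ l0, of n]) (use K G torsion_free in auto)
  obtain C' where C': "basis_mod L {0} C'"
    by (rule basis_mod_exists[OF L(1) _ l0, of n]) (use L H torsion_free in auto)
  have finC: "finite C" "finite C'" and CK: "C \<subseteq> K" and C'L: "C' \<subseteq> L" using C C' by (auto simp: basis_mod_def)
  note 1 = basis_mod_Un[OF B C G(1) K] and 2 = basis_mod_Un[OF D C' H(1) L]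
  note f1 = basis_full_rank[OF 1(1) G NG] and f2 = basis_full_rank[OF 2(1) H NH]
  have "card B + card C = card (d ` B) + card C'"
    using f1(2) f2(2) card_Un_disjoint[OF finB finC(1) 1(2)] card_Un_disjoint[OF _ finC(2) 2(2)] finB by simp
  then have "card C = card C'" by (simp add: card_image[OF dinj])
  then obtain \<beta> where \<beta>: "bij_betw \<beta> C C'" using finite_same_card_bij finC by blast
  define \<phi> where "\<phi> b = (if b \<in> B then d b else \<beta> b)" for b
  have \<phi>: "bij_betw \<phi> (B \<union> C) (d ` B \<union> C')"
  proof (rule bij_betw_combine)
    show "bij_betw \<phi> B (d ` B)" using dinj by (simp add: \<phi>_def bij_betw_def inj_on_def)
    show "bij_betw \<phi> C C'" using \<beta> 1(2) by (subst bij_betw_cong[of C \<phi> \<beta>]) (auto simp: \<phi>_def)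
  qed (rule 2(2))
  obtain A where A: "linear A" "\<forall>b\<in>B \<union> C. A b = \<phi> b" using linear_independent_extend[OF f1(1)] by blast
  obtain A' where A': "linear A'" "\<forall>b\<in>d ` B \<union> C'. A' b = inv_into (B \<union> C) \<phi> b"
    using linear_independent_extend[OF f2(1)] by blast
  have R\<phi>: "R b (\<phi> b)" if "b \<in> B \<union> C" for b
  proof (cases "b \<in> B")
    case False
    then have "b \<in> C" "\<beta> b \<in> C'" using that \<beta> bij_betw_apply by auto
    then show ?thesis using False R(6) CK C'L by (auto simp: \<phi>_def)
  qed (simp add: \<phi>_def d)
  have A'A: "A' (A b) = b" if "b \<in> B \<union> C" for b
    using A A' that \<phi> by (metis bij_betw_apply bij_betw_inv_into_left)
  have AA': "A (A' b) = b" if "b \<in> d ` B \<union> C'" for b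
    using A A' that \<phi> by (metis bij_betw_inv_into bij_betw_apply bij_betw_inv_into_right)
  have sub: "B \<union> C \<subseteq> Rn n" "d ` B \<union> C' \<subseteq> Rn n"
    using basis_modD(2)[OF 1(1)] basis_modD(2)[OF 2(1)] G H Zn_subset by blast+
  have s1: "Rn n = span (B \<union> C)" and s2: "Rn n = span (d ` B \<union> C')"
    using f1(3) f2(3) span_minimal[OF sub(1) subspace_Rn] span_minimal[OF sub(2) subspace_Rn] by auto
  have AR: "A x \<in> Rn n \<and> A' (A x) = x" if "x \<in> Rn n" for x
  proof
    have "A ` span (B \<union> C) = span (A ` (B \<union> C))" using linear_span_image[OF A(1)] by simp
    also have "A ` (B \<union> C) \<subseteq> d ` B \<union> C'" using A(2) \<phi> by (auto simp: bij_betw_def)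
    then have "span (A ` (B \<union> C)) \<subseteq> Rn n" unfolding s2 by (rule span_mono)
    finally show "A x \<in> Rn n" using that s1 by blast
    show "A' (A x) = x"
      using linear_eq_on_span[OF linear_compose[OF A(1) A'(1)] linear_id, of "B \<union> C" x] A'A that s1 by simp
  qed
  have AR': "A' x \<in> Rn n \<and> A (A' x) = x" if "x \<in> Rn n" for x
  proof
    have "A' ` span (d ` B \<union> C') = span (A' ` (d ` B \<union> C'))" using linear_span_image[OF A'(1)] by simp
    also have "A' ` (d ` B \<union> C') \<subseteq> B \<union> C" using A'(2) bij_betw_inv_into[OF \<phi>] by (auto simp: bij_betw_def)
    then have "span (A' ` (d ` B \<union> C')) \<subseteq> Rn n" unfolding s1 by (rule span_mono)
    finally show "A' x \<in> Rn n" using that s2 by blast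
    show "A (A' x) = x"
      using linear_eq_on_span[OF linear_compose[OF A'(1) A(1)] linear_id, of "d ` B \<union> C'" x] AA' that s2 by simp
  qed
  have RA: "R g (A g)" if g: "g \<in> G" for g
  proof -
    obtain c :: "vec \<Rightarrow> int" where c: "g = int_comb c (B \<union> C)"
      using basis_modD(3)[OF 1(1) g] by auto
    have "A g = (\<Sum>b\<in>B \<union> C. of_int (c b) *\<^sub>R \<phi> b)"
      unfolding c using A by (simp add: linear_sum[OF A(1)] linear_scale[OF A(1)])
    then show ?thesis using R\<phi> by (subst c) (auto intro!: Rsum Rscale)
  qed
  have RA': "R (A' h) h" if h: "h \<in> H" for h
  proof -
    obtain c :: "vec \<Rightarrow> int" where c: "h = int_comb c (d ` B \<union> C')"
      using basis_modD(3)[OF 2(1) h] by auto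
    have "A' h = (\<Sum>b\<in>d ` B \<union> C'. of_int (c b) *\<^sub>R inv_into (B \<union> C) \<phi> b)"
      unfolding c using A' by (simp add: linear_sum[OF A'(1)] linear_scale[OF A'(1)])
    moreover have "R (inv_into (B \<union> C) \<phi> b) b" if "b \<in> d ` B \<union> C'" for b
      using R\<phi>[of "inv_into (B \<union> C) \<phi> b"] that \<phi> bij_betw_inv_into_right[OF \<phi> that]
      by (metis bij_betw_apply bij_betw_inv_into)
    ultimately show ?thesis by (subst (2) c) (auto intro!: Rsum Rscale)
  qed
  show ?thesis by (rule that[OF A(1) A'(1) AR AR' RA RA'])
qed

section \<open>From return equivalence to homeomorphism\<close>

lemma continuous_linear_Rn:
  assumes "linear L" and "\<And>x. x \<in> Rn n \<Longrightarrow> L x \<in> Rn n"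
  shows "continuous_map (RnT n) (RnT n) L"
proof -
  have "continuous_on (Rn n) (\<lambda>x. \<Sum>i<n. apply_bcontfun x i *\<^sub>R L (unit_vec i))"
    by (intro continuous_intros linear_continuous_on bounded_linear_coordinate)
  moreover have "(\<Sum>i<n. apply_bcontfun x i *\<^sub>R L (unit_vec i)) = L x" if "x \<in> Rn n" for x
  proof -
    have "L x = L (\<Sum>i<n. apply_bcontfun x i *\<^sub>R unit_vec i)" by (simp add: Rn_coordinates[OF that])
    then show ?thesis by (simp add: linear_sum[OF assms(1)] linear_scale[OF assms(1)])
  qed
  ultimately have "continuous_on (Rn n) L" by (rule continuous_on_eq)
  then show ?thesis using assms(2) by (simp add: Pi_iff)
qed

context torus_tower
begin

lemma add_subgroup_period: "add_subgroup (period l)"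
  by (simp add: add_subgroup_def period_closed)

lemma flow_from_open:
  assumes V: "openin X V" "V \<noteq> {}" and s: "s \<in> topspace S"
  obtains t v where "t \<in> Rn n" "v \<in> V" "s = flow t v"
proof -
  obtain y where y: "y \<in> V" using V by blast
  then have yX: "y \<in> topspace X" using V openin_subset by blast
  obtain m where m: "cylinder m y \<subseteq> V" using cylinder_in_open[OF V(1) y] .
  obtain t where t: "t \<in> Rn n" "flow t s \<in> cylinder m y" using flow_into_cylinder[OF s yX] .
  have "s = flow (- t) (flow t s)" using flow_add[OF s, of "- t" t] t s by simp
  then show ?thesis using that[of "- t" "flow t s"] t m by auto
qed

text \<open>The integer vectors with a multiple in the intersection of all periods have finitely many
  representatives modulo this intersection, and a representative outside it leaves the periods at some
  level.\<close>

lemma torsion_free_level: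
  obtains l where "\<And>m x k. l \<le> m \<Longrightarrow> x \<in> period m \<Longrightarrow> k \<noteq> (0 :: int) \<Longrightarrow>
    of_int k *\<^sub>R x \<in> (\<Inter>j. period j) \<Longrightarrow> x \<in> (\<Inter>j. period j)"
proof -
  let ?K = "\<Inter>j. period j"
  have K: "add_subgroup ?K" "?K \<subseteq> Zn n"
    using add_subgroup_period period_Zn[of 0] by (auto simp: add_subgroup_def)
  obtain F B where F: "finite F" "finite B" "B \<subseteq> ?K"
    "\<forall>x \<in> Zn n \<inter> span ?K. \<exists>c :: vec \<Rightarrow> int. x - int_comb c B \<in> F"
    by (rule add_subgroup_finite_representatives[OF K])
  have "\<exists>j. f \<in> ?K \<or> f \<notin> period j" for f by blast
  then obtain j where j: "\<And>f. f \<in> ?K \<or> f \<notin> period (j f)" by metis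
  obtain l where l: "\<And>f. f \<in> F \<Longrightarrow> j f \<le> l"
    using F(1) by (metis finite_imageI finite_nat_set_iff_bounded_le image_eqI)
  show ?thesis
  proof (rule that[of l])
    fix m x and k :: int assume m: "l \<le> m" and x: "x \<in> period m" and k: "k \<noteq> 0" "of_int k *\<^sub>R x \<in> ?K"
    have "(1 / of_int k) *\<^sub>R (of_int k *\<^sub>R x) \<in> span ?K" using k(2) by (intro span_scale span_base)
    then have "x \<in> span ?K" using k(1) by simp
    moreover have "x \<in> Zn n" using x period_Zn by blast
    ultimately obtain c :: "vec \<Rightarrow> int" where c: "x - int_comb c B \<in> F" (is "?f \<in> F")
      using F(4) by blast
    have s: "int_comb c B \<in> ?K" using F(3) by (intro add_subgroup_comb[OF K(1)]) auto
    then have "?f \<in> period m" using x by (intro add_subgroup_diff[OF add_subgroup_period]) auto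
    then have "?f \<in> period (j ?f)" using period_antimono[OF order_trans[OF l[OF c] m]] by blast
    then have "?f \<in> ?K" using j by blast
    from add_subgroup_add[OF K(1) this s] show "x \<in> ?K" by simp
  qed
qed

lemma continuous_flow_X: "z \<in> Zn n \<Longrightarrow> continuous_map X X (flow z)"
proof -
  assume z: "z \<in> Zn n"
  then have zR: "z \<in> Rn n" using Zn_subset by blast
  have "continuous_map X S (flow z)"
    by (rule continuous_flow_compose) (use zR in \<open>auto simp: base_fibre_def continuous_map_from_subtopology continuous_map_id[unfolded id_def]\<close>)
  then show ?thesis using flow_in_X_iff z zR by (auto simp: continuous_into_X topspace_X)
qed

text \<open>The fibre is totally disconnected, because cylinders are open and closed.\<close>

lemma connected_into_X_constant:
  assumes Y: "connected_space Y" and f: "continuous_map Y X f" and y: "y \<in> topspace Y" "y' \<in> topspace Y"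
  shows "f y = f y'"
proof
  fix l
  have fX: "f y \<in> topspace X" if "y \<in> topspace Y" for y using f that by (auto simp: continuous_map_def)
  have op: "openin Y {z \<in> topspace Y. f z \<in> C}" if "openin X C" for C
    using f that by (rule openin_continuous_map_preimage)
  let ?A = "{z \<in> topspace Y. f z \<in> cylinder l (f y)}"
  have "openin X (topspace X - cylinder l (f y))"
  proof (subst openin_subopen, intro ballI)
    fix x assume x: "x \<in> topspace X - cylinder l (f y)"
    then show "\<exists>T. openin X T \<and> x \<in> T \<and> T \<subseteq> topspace X - cylinder l (f y)"
      using openin_cylinder[of x l] by (intro exI[of _ "cylinder l x"]) (auto simp: cylinder_def)
  qed
  then have "openin Y {z \<in> topspace Y. f z \<in> topspace X - cylinder l (f y)}" by (rule op)
  moreover have "{z \<in> topspace Y. f z \<in> topspace X - cylinder l (f y)} = topspace Y - ?A" using fX by auto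
  ultimately have "closedin Y ?A" by (auto simp: closedin_def)
  moreover have "openin Y ?A" using openin_cylinder[OF fX[OF y(1)]] by (rule op)
  moreover have "y \<in> ?A" using y fX by (auto simp: cylinder_def)
  ultimately have "?A = topspace Y" using Y unfolding connected_space_clopen_in by blast
  then have "y' \<in> ?A" using y(2) by blast
  then show "f y l = f y' l" by (simp add: cylinder_def)
qed

end

locale two_towers = A: torus_tower n M1 p1 x1 u1 + B: torus_tower n M2 p2 x2 u2
  for n :: nat and M1 :: "nat \<Rightarrow> 'a topology" and p1 x1 u1
    and M2 :: "nat \<Rightarrow> 'b topology" and p2 x2 u2
begin

text \<open>Two representations of a point as \<open>t \<cdot> v\<close> with \<open>v\<close> in \<open>V\<close> differ by an integer vector that moves
  one point of \<open>V\<close> to another, so the equivariance of \<open>h\<close> is exactly what makes \<open>t \<cdot> v \<mapsto> L t \<cdot> h v\<close>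
  well defined.  Continuity follows from the local product structure.\<close>

lemma equivariant_extension:
  assumes V: "openin A.X V" "V \<noteq> {}" and h: "continuous_map (subtopology A.X V) B.X h"
    and L: "linear L" "\<And>x. x \<in> Rn n \<Longrightarrow> L x \<in> Rn n"
    and eqv: "\<And>v z. v \<in> V \<Longrightarrow> z \<in> Zn n \<Longrightarrow> A.flow z v \<in> V \<Longrightarrow> h (A.flow z v) = B.flow (L z) (h v)"
  obtains \<Phi> where "continuous_map A.S B.S \<Phi>"
    "\<And>t v. t \<in> Rn n \<Longrightarrow> v \<in> V \<Longrightarrow> \<Phi> (A.flow t v) = B.flow (L t) (h v)"
proof -
  have VX: "V \<subseteq> topspace A.X" using V openin_subset by blast
  have hX: "h v \<in> topspace B.X" if "v \<in> V" for v using h that VX by (auto simp: continuous_map_def)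
  have wd: "B.flow (L t) (h v) = B.flow (L t') (h v')"
    if t: "t \<in> Rn n" "t' \<in> Rn n" and v: "v \<in> V" "v' \<in> V" and eq: "A.flow t v = A.flow t' v'" for t t' v v'
  proof -
    have vS: "v \<in> topspace A.S" "v' \<in> topspace A.S" using v VX A.X_subset_S by blast+
    have "v' = A.flow (- t') (A.flow t v)" unfolding eq using A.flow_add[OF vS(2), of "- t'" t'] t vS by simp
    then have v': "v' = A.flow (t - t') v" using A.flow_add[OF vS(1), of "- t'" t] t by simp
    then have "t - t' \<in> Zn n" using A.flow_in_X_iff[of v "t - t'"] v VX t by auto
    then have "h v' = B.flow (L (t - t')) (h v)" using eqv v v' by simp
    then have "B.flow (L t') (h v') = B.flow (L (t - t') + L t') (h v)"
      using B.flow_add[OF B.X_subset_S[OF hX[OF v(1)]]] L(2) t by simp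
    then show ?thesis by (simp add: linear_diff[OF L(1)])
  qed
  define \<Phi> where "\<Phi> s = (SOME w. \<exists>t\<in>Rn n. \<exists>v\<in>V. s = A.flow t v \<and> w = B.flow (L t) (h v))" for s
  have \<Phi>: "\<Phi> (A.flow t v) = B.flow (L t) (h v)" if tv: "t \<in> Rn n" "v \<in> V" for t v
  proof -
    have "\<exists>w. \<exists>t'\<in>Rn n. \<exists>v'\<in>V. A.flow t v = A.flow t' v' \<and> w = B.flow (L t') (h v')"
      using tv by blast
    from someI_ex[OF this, folded \<Phi>_def]
    have "\<exists>t'\<in>Rn n. \<exists>v'\<in>V. A.flow t v = A.flow t' v' \<and> \<Phi> (A.flow t v) = B.flow (L t') (h v')" .
    then show ?thesis using wd tv by metis
  qed
  have "continuous_map A.S B.S \<Phi>"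
  proof (rule continuous_map_locally)
    fix s assume s: "s \<in> topspace A.S"
    obtain t v where tv: "t \<in> Rn n" "v \<in> V" "s = A.flow t v" using A.flow_from_open[OF V s] .
    obtain N \<tau> where N: "openin A.S N" "A.flow t v \<in> N" "continuous_map (subtopology A.S N) (RnT n) \<tau>"
      "\<tau> (A.flow t v) = t" "\<forall>s\<in>N. A.flow (- \<tau> s) s \<in> V"
      "continuous_map (subtopology A.S N) A.X (\<lambda>s. A.flow (- \<tau> s) s)"
      by (rule A.flow_box[OF V(1) tv(2,1)])
    have NS: "N \<subseteq> topspace A.S" using N(1) openin_subset by blast
    have \<tau>R: "\<tau> s \<in> Rn n" if "s \<in> N" for s using N(3) that NS by (auto simp: continuous_map_def)
    have "continuous_map (subtopology A.S N) (subtopology A.X V) (\<lambda>s. A.flow (- \<tau> s) s)"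
      using N(5,6) by (auto simp: continuous_map_in_subtopology)
    from continuous_map_compose[OF this h]
    have "continuous_map (subtopology A.S N) B.S (\<lambda>s. h (A.flow (- \<tau> s) s))"
      by (simp add: o_def B.continuous_into_X)
    moreover have "continuous_map (subtopology A.S N) (RnT n) (\<lambda>s. L (\<tau> s))"
      using continuous_map_compose[OF N(3) continuous_linear_Rn[OF L]] by (simp add: o_def)
    ultimately have "continuous_map (subtopology A.S N) B.S (\<lambda>s. B.flow (L (\<tau> s)) (h (A.flow (- \<tau> s) s)))"
      by (intro B.continuous_flow_compose)
    then have "continuous_map (subtopology A.S N) B.S \<Phi>"
    proof (rule continuous_map_eq)
      fix s assume "s \<in> topspace (subtopology A.S N)"
      then have s: "s \<in> N" "s \<in> topspace A.S" by auto
      then have "s = A.flow (\<tau> s) (A.flow (- \<tau> s) s)"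
        using A.flow_add[OF s(2), of "\<tau> s" "- \<tau> s"] \<tau>R by simp
      then show "B.flow (L (\<tau> s)) (h (A.flow (- \<tau> s) s)) = \<Phi> s"
        using \<Phi>[of "\<tau> s" "A.flow (- \<tau> s) s"] \<tau>R N(5) s by metis
    qed
    then show "\<exists>N. openin A.S N \<and> s \<in> N \<and> continuous_map (subtopology A.S N) B.S \<Phi>"
      using N(1,2) tv by blast
  qed
  then show ?thesis using that \<Phi> by blast
qed

end

lemma two_towers_swap: "two_towers n M1 p1 x1 u1 M2 p2 x2 u2 \<Longrightarrow> two_towers n M2 p2 x2 u2 M1 p1 x1 u1"
  by (simp add: two_towers_def)

context two_towers
begin

text \<open>The level \<open>l\<close> is chosen such that the cylinder \<open>V'\<close> around a point of \<open>V\<close> lies in \<open>V\<close> and the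
  trivially acting vectors are pure in \<open>period l\<close>.  The relation \<open>R\<close> pairs the integer vectors that \<open>h\<close>
  conjugates into each other on \<open>V'\<close>; a linear map inside \<open>R\<close> makes \<open>h\<close> equivariant, and its inverse
  does the same for the inverse of \<open>h\<close>.\<close>

lemma return_equivalent_imp_homeomorphic:
  assumes V: "openin A.X V" "V \<noteq> {}" and W: "openin B.X W"
    and h: "homeomorphic_map (subtopology A.X V) (subtopology B.X W) h"
    and bij: "bij_betw (conjugate_by h V)
      (local_action (fundamental_group (M1 0) x1) A.X (global_monodromy M1 p1) V)
      (local_action (fundamental_group (M2 0) x2) B.X (global_monodromy M2 p2) W)"
  shows "A.S homeomorphic_space B.S"
proof -
  let ?LA = "{(U, restrict (A.flow z) U) |U z. openin A.X U \<and> U \<subseteq> V \<and> z \<in> Zn n \<and> A.flow z ` U \<subseteq> V}"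
  let ?LB = "{(U, restrict (B.flow z) U) |U z. openin B.X U \<and> U \<subseteq> W \<and> z \<in> Zn n \<and> B.flow z ` U \<subseteq> W}"
  have im: "conjugate_by h V ` ?LA = ?LB"
    using bij by (simp add: A.local_action_monodromy B.local_action_monodromy bij_betw_def)
  have VX: "V \<subseteq> topspace A.X" and WX: "W \<subseteq> topspace B.X" using V W openin_subset by blast+
  have inj: "inj_on h V" using homeomorphic_imp_injective_map[OF h] VX by (simp add: Int_absorb1)
  have hVW: "h ` V = W" using homeomorphic_imp_surjective_map[OF h] VX WX by (simp add: Int_absorb1)
  have ch: "continuous_map (subtopology A.X V) (subtopology B.X W) h" using h homeomorphic_imp_continuous_map by blast
  obtain y0 where y0: "y0 \<in> V" using V by blast
  then have y0X: "y0 \<in> topspace A.X" using VX by blast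
  obtain m0 where m0: "A.cylinder m0 y0 \<subseteq> V" using A.cylinder_in_open[OF V(1) y0] .
  obtain l1 where l1: "\<And>m x k. l1 \<le> m \<Longrightarrow> x \<in> A.period m \<Longrightarrow> k \<noteq> (0 :: int) \<Longrightarrow>
    of_int k *\<^sub>R x \<in> (\<Inter>j. A.period j) \<Longrightarrow> x \<in> (\<Inter>j. A.period j)" using A.torsion_free_level by blast
  define l where "l = max m0 l1"
  define V' where "V' = A.cylinder l y0"
  define G where "G = A.period l"
  define K where "K = (\<Inter>j. A.period j)"
  define K2 where "K2 = (\<Inter>j. B.period j)"
  have V'V: "V' \<subseteq> V" unfolding V'_def
    using m0 A.cylinder_mono[OF y0X, of m0 l] by (simp add: l_def)
  have V'o: "openin A.X V'" unfolding V'_def by (rule A.openin_cylinder[OF y0X])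
  have y0V': "y0 \<in> V'" using y0X by (simp add: V'_def A.cylinder_def)
  have V'X: "v \<in> topspace A.X" "v \<in> topspace A.S" if "v \<in> V'" for v
    using that V'V VX A.X_subset_S by blast+
  have hV'X: "h v \<in> topspace B.X" "h v \<in> topspace B.S" if "v \<in> V'" for v
    using that V'V hVW WX B.X_subset_S by blast+
  have GR: "g \<in> Rn n" "g \<in> Zn n" if "g \<in> G" for g
    using that A.period_Zn Zn_subset by (auto simp: G_def)
  have GV': "A.flow g v \<in> V' \<longleftrightarrow> g \<in> G" if "v \<in> V'" "g \<in> Zn n" for g v
    using A.flow_in_cylinder_iff[OF y0X] that by (simp add: V'_def G_def)
  have hV'o: "openin B.X (h ` V')"
  proof -
    have "openin (subtopology A.X V) V'" using V'o V'V openin_subtopology_Int2 by (metis inf.absorb_iff2 openin_subtopology)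
    then have "openin (subtopology B.X W) (h ` V')" using h homeomorphic_imp_open_map open_map_def by metis
    then show ?thesis using W openin_trans_full by blast
  qed
  have i: "\<exists>d\<in>Zn n. \<forall>v\<in>V'. h (A.flow g v) = B.flow d (h v)" if g: "g \<in> G" for g
  proof -
    have "(V', restrict (A.flow g) V') \<in> ?LA" 
    proof -
      have "A.flow g ` V' \<subseteq> V" using GV' V'V g GR by blast
      then show ?thesis using V'o V'V GR[OF g] by blast
    qed
    from imageI[OF this, of "conjugate_by h V"]
    have "conjugate_by h V (V', restrict (A.flow g) V') \<in> ?LB" unfolding im .
    then obtain U d where d: "h ` V' = U" "d \<in> Zn n"
      "restrict (h \<circ> restrict (A.flow g) V' \<circ> inv_into V h) (h ` V') = restrict (B.flow d) U"
      unfolding conjugate_by_def by auto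
    have "h (A.flow g v) = B.flow d (h v)" if v: "v \<in> V'" for v
      using fun_cong[OF d(3), of "h v"] v V'V d(1) inv_into_f_f[OF inj, of v] by auto
    then show ?thesis using d(2) by blast
  qed
  \<comment> \<open>one return of a point to \<open>h ` V'\<close> under \<open>d\<close> provides a partner
      \<open>g\<close> near this point, and the partner of \<open>g\<close> on all of \<open>V'\<close>
      differs from \<open>d\<close> by a trivially acting vector\<close>
  have ii: "\<exists>g\<in>G. \<forall>v\<in>V'. h (A.flow g v) = B.flow d (h v)"
    if d: "d \<in> Zn n" and v: "v \<in> V'" "B.flow d (h v) \<in> h ` V'" for d v
  proof -
    define U' where "U' = h ` V' \<inter> {w \<in> topspace B.X. B.flow d w \<in> h ` V'}"
    have "openin B.X U'" unfolding U'_def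
      using hV'o openin_continuous_map_preimage[OF B.continuous_flow_X[OF d] hV'o] by blast
    then have "(U', restrict (B.flow d) U') \<in> ?LB" using d V'V hVW by (auto simp: U'_def)
    then obtain \<alpha> where \<alpha>: "\<alpha> \<in> ?LA" "conjugate_by h V \<alpha> = (U', restrict (B.flow d) U')"
      using im by (metis (no_types, lifting) imageE)
    then obtain U g where U: "U \<subseteq> V" "g \<in> Zn n" "A.flow g ` U \<subseteq> V" "h ` U = U'"
      "restrict (h \<circ> restrict (A.flow g) U \<circ> inv_into V h) U' = restrict (B.flow d) U'"
      unfolding conjugate_by_def by auto
    have "h v \<in> U'" using v hV'X by (auto simp: U'_def)
    then obtain x where "x \<in> U" "h x = h v" using U(4) by (metis imageE)
    then have vU: "v \<in> U" using inj U(1) v V'V by (metis inj_onD subsetD)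
    have hv: "h (A.flow g v) = B.flow d (h v)"
      using fun_cong[OF U(5), of "h v"] \<open>h v \<in> U'\<close> vU U(1) inv_into_f_f[OF inj, of v] by auto
    then obtain v' where v': "v' \<in> V'" "h (A.flow g v) = h v'" using v(2) by auto
    moreover have "A.flow g v \<in> V" using U(3) vU by blast
    ultimately have "A.flow g v \<in> V'" using inj V'V by (metis inj_onD subsetD)
    then have g: "g \<in> G" using GV' v U(2) by blast
    then obtain d' where d': "d' \<in> Zn n" "\<forall>v\<in>V'. h (A.flow g v) = B.flow d' (h v)" using i by blast
    have dR: "d \<in> Rn n" "d' \<in> Rn n" using d d' Zn_subset by blast+
    have "B.flow (d - d') (h v) = h v"
    proof -
      have "B.flow (d - d') (h v) = B.flow (- d') (B.flow d (h v))"
        using B.flow_add[OF hV'X(2)[OF v(1)], of "- d'" d] dR by simp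
      also have "\<dots> = B.flow (- d') (B.flow d' (h v))" using hv d' v by simp
      also have "\<dots> = h v" using B.flow_add[OF hV'X(2)[OF v(1)], of "- d'" d'] dR hV'X v by simp
      finally show ?thesis .
    qed
    then have dd: "\<forall>j. d - d' \<in> B.period j" using B.flow_fixed_iff[OF hV'X(2)[OF v(1)]] dR by blast
    have "B.flow d (h x) = B.flow d' (h x)" if x: "x \<in> V'" for x
    proof -
      have "B.flow (d - d') (h x) = h x" using B.flow_fixed_iff[OF hV'X(2)[OF x]] dR dd by blast
      then show ?thesis using B.flow_add[OF hV'X(2)[OF x], of d' "d - d'"] dR by simp
    qed
    then show ?thesis using d' g by auto
  qed
  define R where "R g d \<longleftrightarrow> g \<in> G \<and> d \<in> Zn n \<and> (\<forall>v\<in>V'. h (A.flow g v) = B.flow d (h v))" for g d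
  define H where "H = {d. \<exists>g. R g d}"
  have RR: "g \<in> G" "g \<in> Rn n" "d \<in> Zn n" "d \<in> Rn n" if "R g d" for g d
    using that GR Zn_subset by (auto simp: R_def)
  have Rdiff: "R (g - g') (d - d')" if "R g d" "R g' d'" for g d g' d'
  proof -
    have G': "g - g' \<in> G" "- g' \<in> G" using RR[OF that(1)] RR[OF that(2)] A.period_closed by (auto simp: G_def)
    have "h (A.flow (g - g') v) = B.flow (d - d') (h v)" if v: "v \<in> V'" for v
    proof -
      define v' where "v' = A.flow (- g') v"
      have v': "v' \<in> V'" using GV'[OF v, of "- g'"] G' GR by (simp add: v'_def)
      have "A.flow g' v' = v" unfolding v'_def
        using A.flow_add[OF V'X(2)[OF v], of g' "- g'"] RR[OF \<open>R g' d'\<close>] V'X v by simp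
      then have "h v = B.flow d' (h v')" using \<open>R g' d'\<close> v' unfolding R_def by metis
      then have "B.flow (d - d') (h v) = B.flow d (h v')"
        using B.flow_add[OF hV'X(2)[OF v'], of "d - d'" d'] RR[OF \<open>R g' d'\<close>] RR[OF \<open>R g d\<close>] by simp
      also have "\<dots> = h (A.flow g v')" using \<open>R g d\<close> v' unfolding R_def by metis
      also have "A.flow g v' = A.flow (g - g') v" unfolding v'_def
        using A.flow_add[OF V'X(2)[OF v], of g "- g'"] RR[OF \<open>R g d\<close>] RR[OF \<open>R g' d'\<close>] by simp
      finally show ?thesis by simp
    qed
    then show ?thesis using G' RR[OF that(1)] RR[OF that(2)] by (auto simp: R_def)
  qed
  have KR: "k \<in> Rn n" "k \<in> G" if "k \<in> K" for k
    using that A.period_Zn[of 0] Zn_subset by (auto simp: K_def G_def)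
  have K2R: "k \<in> Rn n" "k \<in> Zn n" if "k \<in> K2" for k
    using that B.period_Zn[of 0] Zn_subset by (auto simp: K2_def)
  have Kfix: "A.flow k v = v" if "k \<in> K" "v \<in> V'" for k v
    using A.flow_fixed_iff[OF V'X(2)[OF that(2)]] KR that(1) by (auto simp: K_def)
  have K2fix: "B.flow k (h v) = h v" if "k \<in> K2" "v \<in> V'" for k v
    using B.flow_fixed_iff[OF hV'X(2)[OF that(2)]] K2R that(1) by (auto simp: K2_def)
  have RKK: "R k k'" if "k \<in> K" "k' \<in> K2" for k k'
    using that KR K2R Kfix K2fix by (auto simp: R_def)
  have K0: "0 \<in> K" "0 \<in> K2" using A.period_closed B.period_closed by (auto simp: K_def K2_def)
  have RK: "g \<in> K \<longleftrightarrow> d \<in> K2" if R: "R g d" for g d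
  proof -
    have eq: "h (A.flow g y0) = B.flow d (h y0)" using R y0V' by (simp add: R_def)
    have gV: "A.flow g y0 \<in> V" using GV'[OF y0V'] RR[OF R] GR V'V by blast
    have "g \<in> K \<longleftrightarrow> A.flow g y0 = y0" using A.flow_fixed_iff[OF V'X(2)[OF y0V']] RR[OF R] by (auto simp: K_def)
    also have "\<dots> \<longleftrightarrow> B.flow d (h y0) = h y0" using eq inj gV y0 by (metis inj_onD)
    also have "\<dots> \<longleftrightarrow> d \<in> K2" using B.flow_fixed_iff[OF hV'X(2)[OF y0V']] RR[OF R] by (auto simp: K2_def)
    finally show ?thesis .
  qed
  have subH: "add_subgroup H"
    unfolding add_subgroup_def H_def using Rdiff RKK[OF K0] by blast
  have subK: "add_subgroup K" "add_subgroup K2"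
    using A.add_subgroup_period B.add_subgroup_period by (auto simp: add_subgroup_def K_def K2_def)
  obtain NG where NG: "NG > 0" "\<And>z. z \<in> Zn n \<Longrightarrow> real NG *\<^sub>R z \<in> G"
    unfolding G_def using A.period_multiples[of l] by blast
  obtain m where m: "B.cylinder m (h y0) \<subseteq> h ` V'" using B.cylinder_in_open[OF hV'o] y0V' by blast
  obtain NH where NH: "NH > 0" "\<And>z. z \<in> Zn n \<Longrightarrow> real NH *\<^sub>R z \<in> B.period m"
    using B.period_multiples[of m] by blast
  \<comment> \<open>the open set \<open>h ` V'\<close> contains a cylinder, so \<open>H\<close> contains the multiples
      that preserve this cylinder\<close>
  have NH': "real NH *\<^sub>R z \<in> H" if "z \<in> Zn n" for z
  proof -
    have z: "real NH *\<^sub>R z \<in> Zn n" using NH(2)[OF that] B.period_Zn by blast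
    have "B.flow (real NH *\<^sub>R z) (h y0) \<in> B.cylinder m (h y0)"
      using B.flow_in_cylinder_iff[OF hV'X(1)[OF y0V'] _ z] NH(2)[OF that] hV'X[OF y0V'] by (simp add: B.cylinder_def)
    then have "B.flow (real NH *\<^sub>R z) (h y0) \<in> h ` V'" using m by blast
    from ii[OF z y0V' this] show ?thesis unfolding H_def R_def using z by blast
  qed
  obtain L L' where L: "linear L" "linear L'" "\<And>x. x \<in> Rn n \<Longrightarrow> L x \<in> Rn n \<and> L' (L x) = x"
    "\<And>x. x \<in> Rn n \<Longrightarrow> L' x \<in> Rn n \<and> L (L' x) = x"
    "\<And>g. g \<in> G \<Longrightarrow> R g (L g)" "\<And>d. d \<in> H \<Longrightarrow> R (L' d) d"
  proof (rule linear_isomorphism_of_relation[of G n K H K2 NG NH R])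
    show "add_subgroup G" "G \<subseteq> Zn n" using A.add_subgroup_period A.period_Zn by (auto simp: G_def)
    show "K \<subseteq> G" using KR by blast
    show "H \<subseteq> Zn n" using RR by (auto simp: H_def)
    show "K2 \<subseteq> H" using RKK[OF K0(1)] by (auto simp: H_def)
    show "x \<in> K" if "x \<in> G" "k \<noteq> 0" "real_of_int k *\<^sub>R x \<in> K" for x k
      using l1[of l x k] that by (simp add: K_def G_def l_def)
    show "\<exists>d. R g d" if "g \<in> G" for g using i[OF that] that by (auto simp: R_def)
    show "R (g - g') (d - d')" if "R g d" "R g' d'" for g d g' d' using Rdiff that by blast
    show "g \<in> K \<longleftrightarrow> d \<in> K2" if "R g d" for g d using RK that by blast
    show "R g d" if "g \<in> K" "d \<in> K2" for g d using RKK that by blast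
  qed (use NG NH NH' subH subK RR in \<open>auto simp: H_def\<close>)
  have chV': "continuous_map (subtopology A.X V') B.X h"
    using ch V'V by (meson continuous_map_from_subtopology_mono continuous_map_in_subtopology)
  obtain \<Phi> where \<Phi>: "continuous_map A.S B.S \<Phi>"
    "\<And>t v. t \<in> Rn n \<Longrightarrow> v \<in> V' \<Longrightarrow> \<Phi> (A.flow t v) = B.flow (L t) (h v)"
  proof (rule equivariant_extension[OF V'o _ chV' L(1)])
    show "h (A.flow z v) = B.flow (L z) (h v)" if "v \<in> V'" "z \<in> Zn n" "A.flow z v \<in> V'" for v z
      using L(5)[of z] GV' that by (simp add: R_def)
  qed (use y0V' L in auto)
  interpret sw: two_towers n M2 p2 x2 u2 M1 p1 x1 u1 by (rule two_towers_swap) unfold_locales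
  define k where "k = inv_into V h"
  have kh: "k (h v) = v" if "v \<in> V" for v using that inj by (simp add: k_def)
  have ck: "continuous_map (subtopology B.X (h ` V')) A.X k"
  proof -
    obtain q where q: "homeomorphic_maps (subtopology A.X V) (subtopology B.X W) h q"
      using h homeomorphic_map_maps by blast
    then have "continuous_map (subtopology B.X W) A.X q"
      by (simp add: homeomorphic_maps_def continuous_map_in_subtopology)
    then have "continuous_map (subtopology B.X (h ` V')) A.X q"
      using V'V hVW by (metis continuous_map_from_subtopology_mono image_mono)
    moreover have "q (h v) = v" if "v \<in> V'" for v
      using q that V'V VX by (auto simp: homeomorphic_maps_def)
    ultimately show ?thesis
      using V'V by (elim continuous_map_eq) (auto simp: kh)
  qed
  obtain \<Psi> where \<Psi>: "continuous_map B.S A.S \<Psi>"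
    "\<And>t w. t \<in> Rn n \<Longrightarrow> w \<in> h ` V' \<Longrightarrow> \<Psi> (B.flow t w) = A.flow (L' t) (k w)"
  proof (rule sw.equivariant_extension[OF hV'o _ ck L(2)])
    fix w d assume w: "w \<in> h ` V'" "d \<in> Zn n" "B.flow d w \<in> h ` V'"
    then obtain v where v: "v \<in> V'" "w = h v" by blast
    have "d \<in> H" using ii[of d v] w v by (auto simp: H_def R_def)
    then have R: "R (L' d) d" by (rule L(6))
    then have "B.flow d w = h (A.flow (L' d) v)" using v by (simp add: R_def)
    moreover have "A.flow (L' d) v \<in> V" using GV'[OF v(1)] RR[OF R] GR V'V by blast
    ultimately show "k (B.flow d w) = A.flow (L' d) (k w)" using kh v V'V by auto
  qed (use y0V' L in auto)
  have "homeomorphic_maps A.S B.S \<Phi> \<Psi>"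
    unfolding homeomorphic_maps_def
  proof (intro conjI ballI \<Phi>(1) \<Psi>(1))
    fix s assume s: "s \<in> topspace A.S"
    obtain t v where tv: "t \<in> Rn n" "v \<in> V'" "s = A.flow t v" using A.flow_from_open[OF V'o _ s] y0V' by blast
    then show "\<Psi> (\<Phi> s) = s" using \<Phi>(2) \<Psi>(2)[of "L t" "h v"] L(3) kh V'V by auto
  next
    fix s assume s: "s \<in> topspace B.S"
    obtain t w where tw: "t \<in> Rn n" "w \<in> h ` V'" "s = B.flow t w" using B.flow_from_open[OF hV'o _ s] y0V' by blast
    then obtain v where v: "v \<in> V'" "w = h v" by blast
    then show "\<Phi> (\<Psi> s) = s" using \<Phi>(2)[of "L' t" v] \<Psi>(2)[of t w] L(4) kh V'V tw by auto
  qed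
  then show ?thesis unfolding homeomorphic_space_def by blast
qed

end

section \<open>Homeomorphisms along leaves\<close>

context torus_tower
begin

text \<open>Cylinders of the same level are equal or disjoint.\<close>

lemma cylinder_clopen_in:
  assumes "y \<in> topspace X" "v \<in> topspace X" "k \<le> m" "v \<notin> cylinder k y" "v' \<in> cylinder m v"
  shows "v' \<notin> cylinder k y"
proof -
  have "v' k = v k" using cylinder_mono[OF assms(2,3)] assms(5) by (auto simp: cylinder_def)
  then show ?thesis using assms by (simp add: cylinder_def)
qed

lemma integer_valued_locally_constant:
  assumes y: "y \<in> topspace X" and f: "continuous_map (subtopology X (cylinder k y)) (RnT n) f"
    and Z: "\<And>v. v \<in> cylinder k y \<Longrightarrow> f v \<in> Zn n"
  obtains m where "k \<le> m"
    "\<And>v v'. v \<in> cylinder k y \<Longrightarrow> v' \<in> cylinder m v \<Longrightarrow> v' \<in> cylinder k y \<and> f v' = f v"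
proof -
  let ?C = "cylinder k y"
  have CX: "?C \<subseteq> topspace X" by (auto simp: cylinder_def)
  define g where "g v = (if v \<in> ?C then Some (f v) else None)" for v
  have ex: "\<exists>m. \<forall>v'\<in>cylinder m v. g v' = g v" if v: "v \<in> topspace X" for v
  proof (cases "v \<in> ?C")
    case False
    then show ?thesis using cylinder_clopen_in[OF y v order_refl] by (intro exI[of _ k]) (auto simp: g_def)
  next
    case True
    let ?T = "{w \<in> topspace (subtopology X ?C). f w \<in> Rn n \<inter> ball (f v) 1}"
    have "openin (subtopology X ?C) ?T"
      using f by (rule openin_continuous_map_preimage) (simp add: openin_open_Int)
    then have "openin X ?T" using openin_cylinder[OF y] openin_trans_full by blast
    moreover have "v \<in> ?T" using v True Z[OF True] Zn_subset by auto
    ultimately obtain m where m: "cylinder m v \<subseteq> ?T" using cylinder_in_open by blast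
    have "g w = g v" if w: "w \<in> cylinder m v" for w
    proof -
      have "w \<in> ?C" "dist (f v) (f w) < 1" using m w by auto
      then have "f v = f w" using Zn_discrete[OF Z[OF True] Z] by blast
      then show ?thesis using \<open>w \<in> ?C\<close> True by (simp add: g_def)
    qed
    then show ?thesis by blast
  qed
  obtain m0 where m0: "\<And>y y'. y \<in> topspace X \<Longrightarrow> y' \<in> cylinder m0 y \<Longrightarrow> g y' = g y"
    using locally_constant_on_fibre[of g] ex by blast
  show ?thesis
  proof (rule that[of "max k m0"])
    fix v v' assume v: "v \<in> ?C" "v' \<in> cylinder (max k m0) v"
    then have "v' \<in> cylinder m0 v" using cylinder_mono[of v m0 "max k m0"] CX by auto
    then have "g v' = g v" using m0 v CX by blast
    then show "v' \<in> ?C \<and> f v' = f v" using v(1) by (auto simp: g_def split: if_splits)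
  qed simp
qed

end

context two_towers
begin

text \<open>Here \<open>h\<close> is the transverse part of \<open>\<Phi>\<close> and \<open>F\<close> its displacement along the leaves.  The vector
  \<open>c g\<close> depends on \<open>g\<close> only, so that \<open>h\<close> carries one element of the action to one element.\<close>

definition leafwise_lift :: "((nat \<Rightarrow> 'a) \<Rightarrow> nat \<Rightarrow> 'b) \<Rightarrow> (nat \<Rightarrow> 'a) \<Rightarrow> nat \<Rightarrow> (vec \<times> (nat \<Rightarrow> 'a) \<Rightarrow> vec) \<Rightarrow>
    ((nat \<Rightarrow> 'a) \<Rightarrow> nat \<Rightarrow> 'b) \<Rightarrow> (vec \<Rightarrow> vec) \<Rightarrow> bool" where
  "leafwise_lift \<Phi> y0 l F h c \<longleftrightarrow>
     continuous_map (prod_topology (RnT n) (subtopology A.X (A.cylinder l y0))) (RnT n) F \<and>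
     F (0, y0) = 0 \<and>
     continuous_map (subtopology A.X (A.cylinder l y0)) B.X h \<and>
     (\<forall>v\<in>A.cylinder l y0. \<forall>x\<in>Rn n. \<Phi> (A.flow x v) = B.flow (F (x, v)) (h v)) \<and>
     (\<forall>g\<in>A.period l. c g \<in> Zn n \<and> (\<forall>v\<in>A.cylinder l y0. h (A.flow g v) = B.flow (c g) (h v)))"

text \<open>The map \<open>h\<close> and the cocycle \<open>d\<close> are found on a cylinder \<open>C\<close> of level \<open>k\<close>.  Each \<open>d g\<close> is locally
  constant, so for the finitely many generators of \<open>period k\<close> it depends only on the coordinate at some
  common level \<open>l\<close>.  By the cocycle identity this property passes to the subgroup that they generate,
  and on the cylinder of level \<open>l\<close> all \<open>d g\<close> are constant.\<close>

lemma leafwise_lift_exists: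
  assumes \<Phi>: "continuous_map A.S B.S \<Phi>" and y0: "y0 \<in> topspace A.X" and \<Phi>y0: "\<Phi> y0 \<in> topspace B.X"
  obtains l F h c where "leafwise_lift \<Phi> y0 l F h c"
proof -
  have y0S: "y0 \<in> topspace A.S" using y0 A.X_subset_S by blast
  obtain V0 \<sigma> where V0: "openin (M2 0) V0" "u2 0 0 \<in> V0" "continuous_map (subtopology (M2 0) V0) (RnT n) \<sigma>"
    "\<sigma> (u2 0 0) = 0" "\<forall>s\<in>V0. u2 0 (\<sigma> s) = s" using B.u_section[of 0 0] by blast
  have c0: "continuous_map A.S (M2 0) (\<lambda>s. \<Phi> s 0)"
    using continuous_map_compose[OF \<Phi> B.continuous_projection] by (simp add: o_def)
  have XS: "continuous_map A.X A.S (\<lambda>y. y)"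
    unfolding base_fibre_def by (intro continuous_map_from_subtopology) (simp add: continuous_map_id[unfolded id_def])
  have c0X: "continuous_map A.X (M2 0) (\<lambda>s. \<Phi> s 0)"
    using continuous_map_compose[OF XS c0] by (simp add: o_def)
  have "openin A.X {v \<in> topspace A.X. \<Phi> v 0 \<in> V0}" using c0X V0(1) by (rule openin_continuous_map_preimage)
  moreover have "y0 \<in> {v \<in> topspace A.X. \<Phi> v 0 \<in> V0}"
    using y0 \<Phi>y0 V0(2) by (simp add: B.topspace_X B.u_base)
  ultimately obtain k where k: "A.cylinder k y0 \<subseteq> {v \<in> topspace A.X. \<Phi> v 0 \<in> V0}"
    by (rule A.cylinder_in_open)
  define C where "C = A.cylinder k y0"
  let ?Y = "subtopology A.X C"
  have CX: "C \<subseteq> topspace A.X" by (auto simp: C_def A.cylinder_def)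
  have CS: "v \<in> topspace A.S" if "v \<in> C" for v using that CX A.X_subset_S by blast
  have y0C: "y0 \<in> C" using y0 by (simp add: C_def A.cylinder_def)
  have YC: "topspace ?Y = C" using CX by auto
  have "continuous_map ?Y (subtopology (M2 0) V0) (\<lambda>v. \<Phi> v 0)"
    using continuous_map_from_subtopology[OF c0X] k by (auto simp: continuous_map_in_subtopology C_def)
  from continuous_map_compose[OF this V0(3)] have cf: "continuous_map ?Y (RnT n) (\<lambda>v. \<sigma> (\<Phi> v 0))" by (simp add: o_def)
  let ?P = "prod_topology (RnT n) ?Y"
  have YS: "continuous_map ?P A.S snd"
    using continuous_map_compose[OF continuous_map_snd continuous_map_from_subtopology[OF XS]] by (simp add: o_def)
  have cfl: "continuous_map ?P A.S (\<lambda>w. A.flow (fst w) (snd w))"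
    by (intro A.continuous_flow_compose continuous_map_fst YS)
  have cg: "continuous_map ?P (M2 0) (\<lambda>w. \<Phi> (A.flow (fst w) (snd w)) 0)"
    using continuous_map_compose[OF cfl c0] by (simp add: o_def)
  obtain F where F: "continuous_map ?P (RnT n) F"
    "\<And>y. y \<in> topspace ?Y \<Longrightarrow> F (0, y) = \<sigma> (\<Phi> y 0)"
    "\<And>x y. x \<in> Rn n \<Longrightarrow> y \<in> topspace ?Y \<Longrightarrow> u2 0 (F (x, y)) = \<Phi> (A.flow (fst (x, y)) (snd (x, y))) 0"
    by (rule lift_from_Rn[OF B.covering_u_0 cg cf]) (use k CS V0(5) in \<open>auto simp: C_def\<close>)
  have F0: "F (0, y0) = 0"
    using F(2)[unfolded YC, OF y0C] \<Phi>y0 V0(4) by (simp add: B.topspace_X B.u_base)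
  have uF: "u2 0 (F (x, v)) = \<Phi> (A.flow x v) 0" if "x \<in> Rn n" "v \<in> C" for x v
    using F(3)[unfolded YC, OF that] by simp
  have FR: "F (x, v) \<in> Rn n" if "x \<in> Rn n" "v \<in> C" for x v
    using F(1) that YC by (auto simp: continuous_map_def)
  have \<Phi>S: "\<Phi> (A.flow x v) \<in> topspace B.S" if "x \<in> Rn n" "v \<in> C" for x v
    using \<Phi> A.flow_in_S[OF CS[OF that(2)] that(1)] by (auto simp: continuous_map_def)
  define q where "q = (\<lambda>w. B.flow (- F w) (\<Phi> (A.flow (fst w) (snd w))))"
  have q0: "q (x, v) 0 = x2" if "x \<in> Rn n" "v \<in> C" for x v
    using B.flow_level[of "\<Phi> (A.flow x v)" 0 "F (x, v)" "- F (x, v)"] uF[OF that] FR[OF that]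
    by (simp add: q_def B.u_base)
  have cq: "continuous_map ?P B.X q"
  proof -
    have "continuous_map ?P B.S q" unfolding q_def
      using continuous_map_compose[OF cfl \<Phi>]
      by (intro B.continuous_flow_compose continuous_map_Rn_minus F(1)) (simp add: o_def)
    then show ?thesis using q0 by (auto simp: B.continuous_into_X)
  qed
  have slice: "continuous_map (RnT n) ?P (\<lambda>x. (x, v))" if "v \<in> C" for v
    using that CX by (intro continuous_map_pairedI) (auto simp: continuous_map_id[unfolded id_def])
  have qconst: "q (x, v) = q (0, v)" if "x \<in> Rn n" "v \<in> C" for x v
    using B.connected_into_X_constant[OF connected_space_RnT, of n "\<lambda>x. q (x, v)" x 0]
      continuous_map_compose[OF slice[OF that(2)] cq] that by (simp add: o_def)
  define h where "h v = q (0, v)" for v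
  have ch: "continuous_map ?Y B.X h"
  proof -
    have "continuous_map ?Y ?P (\<lambda>v. (0, v))"
      by (intro continuous_map_pairedI) (auto simp: continuous_map_id[unfolded id_def])
    from continuous_map_compose[OF this cq] show ?thesis unfolding h_def by (simp add: o_def)
  qed
  have hX: "h v \<in> topspace B.X" "h v \<in> topspace B.S" if "v \<in> C" for v
    using ch that YC B.X_subset_S by (auto simp: continuous_map_def)
  have \<Phi>F: "\<Phi> (A.flow x v) = B.flow (F (x, v)) (h v)" if "x \<in> Rn n" "v \<in> C" for x v
  proof -
    have "h v = B.flow (- F (x, v)) (\<Phi> (A.flow x v))" using qconst[OF that] by (simp add: h_def q_def)
    then show ?thesis using B.flow_add[OF \<Phi>S[OF that], of "F (x, v)" "- F (x, v)"] FR[OF that] \<Phi>S[OF that] by simp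
  qed
  define G where "G = A.period k"
  have GR: "g \<in> Zn n" "g \<in> Rn n" if "g \<in> G" for g using that A.period_Zn Zn_subset by (auto simp: G_def)
  have GC: "A.flow g v \<in> C" if "g \<in> G" "v \<in> C" for g v
    using A.flow_in_cylinder_iff[OF y0, of v k g] that GR by (simp add: C_def G_def)
  define d where "d g v = F (g, v) - F (0, A.flow g v)" for g v
  have cocycle: "F (x + g, v) = F (x, A.flow g v) + d g v" and dZ: "d g v \<in> Zn n"
    if g: "g \<in> G" and v: "v \<in> C" and x: "x \<in> Rn n" for g v x
  proof -
    have gv: "A.flow g v \<in> C" using GC g v by blast
    have up: "u2 0 (F (x + g, v)) = u2 0 (F (x, A.flow g v))" if "x \<in> Rn n" for x
      using uF[of "x + g" v] uF[OF that gv] A.flow_add[OF CS[OF v], of x g] that GR[OF g] v by (simp add: add.commute)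
    have "u2 0 (F (g, v)) = u2 0 (F (0, A.flow g v))" using up[of 0] by simp
    then have "d g v \<in> B.period 0"
      unfolding d_def using B.u_eq_period[of "F (g, v)" "F (0, A.flow g v)" 0] FR GR[OF g] v gv by simp
    then show dZ: "d g v \<in> Zn n" by (simp add: B.period_0)
    have dR: "d g v \<in> Rn n" using dZ Zn_subset by blast
    have c1: "continuous_map (RnT n) (RnT n) (\<lambda>x. F (x + g, v))"
      using continuous_map_compose[OF homeomorphic_imp_continuous_map[OF homeomorphic_map_translation[OF GR(2)[OF g]]]
          continuous_map_compose[OF slice[OF v] F(1)]] by (simp add: o_def)
    have c2: "continuous_map (RnT n) (RnT n) (\<lambda>x. F (x, A.flow g v) + d g v)"
      using continuous_map_compose[OF continuous_map_compose[OF slice[OF gv] F(1)]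
          homeomorphic_imp_continuous_map[OF homeomorphic_map_translation[OF dR]]] by (simp add: o_def)
    show "F (x + g, v) = F (x, A.flow g v) + d g v"
    proof (rule lift_unique[OF B.covering_u_0 connected_space_RnT c1 c2, where ?x0.0 = 0])
      fix x assume "x \<in> topspace (RnT n)"
      then have x: "x \<in> Rn n" by simp
      have "u2 0 (F (x, A.flow g v) + d g v) = u2 0 (F (x, A.flow g v))"
        using B.u_add_period[of "F (x, A.flow g v)" "d g v" 0] FR[OF x gv] dR \<open>d g v \<in> B.period 0\<close> by simp
      then show "u2 0 (F (x + g, v)) = u2 0 (F (x, A.flow g v) + d g v)" using up[OF x] by simp
    qed (use x in \<open>auto simp: d_def\<close>)
  qed
  have dadd: "d (g + g') v = d g (A.flow g' v) + d g' v" if g: "g \<in> G" "g' \<in> G" and v: "v \<in> C" for g g' v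
  proof -
    have g'v: "A.flow g' v \<in> C" using GC g v by blast
    have "F (g + g', v) = F (0, A.flow g (A.flow g' v)) + d g (A.flow g' v) + d g' v"
      using cocycle[OF g(2) v GR(2)[OF g(1)]] cocycle[OF g(1) g'v, of 0] by simp
    moreover have "A.flow g (A.flow g' v) = A.flow (g + g') v"
      using A.flow_add[OF CS[OF v]] GR g by (simp add: add.commute)
    ultimately show ?thesis by (simp add: d_def[of "g + g'"])
  qed
  have cd: "continuous_map ?Y (RnT n) (d g)" if g: "g \<in> G" for g
  proof -
    have "continuous_map ?Y ?P (\<lambda>v. (g, v))" using GR[OF g]
      by (intro continuous_map_pairedI) (auto simp: continuous_map_id[unfolded id_def])
    from continuous_map_compose[OF this F(1)] have 1: "continuous_map ?Y (RnT n) (\<lambda>v. F (g, v))" by (simp add: o_def)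
    have "continuous_map ?Y ?Y (A.flow g)"
      using continuous_map_from_subtopology[OF A.continuous_flow_X[OF GR(1)[OF g]]] GC[OF g] CX
      by (auto simp: continuous_map_in_subtopology)
    then have "continuous_map ?Y ?P (\<lambda>v. (0, A.flow g v))" 
      by (intro continuous_map_pairedI) auto
    from continuous_map_compose[OF this F(1)] have 2: "continuous_map ?Y (RnT n) (\<lambda>v. F (0, A.flow g v))" by (simp add: o_def)
    show ?thesis unfolding d_def by (rule continuous_map_Rn_diff[OF 1 2])
  qed
  have "\<exists>m\<ge>k. \<forall>v\<in>C. \<forall>v'\<in>A.cylinder m v. v' \<in> C \<and> d g v' = d g v" if g: "g \<in> G" for g
  proof -
    obtain m where "k \<le> m"
      "\<And>v v'. v \<in> A.cylinder k y0 \<Longrightarrow> v' \<in> A.cylinder m v \<Longrightarrow> v' \<in> A.cylinder k y0 \<and> d g v' = d g v"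
      using A.integer_valued_locally_constant[OF y0, of k "d g"] cd[OF g] dZ[OF g, of _ 0] unfolding C_def by blast
    then show ?thesis unfolding C_def by blast
  qed
  then obtain mm where mm: "\<And>g v v'. g \<in> G \<Longrightarrow> v \<in> C \<Longrightarrow> v' \<in> A.cylinder (mm g) v \<Longrightarrow> d g v' = d g v"
    by metis
  have subG: "add_subgroup G" "G \<subseteq> Zn n" using A.add_subgroup_period A.period_Zn by (auto simp: G_def)
  obtain H where H: "finite H" "H \<subseteq> G" "\<And>x. x \<in> G \<Longrightarrow> \<exists>c :: vec \<Rightarrow> int. x = int_comb c H"
    using add_subgroup_finitely_generated[OF subG] by blast
  obtain m1 where m1: "\<And>g. g \<in> H \<Longrightarrow> mm g \<le> m1"
    using H(1) by (metis finite_imageI finite_nat_set_iff_bounded_le image_eqI)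
  define l where "l = max k m1"
  define P where "P = {g \<in> G. \<forall>v\<in>C. \<forall>v'\<in>C. v l = v' l \<longrightarrow> d g v = d g v'}"
  have PI: "g \<in> P" if "g \<in> G" "\<And>v v'. v \<in> C \<Longrightarrow> v' \<in> C \<Longrightarrow> v l = v' l \<Longrightarrow> d g v = d g v'" for g
    using that unfolding P_def by blast
  have PD: "d g v = d g v'" if "g \<in> P" "v \<in> C" "v' \<in> C" "v l = v' l" for g v v'
    using that unfolding P_def by blast
  have "add_subgroup P"
    unfolding add_subgroup_def
  proof (intro conjI ballI)
    have "d 0 v = 0" if "v \<in> C" for v using CS[OF that] by (simp add: d_def)
    then show "0 \<in> P" using add_subgroup_0[OF subG(1)] by (simp add: P_def)
    fix g g' assume gg: "g \<in> P" "g' \<in> P"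
    then have g: "g \<in> G" "g' \<in> G" by (auto simp: P_def)
    then have gm: "g - g' \<in> G" "- g' \<in> G" using add_subgroup_diff add_subgroup_minus subG by blast+
    have dd: "d (g - g') w = d g (A.flow (- g') w) - d g' (A.flow (- g') w)" if w: "w \<in> C" for w
    proof -
      have w': "A.flow (- g') w \<in> C" using GC[OF gm(2) w] .
      have "A.flow g' (A.flow (- g') w) = w" using A.flow_add[OF CS[OF w], of g' "- g'"] GR g CS[OF w] by simp
      then show ?thesis using dadd[OF gm(1) g(2) w'] by simp
    qed
    have "d (g - g') v = d (g - g') v'" if v: "v \<in> C" "v' \<in> C" "v l = v' l" for v v'
    proof -
      have "A.flow (- g') v \<in> C" "A.flow (- g') v' \<in> C" using GC gm v by blast+
      moreover have "A.flow (- g') v l = A.flow (- g') v' l"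
        using A.flow_level_cong[OF CS[OF v(1)], of "- g'" l v'] GR[OF gm(2)] v by simp
      ultimately show ?thesis
        using PD[OF gg(1)] PD[OF gg(2)] dd[OF v(1)] dd[OF v(2)] by metis
    qed
    then show "g - g' \<in> P" using gm(1) by (intro PI)
  qed
  moreover have "H \<subseteq> P"
  proof
    fix g assume g: "g \<in> H"
    have "d g v = d g v'" if "v \<in> C" "v' \<in> C" "v l = v' l" for v v'
    proof -
      have "v' \<in> A.cylinder l v" using that CX by (auto simp: A.cylinder_def)
      moreover have "mm g \<le> l" using m1[OF g] by (simp add: l_def)
      ultimately have "v' \<in> A.cylinder (mm g) v" using A.cylinder_mono that CX by blast
      moreover have "g \<in> G" using g H(2) by blast
      ultimately show ?thesis using mm[of g v v'] that(1) by simp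
    qed
    moreover have "g \<in> G" using g H(2) by blast
    ultimately show "g \<in> P" by (intro PI)
  qed
  ultimately have GP: "G \<subseteq> P"
    using H(3) add_subgroup_comb[of P H "\<lambda>b. b"] by (metis subset_iff)
  have CC: "A.cylinder l y0 \<subseteq> C" unfolding C_def using A.cylinder_mono[OF y0, of k l] by (simp add: l_def)
  have Gl: "A.period l \<subseteq> G" unfolding G_def using A.period_antimono[of k l] by (simp add: l_def)
  have "leafwise_lift \<Phi> y0 l F h (\<lambda>g. d g y0)"
    unfolding leafwise_lift_def
  proof (intro conjI ballI F0)
    have "prod_topology (RnT n) (subtopology A.X (A.cylinder l y0)) = subtopology ?P (UNIV \<times> A.cylinder l y0)"
      using CC by (simp add: subtopology_Times subtopology_subtopology Int_absorb1)
    then show "continuous_map (prod_topology (RnT n) (subtopology A.X (A.cylinder l y0))) (RnT n) F"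
      using F(1) by (simp only: continuous_map_from_subtopology)
    show "continuous_map (subtopology A.X (A.cylinder l y0)) B.X h"
      using ch CC continuous_map_from_subtopology_mono by blast
    show "\<Phi> (A.flow x v) = B.flow (F (x, v)) (h v)" if "v \<in> A.cylinder l y0" "x \<in> Rn n" for v x
      using \<Phi>F that CC by blast
    fix g assume g: "g \<in> A.period l"
    then have gG: "g \<in> G" using Gl by blast
    show "d g y0 \<in> Zn n" using dZ[OF gG y0C, of 0] by simp
    fix v assume v: "v \<in> A.cylinder l y0"
    then have vC: "v \<in> C" using CC by blast
    have gv: "A.flow g v \<in> C" using GC gG vC by blast
    have "v l = y0 l" using v by (simp add: A.cylinder_def)
    then have dv: "d g v = d g y0" using GP gG vC y0C by (intro PD) auto
    have dR: "d g v \<in> Rn n" using dZ[OF gG vC, of 0] Zn_subset by auto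
    have FR0: "F (0, A.flow g v) \<in> Rn n" using FR[OF _ gv] by simp
    have "B.flow (F (0, A.flow g v)) (h (A.flow g v)) = \<Phi> (A.flow g v)"
      using \<Phi>F[of 0, OF _ gv] CS[OF gv] by simp
    also have "\<dots> = B.flow (F (0, A.flow g v)) (B.flow (d g v) (h v))"
      using \<Phi>F[of g, OF _ vC] GR[OF gG] B.flow_add[OF hX(2)[OF vC] FR0 dR] by (simp add: d_def)
    finally have "B.flow (- F (0, A.flow g v)) (B.flow (F (0, A.flow g v)) (h (A.flow g v)))
        = B.flow (- F (0, A.flow g v)) (B.flow (F (0, A.flow g v)) (B.flow (d g v) (h v)))" by simp
    moreover have cancel: "B.flow (- t) (B.flow t s) = s" if "t \<in> Rn n" "s \<in> topspace B.S" for t s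
      using B.flow_add[of s "- t" t] that by simp
    ultimately have "h (A.flow g v) = B.flow (d g v) (h v)"
      using FR0 hX(2)[OF gv] B.flow_in_S[OF hX(2)[OF vC] dR] by simp
    then show "h (A.flow g v) = B.flow (d g y0) (h v)" using dv by simp
  qed
  then show ?thesis by (rule that)
qed

end

section \<open>From homeomorphism to return equivalence\<close>

context two_towers
begin

text \<open>The composition of the two leafwise descriptions shows that \<open>h' (h v)\<close> and \<open>v\<close> differ by the
  displacement \<open>\<tau> v\<close>.  It is an integer vector, depends continuously on \<open>v\<close> and vanishes at \<open>y0\<close>,
  so it vanishes nearby.\<close>

lemma leafwise_lift_round_trip:
  assumes \<Phi>: "leafwise_lift \<Phi> y0 l F h c" and y0: "y0 \<in> topspace A.X" and w0: "\<Phi> y0 = w0" "w0 \<in> topspace B.X"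
    and \<Psi>: "two_towers.leafwise_lift n M2 p2 x2 u2 M1 p1 x1 u1 \<Psi> w0 l' F' h' c'"
    and inv: "\<forall>s\<in>topspace A.S. \<Psi> (\<Phi> s) = s"
    and W: "openin B.X W" "w0 \<in> W"
  obtains k where "l \<le> k" "\<And>v. v \<in> A.cylinder k y0 \<Longrightarrow> h v \<in> W \<and> h v \<in> B.cylinder l' w0 \<and> h' (h v) = v"
proof -
  interpret sw: two_towers n M2 p2 x2 u2 M1 p1 x1 u1 by (rule two_towers_swap) unfold_locales
  let ?C = "A.cylinder l y0" and ?C' = "B.cylinder l' w0"
  have F: "continuous_map (prod_topology (RnT n) (subtopology A.X ?C)) (RnT n) F" "F (0, y0) = 0"
      "continuous_map (subtopology A.X ?C) B.X h"
      "\<And>v x. v \<in> ?C \<Longrightarrow> x \<in> Rn n \<Longrightarrow> \<Phi> (A.flow x v) = B.flow (F (x, v)) (h v)"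
    using \<Phi> unfolding leafwise_lift_def by blast+
  have F': "continuous_map (prod_topology (RnT n) (subtopology B.X ?C')) (RnT n) F'" "F' (0, w0) = 0"
      "continuous_map (subtopology B.X ?C') A.X h'"
      "\<And>v x. v \<in> ?C' \<Longrightarrow> x \<in> Rn n \<Longrightarrow> \<Psi> (B.flow x v) = A.flow (F' (x, v)) (h' v)"
    using \<Psi> unfolding sw.leafwise_lift_def by blast+
  have CX: "?C \<subseteq> topspace A.X" "?C' \<subseteq> topspace B.X" by (auto simp: A.cylinder_def B.cylinder_def)
  have y0C: "y0 \<in> ?C" and w0C: "w0 \<in> ?C'" using y0 w0 by (auto simp: A.cylinder_def B.cylinder_def)
  have hX: "h v \<in> topspace B.X" if "v \<in> ?C" for v using F(3) that CX by (auto simp: continuous_map_def)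
  have h'X: "h' w \<in> topspace A.X" if "w \<in> ?C'" for w using F'(3) that CX by (auto simp: continuous_map_def)
  have hy0: "h y0 = w0"
    using F(4)[OF y0C, of 0] F(2) w0 A.X_subset_S[OF y0] B.X_subset_S[OF hX[OF y0C]] by simp
  define D where "D = {v \<in> topspace (subtopology A.X ?C). h v \<in> ?C' \<inter> W}"
  have opC: "openin A.X ?C" "openin B.X ?C'" using A.openin_cylinder[OF y0] B.openin_cylinder[OF w0(2)] by auto
  have "openin (subtopology A.X ?C) D"
    unfolding D_def using F(3) openin_Int[OF opC(2) W(1)] by (rule openin_continuous_map_preimage)
  then have D: "openin A.X D" using opC openin_trans_full by blast
  have DC: "D \<subseteq> ?C" by (auto simp: D_def)
  have y0D: "y0 \<in> D" using y0 y0C hy0 w0C W by (auto simp: D_def)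
  define \<tau> where "\<tau> v = F' (F (0, v), h v)" for v
  let ?Y = "subtopology A.X D"
  have "continuous_map ?Y (RnT n) \<tau>"
  proof -
    have DC': "continuous_map ?Y (subtopology A.X ?C) (\<lambda>v. v)"
      using DC continuous_map_from_subtopology[OF continuous_map_id[unfolded id_def], of A.X D]
      by (auto simp: continuous_map_in_subtopology)
    have "continuous_map ?Y (prod_topology (RnT n) (subtopology A.X ?C)) (\<lambda>v. (0, v))"
      using DC' by (intro continuous_map_pairedI) auto
    from continuous_map_compose[OF this F(1)] have 1: "continuous_map ?Y (RnT n) (\<lambda>v. F (0, v))" by (simp add: o_def)
    have "continuous_map ?Y B.X h" using continuous_map_compose[OF DC' F(3)] by (simp add: o_def)
    then have 2: "continuous_map ?Y (subtopology B.X ?C') h" by (auto simp: continuous_map_in_subtopology D_def)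
    from continuous_map_compose[OF continuous_map_pairedI[OF 1 2] F'(1)] show ?thesis
      unfolding \<tau>_def by (simp add: o_def)
  qed
  then have "openin ?Y {v \<in> topspace ?Y. \<tau> v \<in> Rn n \<inter> ball 0 1}"
    by (rule openin_continuous_map_preimage) (simp add: openin_open_Int)
  then have "openin A.X {v \<in> topspace ?Y. \<tau> v \<in> Rn n \<inter> ball 0 1}" using D openin_trans_full by blast
  moreover have "y0 \<in> {v \<in> topspace ?Y. \<tau> v \<in> Rn n \<inter> ball 0 1}"
    using y0 y0D F(2) F'(2) hy0 by (simp add: \<tau>_def)
  ultimately obtain k where k: "A.cylinder k y0 \<subseteq> {v \<in> topspace ?Y. \<tau> v \<in> Rn n \<inter> ball 0 1}"
    by (rule A.cylinder_in_open)
  show ?thesis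
  proof (rule that[of "max l k"])
    fix v assume "v \<in> A.cylinder (max l k) y0"
    then have v0: "v \<in> {v \<in> topspace ?Y. \<tau> v \<in> Rn n \<inter> ball 0 1}" using A.cylinder_mono[OF y0, of k "max l k"] k by auto
    then have v: "v \<in> D" "v \<in> ?C" "\<tau> v \<in> Rn n" "dist 0 (\<tau> v) < 1" using DC by auto
    have vS: "v \<in> topspace A.S" using v CX A.X_subset_S by blast
    have hv: "h v \<in> ?C'" "h v \<in> W" using v(1) by (auto simp: D_def)
    have F0R: "F (0, v) \<in> Rn n"
      using F(1) v(2) CX by (auto simp: continuous_map_def)
    have "\<Psi> (\<Phi> v) = v" using inv vS by blast
    then have "v = \<Psi> (B.flow (F (0, v)) (h v))" using F(4)[OF v(2), of 0] vS by simp
    also have "\<dots> = A.flow (\<tau> v) (h' (h v))" using F'(4)[OF hv(1) F0R] by (simp add: \<tau>_def)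
    finally have veq: "v = A.flow (\<tau> v) (h' (h v))" .
    have "A.flow (\<tau> v) (h' (h v)) \<in> topspace A.X" using veq v CX by auto
    then have "\<tau> v \<in> Zn n" using A.flow_in_X_iff[OF h'X[OF hv(1)] v(3)] by blast
    then have "\<tau> v = 0" using Zn_discrete[of 0 n "\<tau> v"] v(4) by simp
    then have "h' (h v) = v" using veq A.X_subset_S[OF h'X[OF hv(1)]] by simp
    then show "h v \<in> W \<and> h v \<in> ?C' \<and> h' (h v) = v" using hv by blast
  qed simp
qed

lemma conjugate_local_action:
  assumes V: "openin A.X V" and y0: "y0 \<in> topspace A.X" "V \<subseteq> A.cylinder l y0"
    and W: "openin B.X W" and h: "homeomorphic_map (subtopology A.X V) (subtopology B.X W) h"
    and eqv: "\<And>g. g \<in> A.period l \<Longrightarrow> \<exists>d\<in>Zn n. \<forall>v\<in>V. A.flow g v \<in> V \<longrightarrow> h (A.flow g v) = B.flow d (h v)"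
  shows "conjugate_by h V ` local_action (fundamental_group (M1 0) x1) A.X (global_monodromy M1 p1) V
    \<subseteq> local_action (fundamental_group (M2 0) x2) B.X (global_monodromy M2 p2) W"
  unfolding A.local_action_monodromy B.local_action_monodromy
proof (rule image_subsetI)
  fix \<alpha> assume "\<alpha> \<in> {(U, restrict (A.flow z) U) |U z. openin A.X U \<and> U \<subseteq> V \<and> z \<in> Zn n \<and> A.flow z ` U \<subseteq> V}"
  then obtain U z where \<alpha>: "\<alpha> = (U, restrict (A.flow z) U)"
    and U: "openin A.X U" "U \<subseteq> V" "z \<in> Zn n" "A.flow z ` U \<subseteq> V"
    by blast
  have VX: "V \<subseteq> topspace A.X" and WX: "W \<subseteq> topspace B.X" using V W openin_subset by blast+
  have inj: "inj_on h V" using homeomorphic_imp_injective_map[OF h] VX by (simp add: Int_absorb1)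
  have hVW: "h ` V = W" using homeomorphic_imp_surjective_map[OF h] VX WX by (simp add: Int_absorb1)
  have "openin (subtopology A.X V) U" using U(1,2) openin_subset_topspace_eq by (metis inf.absorb_iff2 openin_subtopology inf.commute)
  then have "openin (subtopology B.X W) (h ` U)" using h homeomorphic_imp_open_map open_map_def by metis
  then have hU: "openin B.X (h ` U)" using W openin_trans_full by blast
  have "\<exists>d\<in>Zn n. \<forall>v\<in>U. h (A.flow z v) = B.flow d (h v)"
  \<comment> \<open>the empty map is a restriction of every group element\<close>
  proof (cases "U = {}")
    case True
    then show ?thesis by (intro bexI[of _ 0]) auto
  next
    case False
    then obtain v where v: "v \<in> U" by blast
    then have "z \<in> A.period l" using A.flow_in_cylinder_iff[OF y0(1), of v l z] U y0(2) by blast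
    from eqv[OF this] show ?thesis using U by blast
  qed
  then obtain d where d: "d \<in> Zn n" "\<And>v. v \<in> U \<Longrightarrow> h (A.flow z v) = B.flow d (h v)" by blast
  have "restrict (h \<circ> restrict (A.flow z) U \<circ> inv_into V h) (h ` U) = restrict (B.flow d) (h ` U)"
  proof (rule restrict_ext)
    fix w assume "w \<in> h ` U"
    then obtain v where v: "v \<in> U" "w = h v" by blast
    then have "inv_into V h w = v" using inv_into_f_f[OF inj] U(2) by blast
    then show "(h \<circ> restrict (A.flow z) U \<circ> inv_into V h) w = B.flow d w" using v d by simp
  qed
  moreover have "B.flow d ` h ` U \<subseteq> W"
  proof clarify
    fix v assume v: "v \<in> U"
    then have "h (A.flow z v) \<in> W" using U(4) hVW by blast
    then show "B.flow d (h v) \<in> W" using d(2)[OF v] by simp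
  qed
  moreover have "h ` U \<subseteq> W" using U(2) hVW by blast
  ultimately show "conjugate_by h V \<alpha> \<in>
      {(U, restrict (B.flow z) U) |U z. openin B.X U \<and> U \<subseteq> W \<and> z \<in> Zn n \<and> B.flow z ` U \<subseteq> W}"
    using hU d(1) unfolding conjugate_by_def \<alpha> by auto
qed

lemma homeomorphic_imp_return_equivalent:
  assumes "A.S homeomorphic_space B.S"
  shows "return_equivalent (fundamental_group (M1 0) x1) A.X (global_monodromy M1 p1)
    (fundamental_group (M2 0) x2) B.X (global_monodromy M2 p2)"
proof -
  interpret sw: two_towers n M2 p2 x2 u2 M1 p1 x1 u1 by (rule two_towers_swap) unfold_locales
  obtain f f' where f: "homeomorphic_maps A.S B.S f f'" using assms homeomorphic_space_def by blast
  then have fc: "continuous_map A.S B.S f" "continuous_map B.S A.S f'"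
    and ff: "\<And>s. s \<in> topspace A.S \<Longrightarrow> f' (f s) = s" "\<And>s. s \<in> topspace B.S \<Longrightarrow> f (f' s) = s"
    by (auto simp: homeomorphic_maps_def)
  define y0 where "y0 = (\<lambda>l. u1 l 0)"
  have y0: "y0 \<in> topspace A.X" unfolding y0_def by (rule A.base_point)
  then have y0S: "y0 \<in> topspace A.S" by (rule A.X_subset_S)
  have fy0: "f y0 \<in> topspace B.S" using fc(1) y0S by (auto simp: continuous_map_def)
  obtain t where t: "t \<in> Rn n" "f y0 0 = u2 0 t" using B.level_parameter[OF fy0] .
  define \<Phi> where "\<Phi> s = B.flow (- t) (f s)" for s
  define \<Psi> where "\<Psi> s = f' (B.flow t s)" for s
  have const: "continuous_map Y (RnT n) (\<lambda>_. a)" if "a \<in> Rn n" for a and Y :: "'z topology" using that by simp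
  have \<Phi>: "continuous_map A.S B.S \<Phi>" unfolding \<Phi>_def
    by (rule B.continuous_flow_compose[OF _ fc(1)]) (use t in simp)
  have "continuous_map B.S B.S (\<lambda>s. B.flow t s)"
    by (rule B.continuous_flow_compose) (use t in \<open>auto simp: continuous_map_id[unfolded id_def]\<close>)
  from continuous_map_compose[OF this fc(2)] have \<Psi>: "continuous_map B.S A.S \<Psi>" unfolding \<Psi>_def by (simp add: o_def)
  have \<Psi>\<Phi>: "\<forall>s\<in>topspace A.S. \<Psi> (\<Phi> s) = s"
  proof
    fix s assume that: "s \<in> topspace A.S"
    have "f s \<in> topspace B.S" using fc(1) that by (auto simp: continuous_map_def)
    then show "\<Psi> (\<Phi> s) = s" using B.flow_add[of "f s" t "- t"] t ff(1)[OF that] by (simp add: \<Phi>_def \<Psi>_def)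
  qed
  have \<Phi>\<Psi>: "\<forall>s\<in>topspace B.S. \<Phi> (\<Psi> s) = s"
  proof
    fix s assume s: "s \<in> topspace B.S"
    then show "\<Phi> (\<Psi> s) = s"
      using B.flow_add[OF s, of "- t" t] t ff(2)[of "B.flow t s"] by (simp add: \<Phi>_def \<Psi>_def)
  qed
  define w0 where "w0 = \<Phi> y0"
  have w0: "w0 \<in> topspace B.X"
    using B.flow_level[of "f y0" 0 t "- t"] t fy0 by (simp add: w0_def \<Phi>_def B.topspace_X B.u_base)
  have \<Psi>w0: "\<Psi> w0 = y0" using \<Psi>\<Phi> y0S by (simp add: w0_def)
  obtain l F h c where lift: "leafwise_lift \<Phi> y0 l F h c"
    using leafwise_lift_exists[OF \<Phi> y0] w0 unfolding w0_def by blast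
  obtain l' F' h' c' where lift': "sw.leafwise_lift \<Psi> w0 l' F' h' c'"
    using sw.leafwise_lift_exists[OF \<Psi> w0] \<Psi>w0 y0 by metis
  have eqv: "\<And>g v. g \<in> A.period l \<Longrightarrow> v \<in> A.cylinder l y0 \<Longrightarrow> c g \<in> Zn n \<and> h (A.flow g v) = B.flow (c g) (h v)"
    and hc: "continuous_map (subtopology A.X (A.cylinder l y0)) B.X h"
    using lift unfolding leafwise_lift_def by blast+
  have eqv': "\<And>g v. g \<in> B.period l' \<Longrightarrow> v \<in> B.cylinder l' w0 \<Longrightarrow> c' g \<in> Zn n \<and> h' (B.flow g v) = A.flow (c' g) (h' v)"
    and hc': "continuous_map (subtopology B.X (B.cylinder l' w0)) A.X h'"
    using lift' unfolding sw.leafwise_lift_def by blast+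
  obtain k' where k': "l' \<le> k'" "\<And>w. w \<in> B.cylinder k' w0 \<Longrightarrow> h' w \<in> A.cylinder l y0 \<and> h (h' w) = w"
  proof -
    have "y0 \<in> A.cylinder l y0" using y0 by (simp add: A.cylinder_def)
    then show thesis
      by (rule sw.leafwise_lift_round_trip[OF lift' w0 \<Psi>w0 y0 lift \<Phi>\<Psi> A.openin_cylinder[OF y0, of l]]) (rule that; blast)
  qed
  obtain k where k: "l \<le> k" "\<And>v. v \<in> A.cylinder k y0 \<Longrightarrow> h v \<in> B.cylinder k' w0 \<and> h' (h v) = v"
  proof -
    have "w0 \<in> B.cylinder k' w0" using w0 by (simp add: B.cylinder_def)
    then show thesis
      by (rule leafwise_lift_round_trip[OF lift y0 w0_def[symmetric] w0 lift' \<Psi>\<Phi> B.openin_cylinder[OF w0, of k']]) (rule that; blast)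
  qed
  define V where "V = A.cylinder k y0"
  define W where "W = h ` V"
  have VX: "V \<subseteq> topspace A.X" by (auto simp: V_def A.cylinder_def)
  have Vo: "openin A.X V" unfolding V_def by (rule A.openin_cylinder[OF y0])
  have Vl: "V \<subseteq> A.cylinder l y0" unfolding V_def by (rule A.cylinder_mono[OF y0 k(1)])
  have Wk': "W \<subseteq> B.cylinder k' w0" using k(2) by (auto simp: W_def V_def)
  have k'l': "B.cylinder k' w0 \<subseteq> B.cylinder l' w0" by (rule B.cylinder_mono[OF w0 k'(1)])
  have Dsub: "B.cylinder k' w0 \<subseteq> topspace B.X" by (auto simp: B.cylinder_def)
  have Do: "openin B.X (B.cylinder k' w0)" by (rule B.openin_cylinder[OF w0])
  have hD: "continuous_map (subtopology B.X (B.cylinder k' w0)) A.X h'"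
    using hc' k'l' continuous_map_from_subtopology_mono by blast
  have "W = {w \<in> topspace (subtopology B.X (B.cylinder k' w0)). h' w \<in> V}"
  proof (intro equalityI subsetI)
    fix w assume "w \<in> {w \<in> topspace (subtopology B.X (B.cylinder k' w0)). h' w \<in> V}"
    then have "h' w \<in> V" "h (h' w) = w" using k'(2) by auto
    then show "w \<in> W" unfolding W_def by (metis imageI)
  qed (use Wk' Dsub k(2) in \<open>auto simp: W_def V_def\<close>)
  then have "openin (subtopology B.X (B.cylinder k' w0)) W"
    using openin_continuous_map_preimage[OF hD Vo] by simp
  then have Wo: "openin B.X W" using Do openin_trans_full by blast
  have WX: "W \<subseteq> topspace B.X" using Wo openin_subset by blast
  have hm: "homeomorphic_maps (subtopology A.X V) (subtopology B.X W) h h'"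
    unfolding homeomorphic_maps_def
  proof (intro conjI ballI)
    show "continuous_map (subtopology A.X V) (subtopology B.X W) h"
      using hc Vl continuous_map_from_subtopology_mono[OF hc Vl] by (auto simp: continuous_map_in_subtopology W_def)
    show "continuous_map (subtopology B.X W) (subtopology A.X V) h'"
      using continuous_map_from_subtopology_mono[OF hD Wk'] k(2) by (auto simp: continuous_map_in_subtopology W_def V_def)
  qed (use k(2) in \<open>auto simp: W_def V_def\<close>)
  then have h: "homeomorphic_map (subtopology A.X V) (subtopology B.X W) h"
    and h': "homeomorphic_map (subtopology B.X W) (subtopology A.X V) h'"
    using homeomorphic_map_maps homeomorphic_maps_sym by blast+
  let ?LA = "local_action (fundamental_group (M1 0) x1) A.X (global_monodromy M1 p1) V"
  let ?LB = "local_action (fundamental_group (M2 0) x2) B.X (global_monodromy M2 p2) W"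
  have into: "conjugate_by h V ` ?LA \<subseteq> ?LB"
    by (rule conjugate_local_action[OF Vo y0 Vl Wo h]) (use eqv Vl y0 in \<open>force simp: A.cylinder_def\<close>)
  have into': "conjugate_by h' W ` ?LB \<subseteq> ?LA"
  proof (rule sw.conjugate_local_action[OF Wo w0 _ Vo h'])
    show "W \<subseteq> B.cylinder l' w0" using Wk' k'l' by blast
    then show "\<exists>d\<in>Zn n. \<forall>v\<in>W. B.flow g v \<in> W \<longrightarrow> h' (B.flow g v) = A.flow d (h' v)"
      if "g \<in> B.period l'" for g
      using eqv'[OF that] w0 by (intro bexI[of _ "c' g"]) (auto simp: B.cylinder_def)
  qed
  have hh': "h' (h v) = v" if "v \<in> V" for v using k(2) that by (simp add: V_def)
  have h'h: "h (h' w) = w" "h' w \<in> V" if "w \<in> W" for w using that hh' by (auto simp: W_def)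
  have inj: "inj_on h V" "inj_on h' W" using hh' h'h by (metis inj_onI)+
  have iV: "inv_into V h w = h' w" if "w \<in> W" for w using inv_into_f_f[OF inj(1) h'h(2)[OF that]] h'h(1)[OF that] by simp
  have iW: "inv_into W h' v = h v" if "v \<in> V" for v
    using inv_into_f_f[OF inj(2), of "h v"] hh'[OF that] that by (simp add: W_def)
  have undo: "conjugate_by h' W (conjugate_by h V \<alpha>) = \<alpha>" if "\<alpha> \<in> ?LA" for \<alpha>
  proof -
    obtain U z where U: "\<alpha> = (U, restrict (A.flow z) U)" "U \<subseteq> V" "A.flow z ` U \<subseteq> V"
      using \<open>\<alpha> \<in> ?LA\<close> unfolding A.local_action_monodromy by blast
    have im: "h' ` h ` U = U" using U(2) hh' by (force simp: image_iff)
    have "restrict (h' \<circ> restrict (h \<circ> restrict (A.flow z) U \<circ> inv_into V h) (h ` U) \<circ> inv_into W h') U = restrict (A.flow z) U"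
    proof (rule restrict_ext)
      fix v assume v: "v \<in> U"
      then have "v \<in> V" "A.flow z v \<in> V" "h v \<in> W" using U by (auto simp: W_def)
      then show "(h' \<circ> restrict (h \<circ> restrict (A.flow z) U \<circ> inv_into V h) (h ` U) \<circ> inv_into W h') v = A.flow z v"
        using v iW iV hh' by simp
    qed
    then show ?thesis unfolding U(1) conjugate_by_def by (simp add: im)
  qed
  have undo': "conjugate_by h V (conjugate_by h' W \<alpha>) = \<alpha>" if "\<alpha> \<in> ?LB" for \<alpha>
  proof -
    obtain U z where U: "\<alpha> = (U, restrict (B.flow z) U)" "U \<subseteq> W" "B.flow z ` U \<subseteq> W"
      using \<open>\<alpha> \<in> ?LB\<close> unfolding B.local_action_monodromy by blast
    have im: "h ` h' ` U = U" using U(2) h'h by (force simp: image_iff)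
    have "restrict (h \<circ> restrict (h' \<circ> restrict (B.flow z) U \<circ> inv_into W h') (h' ` U) \<circ> inv_into V h) U = restrict (B.flow z) U"
    proof (rule restrict_ext)
      fix v assume v: "v \<in> U"
      then have "v \<in> W" "B.flow z v \<in> W" "h' v \<in> V" using U h'h by auto
      then show "(h \<circ> restrict (h' \<circ> restrict (B.flow z) U \<circ> inv_into W h') (h' ` U) \<circ> inv_into V h) v = B.flow z v"
        using v iW iV h'h by simp
    qed
    then show ?thesis unfolding U(1) conjugate_by_def by (simp add: im)
  qed
  have "bij_betw (conjugate_by h V) ?LA ?LB"
    by (rule bij_betw_byWitness[where f' = "conjugate_by h' W"]) (use undo undo' into into' in auto)
  moreover have "y0 \<in> V" using y0 by (simp add: V_def A.cylinder_def)
  ultimately show ?thesis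
    unfolding return_equivalent_def using Vo Wo h by (intro exI[of _ V] exI[of _ W] exI[of _ h]) (auto simp: W_def)
qed

end

theorem theorem1p3:
  fixes n :: nat
    and M1 :: "nat \<Rightarrow> 'a topology" and p1 :: "nat \<Rightarrow> 'a \<Rightarrow> 'a" and x1 :: 'a
    and M2 :: "nat \<Rightarrow> 'b topology" and p2 :: "nat \<Rightarrow> 'b \<Rightarrow> 'b" and x2 :: 'b
    and \<MM>1 :: "'c topology" and \<MM>2 :: "'d topology"
  assumes "n \<ge> 1"
    and "toroidal_presentation n M1 p1" and "toroidal_presentation n M2 p2"
    and "\<MM>1 homeomorphic_space solenoid M1 p1" and "\<MM>2 homeomorphic_space solenoid M2 p2"
    and "x1 \<in> topspace (M1 0)" and "x2 \<in> topspace (M2 0)"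
  shows "\<MM>1 homeomorphic_space \<MM>2 \<longleftrightarrow>
    return_equivalent
      (fundamental_group (M1 0) x1) (base_fibre M1 p1 x1) (global_monodromy M1 p1)
      (fundamental_group (M2 0) x2) (base_fibre M2 p2 x2) (global_monodromy M2 p2)"
proof -
  obtain u1 where u1: "torus_tower n M1 p1 x1 u1"
    using toroidal_presentation_imp_torus_tower[OF assms(2,6)] by blast
  obtain u2 where u2: "torus_tower n M2 p2 x2 u2"
    using toroidal_presentation_imp_torus_tower[OF assms(3,7)] by blast
  interpret two_towers n M1 p1 x1 u1 M2 p2 x2 u2
    using u1 u2 by (simp add: two_towers_def)
  have "\<MM>1 homeomorphic_space \<MM>2 \<longleftrightarrow> A.S homeomorphic_space B.S"
    using assms(4,5) by (meson homeomorphic_space_sym homeomorphic_space_trans)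
  also have "\<dots> \<longleftrightarrow> return_equivalent
      (fundamental_group (M1 0) x1) A.X (global_monodromy M1 p1)
      (fundamental_group (M2 0) x2) B.X (global_monodromy M2 p2)"
    using homeomorphic_imp_return_equivalent return_equivalent_imp_homeomorphic
    unfolding return_equivalent_def by metis
  finally show ?thesis .
qed

end
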